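(* Let $a=(a_1,\dots,a_d):\mathbb{R}^d\to\mathbb{R}^d$, $b_j=(b_{1j},\dots,b_{dj}):\mathbb{R}^d\to\mathbb{R}^d$ ($j=1,\dots,m$), and let $x_0=(x_{0,1},\dots,x_{0,d})$ be an $\mathcal{F}_0$-measurable $\mathbb{R}^d$-valued random variable. Let $x(t)$, $t\in[0,T]$, be the solution of $$x(t)=x_0+\int_0^t a(x(s))\,ds+\sum_{j=1}^m\int_0^t b_j(x(s))\,dW_j(s).\qquad(\mathrm{SDE})$$ Suppose there are functions $f_i,g_{ij}:\mathbb{R}^d\times\mathbb{R}^d\to\mathbb{R}$ ($i=1,\dots,d$, $j=1,\dots,m$) with $f_i(u,u)=a_i(u)$ and $g_{ij}(u,u)=b_{ij}(u)$ for all $u\in\mathbb{R}^d$, such that for every $R>0$ there is a constant $C_R$ with $$|f_i(u_1,v_1)-f_i(u_2,v_2)|+|g_{ij}(u_1,v_1)-g_{ij}(u_2,v_2)|\le C_R\big(\|u_1-u_2\|_2+\|v_1-v_2\|_2\big)$$ for all $i,j$ and all $u_1,u_2,v_1,v_2\in\mathbb{R}^d$ with Euclidean norms at most $R$. For each integer $N\ge1$ put $\Delta=T/N$ and $t_k=k\Delta$, and suppose that the system $$y_i(t)=x_{0,i}+\int_0^t f_i(y(s),y(\hat s))\,ds+\sum_{j=1}^m\int_0^t g_{ij}(y(s),y(\hat s))\,dW_j(s),\quad i=1,\dots,d,\ t\in[0,T],\qquad(\mathrm{SD})$$ where $\hat s=t_k$ for $s\in[t_k,t_{k+1})$, has a unique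 strong solution $y=y^{\Delta}=(y_1,\dots,y_d)$. Suppose finally that there are $p>2$ and $A>0$ (not depending on $\Delta$) such that $\mathbb{E}\|x_0\|_2^p<A$ and, for every $\Delta=T/N$, $$\mathbb{E}\Big(\sup_{0\le t\le T}\|x(t)\|_2^p\Big)<A,\qquad \mathbb{E}\Big(\sup_{0\le t\le T}\|y^{\Delta}(t)\|_2^p\Big)<A.$$ Then $$\lim_{\Delta\to0}\mathbb{E}\sup_{0\le t\le T}\|y^{\Delta}(t)-x(t)\|_2^2=0.$$
   Context: $T>0$ is fixed and $(\Omega,\mathcal{F},\{\mathcal{F}_t\}_{0\le t\le T},\mathbf{P})$ is a complete filtered probability space satisfying the usual conditions (the filtration is right continuous and $\mathcal{F}_0$ contains all $\mathbf{P}$-null sets). $W=(W_1,\dots,W_m)$ is an $m$-dimensional Wiener process on this space with respect to $\{\mathcal{F}_t\}$. $\|\cdot\|_2$ is the Euclidean norm on $\mathbb{R}^d$. $\Delta\to0$ means $N\to\infty$ with $\Delta=T/N$. The process $y^\Delta$ is called the semi-discrete approximation of $x$ (only the second argument of $f_i,g_{ij}$ is frozen at the grid points). *)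

theory Defs
  imports "HOL-Probability.Probability"
begin

section \<open>Filtered probability spaces on a bounded time interval\<close>

text \<open>
  Processes and filtrations are indexed by all of \<^typ>\<open>real\<close>, but only their values at times in
  \<open>[0, T]\<close> are ever constrained or used.
\<close>

locale usual_filtered_prob_space = prob_space M + complete_measure M
  for M :: "'a measure" +
  fixes F :: "real \<Rightarrow> 'a measure" and T :: real
  assumes T_pos: "0 < T"
    and subalgebra_F: "\<And>t. t \<in> {0..T} \<Longrightarrow> subalgebra M (F t)"
    and F_mono: "\<And>s t. 0 \<le> s \<Longrightarrow> s \<le> t \<Longrightarrow> t \<le> T \<Longrightarrow> sets (F s) \<subseteq> sets (F t)"
    and F_right_continuous: "\<And>t. 0 \<le> t \<Longrightarrow> t < T \<Longrightarrow> sets (F t) = (\<Inter>s\<in>{t<..T}. sets (F s))"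
    and null_sets_F: "null_sets M \<subseteq> sets (F 0)"

definition adapted ::
    "(real \<Rightarrow> 'a measure) \<Rightarrow> real \<Rightarrow> (real \<Rightarrow> 'a \<Rightarrow> 'b::topological_space) \<Rightarrow> bool" where
  "adapted F T X \<longleftrightarrow> (\<forall>t\<in>{0..T}. X t \<in> borel_measurable (F t))"

definition ae_continuous ::
    "'a measure \<Rightarrow> real \<Rightarrow> (real \<Rightarrow> 'a \<Rightarrow> 'b::topological_space) \<Rightarrow> bool" where
  "ae_continuous M T X \<longleftrightarrow> (AE \<omega> in M. continuous_on {0..T} (\<lambda>t. X t \<omega>))"

definition progressively_measurable ::
    "(real \<Rightarrow> 'a measure) \<Rightarrow> real \<Rightarrow> (real \<Rightarrow> 'a \<Rightarrow> real) \<Rightarrow> bool" where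
  "progressively_measurable F T H \<longleftrightarrow>
     (\<forall>t\<in>{0..T}. (\<lambda>(s, \<omega>). H s \<omega>) \<in> borel_measurable (restrict_space borel {0..t} \<Otimes>\<^sub>M F t))"

definition indistinguishable ::
    "'a measure \<Rightarrow> real \<Rightarrow> (real \<Rightarrow> 'a \<Rightarrow> 'b) \<Rightarrow> (real \<Rightarrow> 'a \<Rightarrow> 'b) \<Rightarrow> bool" where
  "indistinguishable M T X Y \<longleftrightarrow> (AE \<omega> in M. \<forall>t\<in>{0..T}. X t \<omega> = Y t \<omega>)"

text \<open>
  The increment over \<open>[s, t]\<close> has law \<open>N(0, (t - s) I)\<close>, i.e. its components are
  independent with law \<open>N(0, t - s)\<close>; \<^const>\<open>normal_density\<close> takes the standard deviation.
\<close>

definition wiener_process ::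
    "'a measure \<Rightarrow> (real \<Rightarrow> 'a measure) \<Rightarrow> real \<Rightarrow> (real \<Rightarrow> 'a \<Rightarrow> real ^ 'm) \<Rightarrow> bool" where
  "wiener_process M F T W \<longleftrightarrow>
     adapted F T W \<and> ae_continuous M T W \<and> (AE \<omega> in M. W 0 \<omega> = 0) \<and>
     (\<forall>s t. 0 \<le> s \<and> s < t \<and> t \<le> T \<longrightarrow>
        prob_space.indep_set M (sets (F s))
          (sets (vimage_algebra (space M) (\<lambda>\<omega>. W t \<omega> - W s \<omega>) borel)) \<and>
        prob_space.indep_vars M (\<lambda>_. borel) (\<lambda>j \<omega>. (W t \<omega> - W s \<omega>) $ j) UNIV \<and>
        (\<forall>j. distributed M lborel (\<lambda>\<omega>. (W t \<omega> - W s \<omega>) $ j)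
               (\<lambda>z. ennreal (normal_density 0 (sqrt (t - s)) z))))"


section \<open>The Ito integral\<close>

text \<open>
  A simple integrand is \<open>\<Sum>k<n. \<xi>\<^sub>k 1\<^bsub>(s\<^sub>k, s\<^sub>k\<^sub>+\<^sub>1]\<^esub>\<close> with
  \<open>0 \<le> s\<^sub>0 \<le> \<dots> \<le> s\<^sub>n \<le> T\<close> and \<open>\<xi>\<^sub>k\<close> bounded and measurable at time \<open>s\<^sub>k\<close>.
\<close>

definition simple_integrand ::
    "'a measure \<Rightarrow> (real \<Rightarrow> 'a measure) \<Rightarrow> real \<Rightarrow> nat \<Rightarrow> (nat \<Rightarrow> real) \<Rightarrow> (nat \<Rightarrow> 'a \<Rightarrow> real) \<Rightarrow> bool"
  where
  "simple_integrand M F T n s \<xi> \<longleftrightarrow>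
     mono_on {..n} s \<and> s ` {..n} \<subseteq> {0..T} \<and>
     (\<forall>k<n. \<xi> k \<in> borel_measurable (F (s k)) \<and> (\<exists>C. \<forall>\<omega>\<in>space M. \<bar>\<xi> k \<omega>\<bar> \<le> C))"

definition simple_value ::
    "nat \<Rightarrow> (nat \<Rightarrow> real) \<Rightarrow> (nat \<Rightarrow> 'a \<Rightarrow> real) \<Rightarrow> real \<Rightarrow> 'a \<Rightarrow> real" where
  "simple_value n s \<xi> t \<omega> = (\<Sum>k<n. \<xi> k \<omega> * indicator {s k<..s (Suc k)} t)"

definition simple_integral ::
    "(real \<Rightarrow> 'a \<Rightarrow> real) \<Rightarrow> nat \<Rightarrow> (nat \<Rightarrow> real) \<Rightarrow> (nat \<Rightarrow> 'a \<Rightarrow> real) \<Rightarrow> real \<Rightarrow> 'a \<Rightarrow> real" where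
  "simple_integral B n s \<xi> t \<omega> =
     (\<Sum>k<n. \<xi> k \<omega> * (B (min (s (Suc k)) t) \<omega> - B (min (s k) t) \<omega>))"

definition tendsto_zero_in_prob :: "'a measure \<Rightarrow> (nat \<Rightarrow> 'a \<Rightarrow> ennreal) \<Rightarrow> bool" where
  "tendsto_zero_in_prob M Z \<longleftrightarrow>
     (\<forall>\<epsilon>>0. (\<lambda>n. emeasure M {\<omega> \<in> space M. ennreal \<epsilon> < Z n \<omega>}) \<longlonglongrightarrow> 0)"

text \<open>
  \<open>ito_integral M F T B H I\<close> says that \<open>I\<close> is a version of the process
  \<open>t \<mapsto> \<integral>\<^sub>0\<^sup>t H dB\<close> for a scalar Wiener process \<open>B\<close> and a progressively measurable \<open>H\<close> with
  almost surely square integrable paths: the continuous adapted process that is the limit,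
  uniformly on \<open>[0, T]\<close> in probability, of the elementary integrals of simple integrands
  \<open>H\<^sub>n\<close> with \<open>\<integral>\<^sub>0\<^sup>T (H\<^sub>n - H)\<^sup>2 dt \<rightarrow> 0\<close> in probability.  It is a relation since \<open>I\<close> is
  determined only up to indistinguishability.  The suprema over the uncountable set \<open>[0, T]\<close> are
  measurable because the paths are almost surely continuous and \<open>M\<close> is complete.
\<close>

definition ito_integral ::
    "'a measure \<Rightarrow> (real \<Rightarrow> 'a measure) \<Rightarrow> real \<Rightarrow> (real \<Rightarrow> 'a \<Rightarrow> real) \<Rightarrow>
     (real \<Rightarrow> 'a \<Rightarrow> real) \<Rightarrow> (real \<Rightarrow> 'a \<Rightarrow> real) \<Rightarrow> bool" where
  "ito_integral M F T B H I \<longleftrightarrow>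
     progressively_measurable F T H \<and>
     (AE \<omega> in M. (\<integral>\<^sup>+t\<in>{0..T}. ennreal ((H t \<omega>)\<^sup>2) \<partial>lborel) < \<infinity>) \<and>
     adapted F T I \<and> ae_continuous M T I \<and>
     (\<exists>n s \<xi>.
        (\<forall>l::nat. simple_integrand M F T (n l) (s l) (\<xi> l)) \<and>
        tendsto_zero_in_prob M
          (\<lambda>l \<omega>. \<integral>\<^sup>+t\<in>{0..T}. ennreal ((simple_value (n l) (s l) (\<xi> l) t \<omega> - H t \<omega>)\<^sup>2) \<partial>lborel) \<and>
        tendsto_zero_in_prob M
          (\<lambda>l \<omega>. SUP t\<in>{0..T}. ennreal \<bar>simple_integral B (n l) (s l) (\<xi> l) t \<omega> - I t \<omega>\<bar>))"


section \<open>Stochastic differential equations\<close>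

definition ito_process ::
    "'a measure \<Rightarrow> (real \<Rightarrow> 'a measure) \<Rightarrow> real \<Rightarrow> (real \<Rightarrow> 'a \<Rightarrow> real ^ 'm) \<Rightarrow> ('a \<Rightarrow> real ^ 'd) \<Rightarrow>
     ('d \<Rightarrow> real \<Rightarrow> 'a \<Rightarrow> real) \<Rightarrow> ('d \<Rightarrow> 'm \<Rightarrow> real \<Rightarrow> 'a \<Rightarrow> real) \<Rightarrow>
     (real \<Rightarrow> 'a \<Rightarrow> real ^ 'd) \<Rightarrow> bool" where
  "ito_process M F T W X0 \<alpha> \<beta> X \<longleftrightarrow>
     adapted F T X \<and> ae_continuous M T X \<and>
     (\<forall>i. AE \<omega> in M. set_integrable lborel {0..T} (\<lambda>s. \<alpha> i s \<omega>)) \<and>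
     (\<exists>I. (\<forall>i j. ito_integral M F T (\<lambda>t \<omega>. W t \<omega> $ j) (\<beta> i j) (I i j)) \<and>
          (\<forall>i. AE \<omega> in M. \<forall>t\<in>{0..T}.
             X t \<omega> $ i = X0 \<omega> $ i + (LINT s:{0..t}|lborel. \<alpha> i s \<omega>) + (\<Sum>j\<in>UNIV. I i j t \<omega>)))"

definition sde_solution ::
    "'a measure \<Rightarrow> (real \<Rightarrow> 'a measure) \<Rightarrow> real \<Rightarrow> (real \<Rightarrow> 'a \<Rightarrow> real ^ 'm) \<Rightarrow> ('a \<Rightarrow> real ^ 'd) \<Rightarrow>
     (real ^ 'd \<Rightarrow> real ^ 'd) \<Rightarrow> ('m \<Rightarrow> real ^ 'd \<Rightarrow> real ^ 'd) \<Rightarrow>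
     (real \<Rightarrow> 'a \<Rightarrow> real ^ 'd) \<Rightarrow> bool" where
  "sde_solution M F T W x0 a b x \<longleftrightarrow>
     ito_process M F T W x0 (\<lambda>i s \<omega>. a (x s \<omega>) $ i) (\<lambda>i j s \<omega>. b j (x s \<omega>) $ i) x"

definition grid_point :: "real \<Rightarrow> real \<Rightarrow> real" where
  "grid_point \<Delta> s = of_int \<lfloor>s / \<Delta>\<rfloor> * \<Delta>"

lemma grid_point_eq:
  assumes "0 < \<Delta>" "s \<in> {real k * \<Delta>..<real (Suc k) * \<Delta>}"
  shows "grid_point \<Delta> s = real k * \<Delta>"
proof -
  have "\<lfloor>s / \<Delta>\<rfloor> = int k"
    using assms by (intro floor_unique) (auto simp: field_simps)
  then show ?thesis
    by (simp add: grid_point_def)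
qed

definition semi_discrete_solution ::
    "'a measure \<Rightarrow> (real \<Rightarrow> 'a measure) \<Rightarrow> real \<Rightarrow> (real \<Rightarrow> 'a \<Rightarrow> real ^ 'm) \<Rightarrow> ('a \<Rightarrow> real ^ 'd) \<Rightarrow>
     ('d \<Rightarrow> real ^ 'd \<Rightarrow> real ^ 'd \<Rightarrow> real) \<Rightarrow> ('d \<Rightarrow> 'm \<Rightarrow> real ^ 'd \<Rightarrow> real ^ 'd \<Rightarrow> real) \<Rightarrow>
     real \<Rightarrow> (real \<Rightarrow> 'a \<Rightarrow> real ^ 'd) \<Rightarrow> bool" where
  "semi_discrete_solution M F T W x0 f g \<Delta> y \<longleftrightarrow>
     ito_process M F T W x0
       (\<lambda>i s \<omega>. f i (y s \<omega>) (y (grid_point \<Delta> s) \<omega>))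
       (\<lambda>i j s \<omega>. g i j (y s \<omega>) (y (grid_point \<Delta> s) \<omega>)) y"

definition unique_semi_discrete_solution ::
    "'a measure \<Rightarrow> (real \<Rightarrow> 'a measure) \<Rightarrow> real \<Rightarrow> (real \<Rightarrow> 'a \<Rightarrow> real ^ 'm) \<Rightarrow> ('a \<Rightarrow> real ^ 'd) \<Rightarrow>
     ('d \<Rightarrow> real ^ 'd \<Rightarrow> real ^ 'd \<Rightarrow> real) \<Rightarrow> ('d \<Rightarrow> 'm \<Rightarrow> real ^ 'd \<Rightarrow> real ^ 'd \<Rightarrow> real) \<Rightarrow>
     real \<Rightarrow> (real \<Rightarrow> 'a \<Rightarrow> real ^ 'd) \<Rightarrow> bool" where
  "unique_semi_discrete_solution M F T W x0 f g \<Delta> y \<longleftrightarrow>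
     semi_discrete_solution M F T W x0 f g \<Delta> y \<and>
     (\<forall>z. semi_discrete_solution M F T W x0 f g \<Delta> z \<longrightarrow> indistinguishable M T z y)"

end

theory Submission
  imports Defs
begin

text \<open>
  The error \<open>e = y\<^sup>\<Delta> - x\<close> is stopped at the first time \<open>\<tau>\<close> at which \<open>x\<close> or \<open>y\<^sup>\<Delta>\<close> leaves
  the ball of radius \<open>R\<close>, or \<open>x\<close> moves by more than \<open>\<eta>\<close> away from its value at the last grid point.
  Up to \<open>\<tau>\<close> the local Lipschitz condition bounds the drift and the diffusion of \<open>e\<close> by
  \<open>C\<^sub>R (2 sup\<^bsub>r \<le> s\<^esub> \<parallel>e(r)\<parallel> + \<eta>)\<close>, so Doob's inequality and a Gronwall argument give
  \<open>E sup\<^bsub>t \<le> \<tau>\<^esub> \<parallel>e(t)\<parallel>\<^sup>2 \<le> K\<^sub>R \<eta>\<^sup>2\<close> with \<open>K\<^sub>R\<close> independent of \<open>\<Delta>\<close> and \<open>\<eta>\<close>.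
  The moments of order \<open>p > 2\<close> control the complement of \<open>{\<tau> \<ge> T}\<close>, whose probability is small
  for \<open>R\<close> large and then \<open>\<Delta>\<close> small by uniform continuity of the paths of \<open>x\<close>.

  No martingale theory is needed. Doob's \<open>L\<^sup>2\<close> inequality follows for simple integrands from
  a pathwise inequality and the independence of increments, and passes to the limit by Fatou's lemma.
\<close>

text \<open>An Ito integral is stopped through its integrand. Multiplying the coefficient of a grid
  cell by the survival indicator at the left end of the cell keeps it measurable at that end, so the
  product is again a simple integrand. It stops up to one mesh too late, and the left-continuity of
  the indicator repairs this as the mesh tends to 0.

  The oscillation condition in \<tau> is imposed on x and not on the approximation because x does
  not change with \<Delta>: one uniformly continuous path serves all grids, while no modulus of
  continuity common to all approximations is at hand.

  The order of the choices carries the final argument: a truncation level L for the size of the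
  error, then R depending on L, then the constant of the stopped estimate, then \<eta>, and \<Delta>
  last.\<close>

section \<open>Doob's inequality, path by path\<close>

text \<open>The sum is a discrete stochastic integral of the running maximum against
  \<open>\<bar>m\<bar>\<close>. For a martingale \<open>m\<close> the process
  \<open>\<bar>m\<bar>\<close> is a submartingale, so the sum has nonnegative expectation and drops
  out, which leaves Doob's constant 4.\<close>

lemma running_max_square_le:
  fixes m a :: "nat \<Rightarrow> real"
  assumes a0: "a 0 = \<bar>m 0\<bar>" and aSuc: "\<And>k. a (Suc k) = max (a k) \<bar>m (Suc k)\<bar>"
  shows "(a n)\<^sup>2 \<le> 4 * (m n)\<^sup>2 - 4 * (\<Sum>k<n. a k * (\<bar>m (Suc k)\<bar> - \<bar>m k\<bar>))"
proof -
  \<comment> \<open>Summation by parts, using that \<open>a\<close> grows only at indices where the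
    new maximum equals \<open>\<bar>m\<bar>\<close>; the growth of the square is then bounded by
    completing a square.\<close>
  have "(a n)\<^sup>2 \<le> 2 * a n * \<bar>m n\<bar> - 2 * (\<Sum>k<n. a k * (\<bar>m (Suc k)\<bar> - \<bar>m k\<bar>))"
  proof (induction n)
    case 0
    then show ?case by (simp add: a0 power2_eq_square mult.assoc)
  next
    case (Suc n)
    have "(a (Suc n))\<^sup>2 \<le> 2 * (a (Suc n) - a n) * \<bar>m (Suc n)\<bar> + (a n)\<^sup>2"
    proof (cases "\<bar>m (Suc n)\<bar> \<le> a n")
      case True
      then show ?thesis by (simp add: aSuc max_absorb1)
    next
      case False
      then have "a (Suc n) = \<bar>m (Suc n)\<bar>" by (simp add: aSuc)
      moreover have "0 \<le> (\<bar>m (Suc n)\<bar> - a n)\<^sup>2" by simp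
      ultimately show ?thesis by (simp add: power2_eq_square algebra_simps)
    qed
    with Suc.IH show ?case by (simp add: algebra_simps)
  qed
  \<comment> \<open>Weighted so that half of \<open>(a n)\<^sup>2\<close> stays on the left;
    doubling then gives the factor 4.\<close>
  moreover have "2 * a n * \<bar>m n\<bar> \<le> (a n)\<^sup>2 / 2 + 2 * (m n)\<^sup>2"
    using zero_le_power2[of "a n - 2 * \<bar>m n\<bar>"] by (simp add: power2_eq_square algebra_simps)
  ultimately show ?thesis by (simp add: algebra_simps)
qed

context usual_filtered_prob_space
begin

lemma space_F: "t \<in> {0..T} \<Longrightarrow> space (F t) = space M"
  using subalgebra_F by (simp add: subalgebra_def)

lemma measurable_F_M: "t \<in> {0..T} \<Longrightarrow> X \<in> measurable (F t) N \<Longrightarrow> X \<in> measurable M N"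
  using subalgebra_F measurable_from_subalg by blast

lemma measurable_F_mono:
  assumes "0 \<le> s" "s \<le> t" "t \<le> T" "X \<in> measurable (F s) N"
  shows "X \<in> measurable (F t) N"
proof -
  have "subalgebra (F t) (F s)"
    using assms F_mono by (auto simp: subalgebra_def space_F)
  then show ?thesis using assms(4) measurable_from_subalg by blast
qed

end

section \<open>Increments of a scalar Wiener process\<close>

text \<open>Independence is stated for single random variables \<open>Z\<close> known at time
  \<open>s\<close>, the form in which the expectation of a product of a past factor and an increment
  factorises.\<close>

locale scalar_wiener = usual_filtered_prob_space M F T
  for M :: "'a measure" and F T +
  fixes B :: "real \<Rightarrow> 'a \<Rightarrow> real"
  assumes B_adapted: "\<And>t. t \<in> {0..T} \<Longrightarrow> B t \<in> borel_measurable (F t)"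
    and B_continuous: "ae_continuous M T B"
    and B_indep: "\<And>s t Z. 0 \<le> s \<Longrightarrow> s < t \<Longrightarrow> t \<le> T \<Longrightarrow> Z \<in> borel_measurable (F s) \<Longrightarrow>
      indep_var borel (Z :: 'a \<Rightarrow> real) borel (\<lambda>\<omega>. B t \<omega> - B s \<omega>)"
    and B_normal: "\<And>s t. 0 \<le> s \<Longrightarrow> s < t \<Longrightarrow> t \<le> T \<Longrightarrow>
      distributed M lborel (\<lambda>\<omega>. B t \<omega> - B s \<omega>) (\<lambda>z. ennreal (normal_density 0 (sqrt (t - s)) z))"
begin

lemma increment_moments:
  assumes "0 \<le> s" "s \<le> t" "t \<le> T"
  shows "integrable M (\<lambda>\<omega>. B t \<omega> - B s \<omega>)" (is ?A)
    and "expectation (\<lambda>\<omega>. B t \<omega> - B s \<omega>) = 0" (is ?B)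
    and "integrable M (\<lambda>\<omega>. (B t \<omega> - B s \<omega>)\<^sup>2)" (is ?C)
    and "expectation (\<lambda>\<omega>. (B t \<omega> - B s \<omega>)\<^sup>2) = t - s" (is ?D)
proof -
  have "?A \<and> ?B \<and> ?C \<and> ?D"
  proof (cases "s = t")
    case False
    then have st: "s < t" using assms by simp
    note D = B_normal[OF assms(1) st assms(3)]
    have pos: "0 < sqrt (t - s)" using st by simp
    have e: "expectation (\<lambda>\<omega>. B t \<omega> - B s \<omega>) = 0"
      using normal_distributed_expectation[OF pos D] .
    have v: "expectation (\<lambda>\<omega>. (B t \<omega> - B s \<omega>)\<^sup>2) = t - s"
      using normal_distributed_variance[OF pos D] st by (simp add: e)
    have i1: "integrable M (\<lambda>\<omega>. B t \<omega> - B s \<omega>)"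
      using distributed_integrable[OF D, of "\<lambda>x. x"] integrable_normal_moment_nz_1[OF pos, of 0] by simp
    have i2: "integrable M (\<lambda>\<omega>. (B t \<omega> - B s \<omega>)\<^sup>2)"
      using distributed_integrable[OF D, of "\<lambda>x. x\<^sup>2"] integrable_normal_moment[OF pos, of 0 2] by simp
    show ?thesis using e v i1 i2 by simp
  qed simp
  then show ?A ?B ?C ?D by blast+
qed

text \<open>This takes the place of conditional expectations: the first two claims are the
  martingale property tested against the past, the last two the quadratic variation. Both come from
  factorising expectations of independent variables.\<close>

lemma increment_times_past:
  assumes st: "0 \<le> s" "s \<le> t" "t \<le> T" and Z: "Z \<in> borel_measurable (F s)" "integrable M Z"
  shows "integrable M (\<lambda>\<omega>. Z \<omega> * (B t \<omega> - B s \<omega>))" (is ?A)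
    and "expectation (\<lambda>\<omega>. Z \<omega> * (B t \<omega> - B s \<omega>)) = 0" (is ?B)
    and "integrable M (\<lambda>\<omega>. Z \<omega> * (B t \<omega> - B s \<omega>)\<^sup>2)" (is ?C)
    and "expectation (\<lambda>\<omega>. Z \<omega> * (B t \<omega> - B s \<omega>)\<^sup>2) = expectation Z * (t - s)" (is ?D)
proof -
  have "?A \<and> ?B \<and> ?C \<and> ?D"
  proof (cases "s = t")
    case False
    then have "s < t" using st by simp
    note I = B_indep[OF st(1) this st(3) Z(1)]
    have "indep_var borel ((\<lambda>z. z) \<circ> Z) borel ((\<lambda>z. z\<^sup>2) \<circ> (\<lambda>\<omega>. B t \<omega> - B s \<omega>))"
      by (rule indep_var_compose[OF I]) auto
    then have I2: "indep_var borel Z borel (\<lambda>\<omega>. (B t \<omega> - B s \<omega>)\<^sup>2)"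
      by (simp add: comp_def)
    note m = increment_moments[OF st]
    show ?thesis
      using indep_var_integrable[OF I Z(2) m(1)] indep_var_lebesgue_integral[OF I Z(2) m(1)]
        indep_var_integrable[OF I2 Z(2) m(3)] indep_var_lebesgue_integral[OF I2 Z(2) m(3)] m
      by simp
  qed simp
  then show ?A ?B ?C ?D by blast+
qed

end

lemma integrable_bounded_mult:
  fixes X Y :: "'a \<Rightarrow> real"
  assumes "integrable M X" "Y \<in> borel_measurable M" "\<And>\<omega>. \<omega> \<in> space M \<Longrightarrow> \<bar>Y \<omega>\<bar> \<le> C"
  shows "integrable M (\<lambda>\<omega>. Y \<omega> * X \<omega>)"
proof (rule Bochner_Integration.integrable_bound)
  show "integrable M (\<lambda>\<omega>. C * X \<omega>)" using assms(1) by simp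
  show "(\<lambda>\<omega>. Y \<omega> * X \<omega>) \<in> borel_measurable M" using assms by measurable
  show "AE \<omega> in M. norm (Y \<omega> * X \<omega>) \<le> norm (C * X \<omega>)"
  proof (rule AE_I2)
    fix \<omega> assume "\<omega> \<in> space M"
    then have "\<bar>Y \<omega>\<bar> \<le> \<bar>C\<bar>" using assms(3)[of \<omega>] by linarith
    then show "norm (Y \<omega> * X \<omega>) \<le> norm (C * X \<omega>)"
      by (simp add: abs_mult mult_right_mono)
  qed
qed

lemma (in finite_measure) integrable_of_square:
  fixes X :: "'a \<Rightarrow> real"
  assumes "X \<in> borel_measurable M" "integrable M (\<lambda>\<omega>. (X \<omega>)\<^sup>2)"
  shows "integrable M X"
proof (rule Bochner_Integration.integrable_bound)
  show "integrable M (\<lambda>\<omega>. 1 + (X \<omega>)\<^sup>2)" using assms(2) by simp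
  have "\<bar>x\<bar> \<le> 1 + x\<^sup>2" for x :: real
    using zero_le_power2[of "\<bar>x\<bar> - 1 / 2"] by (simp add: power2_eq_square algebra_simps)
  then show "AE \<omega> in M. norm (X \<omega>) \<le> norm (1 + (X \<omega>)\<^sup>2)" by (auto simp: abs_of_nonneg)
qed (use assms in auto)

lemma integrable_square_add:
  fixes X Y :: "'a \<Rightarrow> real"
  assumes "X \<in> borel_measurable M" "Y \<in> borel_measurable M"
    "integrable M (\<lambda>\<omega>. (X \<omega>)\<^sup>2)" "integrable M (\<lambda>\<omega>. (Y \<omega>)\<^sup>2)"
  shows "integrable M (\<lambda>\<omega>. (X \<omega> + Y \<omega>)\<^sup>2)"
proof (rule Bochner_Integration.integrable_bound)
  show "integrable M (\<lambda>\<omega>. 2 * (X \<omega>)\<^sup>2 + 2 * (Y \<omega>)\<^sup>2)" using assms by simp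
  have "(x + y)\<^sup>2 \<le> 2 * x\<^sup>2 + 2 * y\<^sup>2" for x y :: real
    using zero_le_power2[of "x - y"] by (simp add: power2_eq_square algebra_simps)
  then show "AE \<omega> in M. norm ((X \<omega> + Y \<omega>)\<^sup>2) \<le> norm (2 * (X \<omega>)\<^sup>2 + 2 * (Y \<omega>)\<^sup>2)"
    by (auto intro: order_trans)
qed (use assms in auto)

primrec running_max :: "(nat \<Rightarrow> real) \<Rightarrow> nat \<Rightarrow> real" where
  "running_max m 0 = \<bar>m 0\<bar>"
| "running_max m (Suc k) = max (running_max m k) \<bar>m (Suc k)\<bar>"

lemma abs_le_running_max: "k \<le> n \<Longrightarrow> \<bar>m k\<bar> \<le> running_max m n"
proof (induction n)
  case (Suc n)
  then show ?case by (cases "k = Suc n") (auto simp: max.coboundedI1)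
qed simp

lemma running_max_nonneg: "0 \<le> running_max m n"
  using abs_le_running_max[of 0 n m] by simp

lemma running_max_square_le_sum: "(running_max m n)\<^sup>2 \<le> (\<Sum>k\<le>n. (m k)\<^sup>2)"
proof (induction n)
  case (Suc n)
  show ?case
  proof (cases "running_max m n \<le> \<bar>m (Suc n)\<bar>")
    case True
    then show ?thesis by (simp add: max_absorb2 sum_nonneg)
  next
    case False
    then show ?thesis using Suc by (simp add: max_absorb1 add_increasing2)
  qed
qed simp

section \<open>Elementary integrals on a grid\<close>

context scalar_wiener
begin

context
  fixes n :: nat and p :: "nat \<Rightarrow> real" and \<xi> :: "nat \<Rightarrow> 'a \<Rightarrow> real"
  assumes p_mono: "mono_on {..n} p" and p_range: "p ` {..n} \<subseteq> {0..T}"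
    and \<xi>_meas: "\<And>k. k < n \<Longrightarrow> \<xi> k \<in> borel_measurable (F (p k))"
    and \<xi>_bounded: "\<And>k. k < n \<Longrightarrow> \<exists>C. \<forall>\<omega>\<in>space M. \<bar>\<xi> k \<omega>\<bar> \<le> C"
begin

text \<open>The integral sampled at grid points only, a square integrable discrete martingale. Other
  times are reached later by adding them to the grid.\<close>

private definition X :: "'a \<Rightarrow> nat \<Rightarrow> real" where
  "X \<omega> k = (\<Sum>j<k. \<xi> j \<omega> * (B (p (Suc j)) \<omega> - B (p j) \<omega>))"

private lemma p_in: "k \<le> n \<Longrightarrow> p k \<in> {0..T}"
  using p_range by auto

private lemma p_le: "k < n \<Longrightarrow> p k \<le> p (Suc k)"
  using p_mono by (auto simp: mono_on_def)

private lemma p_Suc: "k < n \<Longrightarrow> 0 \<le> p k \<and> p k \<le> p (Suc k) \<and> p (Suc k) \<le> T"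
  using p_in[of k] p_in[of "Suc k"] p_le[of k] by auto

private lemma X_meas: "k \<le> n \<Longrightarrow> (\<lambda>\<omega>. X \<omega> k) \<in> borel_measurable (F (p k))"
proof (induction k)
  case (Suc k)
  then have k: "k < n" by simp
  have [measurable]: "(\<lambda>\<omega>. X \<omega> k) \<in> borel_measurable (F (p (Suc k)))"
    using Suc p_Suc[OF k] by (intro measurable_F_mono[of "p k" "p (Suc k)"]) auto
  have [measurable]: "\<xi> k \<in> borel_measurable (F (p (Suc k)))"
    using p_Suc[OF k] by (intro measurable_F_mono[OF _ _ _ \<xi>_meas[OF k]]) auto
  have [measurable]: "B (p k) \<in> borel_measurable (F (p (Suc k)))"
    using p_Suc[OF k] by (intro measurable_F_mono[OF _ _ _ B_adapted]) auto
  have [measurable]: "B (p (Suc k)) \<in> borel_measurable (F (p (Suc k)))"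
    using p_Suc[OF k] by (intro B_adapted) auto
  have "(\<lambda>\<omega>. X \<omega> k + \<xi> k \<omega> * (B (p (Suc k)) \<omega> - B (p k) \<omega>)) \<in> borel_measurable (F (p (Suc k)))"
    by measurable
  then show ?case by (simp only: X_def sum.lessThan_Suc)
qed (simp add: X_def)

private lemma X_step: "X \<omega> (Suc k) = X \<omega> k + \<xi> k \<omega> * (B (p (Suc k)) \<omega> - B (p k) \<omega>)"
  by (simp add: X_def)

private lemma \<xi>sq_int: "k < n \<Longrightarrow> integrable M (\<lambda>\<omega>. (\<xi> k \<omega>)\<^sup>2)"
proof -
  assume k: "k < n"
  obtain C where C: "\<forall>\<omega>\<in>space M. \<bar>\<xi> k \<omega>\<bar> \<le> C" using \<xi>_bounded[OF k] by auto
  show ?thesis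
    using measurable_F_M[OF p_in \<xi>_meas[OF k]] k C
    by (intro integrable_const_bound[where B="C\<^sup>2"])
       (auto intro!: AE_I2 simp: abs_le_square_iff[symmetric] intro: order_trans)
qed

private lemma X_sq_int: "k \<le> n \<Longrightarrow> integrable M (\<lambda>\<omega>. (X \<omega> k)\<^sup>2)"
proof (induction k)
  case (Suc k)
  then have k: "k < n" by simp
  have [measurable]: "(\<lambda>\<omega>. X \<omega> k) \<in> borel_measurable M" "\<xi> k \<in> borel_measurable M"
    "B (p k) \<in> borel_measurable M" "B (p (Suc k)) \<in> borel_measurable M"
    using measurable_F_M[OF p_in X_meas[of k]] measurable_F_M[OF p_in \<xi>_meas[OF k]] k
      measurable_F_M[OF p_in B_adapted[OF p_in]] by auto
  have "integrable M (\<lambda>\<omega>. (\<xi> k \<omega>)\<^sup>2 * (B (p (Suc k)) \<omega> - B (p k) \<omega>)\<^sup>2)"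
    using p_Suc[OF k] \<xi>_meas[OF k] \<xi>sq_int[OF k] by (intro increment_times_past) auto
  then show ?case
    using Suc unfolding X_step
    by (intro integrable_square_add) (auto simp: power_mult_distrib)
qed (simp add: X_def)

text \<open>The martingale property of \<open>X\<close> in weak form. The bounded coefficient
  \<open>\<xi> k\<close> is merged with \<open>Z\<close> into one past variable.\<close>

private lemma cross_zero:
  assumes k: "k < n" and Z: "Z \<in> borel_measurable (F (p k))" "integrable M Z"
  shows "integrable M (\<lambda>\<omega>. Z \<omega> * (X \<omega> (Suc k) - X \<omega> k))"
    "expectation (\<lambda>\<omega>. Z \<omega> * (X \<omega> (Suc k) - X \<omega> k)) = 0"
proof -
  obtain C where C: "\<forall>\<omega>\<in>space M. \<bar>\<xi> k \<omega>\<bar> \<le> C" using \<xi>_bounded[OF k] by auto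
  have "integrable M (\<lambda>\<omega>. \<xi> k \<omega> * Z \<omega>)"
    using C Z measurable_F_M[OF p_in \<xi>_meas[OF k]] k by (intro integrable_bounded_mult) auto
  moreover have "(\<lambda>\<omega>. \<xi> k \<omega> * Z \<omega>) \<in> borel_measurable (F (p k))"
    using Z \<xi>_meas[OF k] by simp
  moreover have "(\<lambda>\<omega>. Z \<omega> * (X \<omega> (Suc k) - X \<omega> k)) = (\<lambda>\<omega>. (\<xi> k \<omega> * Z \<omega>) * (B (p (Suc k)) \<omega> - B (p k) \<omega>))"
    by (simp add: X_step fun_eq_iff)
  ultimately show "integrable M (\<lambda>\<omega>. Z \<omega> * (X \<omega> (Suc k) - X \<omega> k))"
    "expectation (\<lambda>\<omega>. Z \<omega> * (X \<omega> (Suc k) - X \<omega> k)) = 0"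
    using increment_times_past[of "p k" "p (Suc k)" "\<lambda>\<omega>. \<xi> k \<omega> * Z \<omega>"] p_Suc[OF k] by auto
qed

private lemma X_M: "k \<le> n \<Longrightarrow> (\<lambda>\<omega>. X \<omega> k) \<in> borel_measurable M"
  using measurable_F_M[OF p_in X_meas] by simp

private lemma isometry:
  "k \<le> n \<Longrightarrow> expectation (\<lambda>\<omega>. (X \<omega> k)\<^sup>2) = (\<Sum>j<k. expectation (\<lambda>\<omega>. (\<xi> j \<omega>)\<^sup>2) * (p (Suc j) - p j))"
proof (induction k)
  case (Suc k)
  then have k: "k < n" by simp
  have e: "(X \<omega> (Suc k))\<^sup>2 = (X \<omega> k)\<^sup>2 + 2 * (X \<omega> k * (X \<omega> (Suc k) - X \<omega> k))
      + (\<xi> k \<omega>)\<^sup>2 * (B (p (Suc k)) \<omega> - B (p k) \<omega>)\<^sup>2" for \<omega>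
    by (simp add: X_step power2_eq_square algebra_simps)
  have i: "integrable M (\<lambda>\<omega>. X \<omega> k)"
    using k by (auto intro: integrable_of_square[OF X_M X_sq_int])
  note c = cross_zero[OF k X_meas i]
  note q = increment_times_past[of "p k" "p (Suc k)" "\<lambda>\<omega>. (\<xi> k \<omega>)\<^sup>2"]
  show ?case
    unfolding e using c q Suc k p_Suc[OF k] \<xi>_meas[OF k] \<xi>sq_int[OF k] X_sq_int[of k]
    by simp
qed (simp add: X_def)

private lemma running_max_meas: "k \<le> n \<Longrightarrow> (\<lambda>\<omega>. running_max (X \<omega>) k) \<in> borel_measurable (F (p k))"
proof (induction k)
  case 0
  then show ?case using X_meas[of 0] by simp
next
  case (Suc k)
  then have "(\<lambda>\<omega>. running_max (X \<omega>) k) \<in> borel_measurable (F (p (Suc k)))"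
    using measurable_F_mono[of "p k" "p (Suc k)"] p_Suc[of k] by auto
  with X_meas[OF Suc.prems] show ?case
    unfolding running_max.simps by (intro borel_measurable_max borel_measurable_abs)
qed

private lemma running_max_M: "k \<le> n \<Longrightarrow> (\<lambda>\<omega>. running_max (X \<omega>) k) \<in> borel_measurable M"
  by (rule measurable_F_M[OF p_in running_max_meas])

private lemma running_max_sq_int:
  assumes k: "k \<le> n"
  shows "integrable M (\<lambda>\<omega>. (running_max (X \<omega>) k)\<^sup>2)"
proof (rule Bochner_Integration.integrable_bound)
  show "integrable M (\<lambda>\<omega>. \<Sum>j\<le>k. (X \<omega> j)\<^sup>2)"
    using k by (intro Bochner_Integration.integrable_sum X_sq_int) simp
  show "(\<lambda>\<omega>. (running_max (X \<omega>) k)\<^sup>2) \<in> borel_measurable M"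
    using running_max_M[OF k] by measurable
  show "AE \<omega> in M. norm ((running_max (X \<omega>) k)\<^sup>2) \<le> norm (\<Sum>j\<le>k. (X \<omega> j)\<^sup>2)"
    using running_max_square_le_sum by (simp add: sum_nonneg)
qed

text \<open>The expectation of the pathwise inequality: the correction terms \<open>Y k\<close> have
  nonnegative mean, and the mean of the square of the last value is given by the isometry.\<close>

lemma maximal_inequality_simple:
  "(\<integral>\<^sup>+\<omega>. ennreal ((running_max (\<lambda>k. \<Sum>j<k. \<xi> j \<omega> * (B (p (Suc j)) \<omega> - B (p j) \<omega>)) n)\<^sup>2) \<partial>M)
    \<le> 4 * (\<integral>\<^sup>+\<omega>. ennreal (\<Sum>j<n. (\<xi> j \<omega>)\<^sup>2 * (p (Suc j) - p j)) \<partial>M)"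
proof -
  let ?V = "\<lambda>\<omega>. \<Sum>j<n. (\<xi> j \<omega>)\<^sup>2 * (p (Suc j) - p j)"
  define Y where "Y k \<omega> = running_max (X \<omega>) k * (\<bar>X \<omega> (Suc k)\<bar> - \<bar>X \<omega> k\<bar>)" for k \<omega>
  have Y: "integrable M (Y k) \<and> 0 \<le> expectation (Y k)" if k: "k < n" for k
  proof -
    have rm: "running_max (X \<omega>) k \<le> running_max (X \<omega>) (Suc k)" for \<omega> by simp
    \<comment> \<open>The sign is a subgradient of the absolute value, so \<open>?Z\<close> times
      the increment of \<open>X\<close> lies below \<open>Y k\<close>. Since \<open>?Z\<close> is
      known at time \<open>p k\<close>, that product has mean 0, whence the mean of
      \<open>Y k\<close> is nonnegative.\<close>
    let ?Z = "\<lambda>\<omega>. running_max (X \<omega>) k * sgn (X \<omega> k)"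
    have mZ: "?Z \<in> borel_measurable (F (p k))"
      using k by (intro borel_measurable_times running_max_meas measurable_compose[OF X_meas borel_measurable_sgn]) auto
    have "integrable M (\<lambda>\<omega>. running_max (X \<omega>) k)"
      using k by (auto intro: integrable_of_square[OF running_max_M running_max_sq_int])
    moreover have "(\<lambda>\<omega>. sgn (X \<omega> k)) \<in> borel_measurable M"
      using k by (intro measurable_compose[OF X_M borel_measurable_sgn]) simp
    ultimately have "integrable M (\<lambda>\<omega>. sgn (X \<omega> k) * running_max (X \<omega>) k)"
      by (rule integrable_bounded_mult[where C=1]) (simp add: abs_sgn_eq)
    then have iZ: "integrable M ?Z"
      by (simp only: mult.commute)
    note c = cross_zero[OF k mZ iZ]
    have le: "?Z \<omega> * (X \<omega> (Suc k) - X \<omega> k) \<le> Y k \<omega>" for \<omega>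
    proof -
      have "sgn u * (v - u) \<le> \<bar>v\<bar> - \<bar>u\<bar>" for u v :: real
        by (auto simp: sgn_if)
      then have "sgn (X \<omega> k) * (X \<omega> (Suc k) - X \<omega> k) \<le> \<bar>X \<omega> (Suc k)\<bar> - \<bar>X \<omega> k\<bar>" .
      from mult_left_mono[OF this running_max_nonneg] show ?thesis
        by (simp add: Y_def mult.assoc)
    qed
    have i: "integrable M (Y k)"
    proof (rule Bochner_Integration.integrable_bound)
      show "integrable M (\<lambda>\<omega>. 2 * (running_max (X \<omega>) (Suc k))\<^sup>2)"
        using running_max_sq_int[of "Suc k"] k by (intro integrable_mult_right) simp
      show "Y k \<in> borel_measurable M"
        using k unfolding Y_def
        by (intro borel_measurable_times borel_measurable_diff borel_measurable_abs running_max_M X_M) auto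
      have "\<bar>Y k \<omega>\<bar> \<le> 2 * (running_max (X \<omega>) (Suc k))\<^sup>2" for \<omega>
      proof -
        let ?r = "running_max (X \<omega>) (Suc k)"
        have "0 \<le> running_max (X \<omega>) k" "running_max (X \<omega>) k \<le> ?r"
          "\<bar>X \<omega> k\<bar> \<le> ?r" "\<bar>X \<omega> (Suc k)\<bar> \<le> ?r"
          by (rule running_max_nonneg rm abs_le_running_max; simp)+
        then have "\<bar>running_max (X \<omega>) k\<bar> * \<bar>\<bar>X \<omega> (Suc k)\<bar> - \<bar>X \<omega> k\<bar>\<bar> \<le> ?r * (2 * ?r)"
          by (intro mult_mono) linarith+
        then show ?thesis by (simp only: Y_def abs_mult power2_eq_square mult_ac)
      qed
      then show "AE \<omega> in M. norm (Y k \<omega>) \<le> norm (2 * (running_max (X \<omega>) (Suc k))\<^sup>2)"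
        by (simp del: running_max.simps)
    qed
    show ?thesis using integral_mono[OF c(1) i le] c(2) i by simp
  qed
  have iX: "integrable M (\<lambda>\<omega>. 4 * (X \<omega> n)\<^sup>2)"
    using X_sq_int[of n] by simp
  have iY: "integrable M (\<lambda>\<omega>. \<Sum>k<n. Y k \<omega>)"
    using Y by (intro Bochner_Integration.integrable_sum) auto
  have "expectation (\<lambda>\<omega>. (running_max (X \<omega>) n)\<^sup>2)
      \<le> expectation (\<lambda>\<omega>. 4 * (X \<omega> n)\<^sup>2 - 4 * (\<Sum>k<n. Y k \<omega>))"
  proof (rule integral_mono)
    show "(running_max (X \<omega>) n)\<^sup>2 \<le> 4 * (X \<omega> n)\<^sup>2 - 4 * (\<Sum>k<n. Y k \<omega>)" for \<omega>
      using running_max_square_le[of "running_max (X \<omega>)" "X \<omega>" n] by (simp add: Y_def)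
    show "integrable M (\<lambda>\<omega>. 4 * (X \<omega> n)\<^sup>2 - 4 * (\<Sum>k<n. Y k \<omega>))"
      by (intro Bochner_Integration.integrable_diff iX integrable_mult_right iY)
  qed (rule running_max_sq_int[OF order_refl])
  also have "\<dots> = 4 * expectation (\<lambda>\<omega>. (X \<omega> n)\<^sup>2) - 4 * expectation (\<lambda>\<omega>. \<Sum>k<n. Y k \<omega>)"
    by (subst Bochner_Integration.integral_diff[OF iX integrable_mult_right[OF iY]]) simp
  also have "expectation (\<lambda>\<omega>. \<Sum>k<n. Y k \<omega>) = (\<Sum>k<n. expectation (Y k))"
    using Y by (intro Bochner_Integration.integral_sum) auto
  also have "4 * expectation (\<lambda>\<omega>. (X \<omega> n)\<^sup>2) - 4 * (\<Sum>k<n. expectation (Y k)) \<le> 4 * expectation (\<lambda>\<omega>. (X \<omega> n)\<^sup>2)"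
    using sum_nonneg[of "{..<n}" "\<lambda>k. expectation (Y k)"] Y by simp
  also have "expectation (\<lambda>\<omega>. (X \<omega> n)\<^sup>2) = (\<Sum>j<n. expectation (\<lambda>\<omega>. (\<xi> j \<omega>)\<^sup>2 * (p (Suc j) - p j)))"
    using isometry[of n] by simp
  also have "\<dots> = expectation ?V"
    using \<xi>sq_int by (intro Bochner_Integration.integral_sum[symmetric] integrable_mult_left) auto
  finally have *: "expectation (\<lambda>\<omega>. (running_max (X \<omega>) n)\<^sup>2)
    \<le> 4 * expectation ?V" .
  have "(\<integral>\<^sup>+\<omega>. ennreal ((running_max (X \<omega>) n)\<^sup>2) \<partial>M) = ennreal (expectation (\<lambda>\<omega>. (running_max (X \<omega>) n)\<^sup>2))"
    using running_max_sq_int by (intro nn_integral_eq_integral) auto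
  also have "\<dots> \<le> ennreal (4 * expectation ?V)"
    using * by (rule ennreal_leI)
  also have "\<dots> = 4 * ennreal (expectation ?V)"
    by (simp add: ennreal_mult')
  also have "ennreal (expectation ?V) =
      (\<integral>\<^sup>+\<omega>. ennreal (?V \<omega>) \<partial>M)"
  proof (rule nn_integral_eq_integral[symmetric])
    show "integrable M ?V"
      using \<xi>sq_int by (intro Bochner_Integration.integrable_sum integrable_mult_left) auto
    have "0 \<le> ?V \<omega>" for \<omega>
      using p_le by (intro sum_nonneg mult_nonneg_nonneg) auto
    then show "AE \<omega> in M. 0 \<le> ?V \<omega>" by simp
  qed
  finally show ?thesis unfolding X_def .
qed

end

end

section \<open>Components of the vector Wiener process\<close>

lemma borel_measurable_vec_nth:
  "f \<in> borel_measurable M \<Longrightarrow> (\<lambda>\<omega>. (f \<omega> :: real ^ 'n) $ i) \<in> borel_measurable M"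
  by (rule measurable_compose[OF _ borel_measurable_continuous_onI])
     (auto intro: continuous_intros)

context usual_filtered_prob_space
begin

text \<open>Independence is inherited by smaller sigma-algebras: the one generated by
  \<open>Z\<close> lies in \<open>F s\<close>, the one generated by a component of the increment in
  that of the whole increment.\<close>

lemma scalar_wiener_component:
  fixes W :: "real \<Rightarrow> 'a \<Rightarrow> real ^ 'm"
  assumes "wiener_process M F T W"
  shows "scalar_wiener M F T (\<lambda>t \<omega>. W t \<omega> $ j)"
proof unfold_locales
  have W: "\<And>t. t \<in> {0..T} \<Longrightarrow> W t \<in> borel_measurable (F t)" "ae_continuous M T W"
    using assms by (auto simp: wiener_process_def adapted_def)
  show "(\<lambda>\<omega>. W t \<omega> $ j) \<in> borel_measurable (F t)" if "t \<in> {0..T}" for t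
    using W(1)[OF that] by (rule borel_measurable_vec_nth)
  show "ae_continuous M T (\<lambda>t \<omega>. W t \<omega> $ j)"
    using W(2) unfolding ae_continuous_def
    by eventually_elim (intro continuous_on_component)
  fix s t assume st: "0 \<le> s" "s < t" "t \<le> T"
  show "distributed M lborel (\<lambda>\<omega>. W t \<omega> $ j - W s \<omega> $ j) (\<lambda>z. ennreal (normal_density 0 (sqrt (t - s)) z))"
    using assms st by (auto simp: wiener_process_def)
  fix Z :: "'a \<Rightarrow> real" assume Z: "Z \<in> borel_measurable (F s)"
  have ind: "indep_set (sets (F s)) (sets (vimage_algebra (space M) (\<lambda>\<omega>. W t \<omega> - W s \<omega>) borel))"
    using assms st by (auto simp: wiener_process_def)
  have s: "s \<in> {0..T}" and t: "t \<in> {0..T}" using st by auto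
  have "sigma_sets (space M) {Z -` A \<inter> space M |A. A \<in> sets borel} \<subseteq> sets (F s)"
  proof -
    have "{Z -` A \<inter> space M |A. A \<in> sets borel} \<subseteq> sets (F s)"
      using measurable_sets[OF Z] by (auto simp: space_F[OF s])
    from sets.sigma_sets_subset[OF this] show ?thesis by (simp add: space_F[OF s])
  qed
  moreover have "sigma_sets (space M) {(\<lambda>\<omega>. W t \<omega> $ j - W s \<omega> $ j) -` A \<inter> space M |A. A \<in> sets borel}
      \<subseteq> sets (vimage_algebra (space M) (\<lambda>\<omega>. W t \<omega> - W s \<omega>) borel)"
  proof -
    let ?V = "vimage_algebra (space M) (\<lambda>\<omega>. W t \<omega> - W s \<omega>) borel"
    have "(\<lambda>\<omega>. W t \<omega> $ j - W s \<omega> $ j) -` A \<inter> space M \<in> sets ?V" if "A \<in> sets borel" for A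
    proof -
      have "(\<lambda>v :: real ^ 'm. v $ j) -` A \<inter> space borel \<in> sets borel"
        by (rule measurable_sets[OF borel_measurable_vec_nth that]) simp
      from in_vimage_algebra[OF this, of "\<lambda>\<omega>. W t \<omega> - W s \<omega>" "space M"]
      show ?thesis by (simp add: vimage_def)
    qed
    then have "{(\<lambda>\<omega>. W t \<omega> $ j - W s \<omega> $ j) -` A \<inter> space M |A. A \<in> sets borel} \<subseteq> sets ?V"
      by auto
    from sets.sigma_sets_subset[OF this] show ?thesis by simp
  qed
  ultimately have "indep_set (sigma_sets (space M) {Z -` A \<inter> space M |A. A \<in> sets borel})
      (sigma_sets (space M) {(\<lambda>\<omega>. W t \<omega> $ j - W s \<omega> $ j) -` A \<inter> space M |A. A \<in> sets borel})"
    unfolding indep_set_def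
    by (intro indep_sets_mono_sets[OF ind[unfolded indep_set_def]]) (simp split: bool.split)
  moreover have "Z \<in> borel_measurable M"
    by (rule measurable_F_M[OF s Z])
  moreover have "(\<lambda>\<omega>. W t \<omega> $ j - W s \<omega> $ j) \<in> borel_measurable M"
    by (intro borel_measurable_diff borel_measurable_vec_nth measurable_F_M[OF s W(1)[OF s]] measurable_F_M[OF t W(1)[OF t]])
  ultimately show "indep_var borel Z borel (\<lambda>\<omega>. W t \<omega> $ j - W s \<omega> $ j)"
    unfolding indep_var_eq by simp
qed

end

subsection \<open>Refining simple integrands\<close>

text \<open>Clamping to \<open>[p\<^sub>a, p\<^sub>b]\<close> turns the sum into a telescoping one.\<close>

lemma sum_increments_between:
  fixes p :: "nat \<Rightarrow> real" and \<phi> :: "real \<Rightarrow> real"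
  assumes p: "mono_on {..n} p" and c: "c \<in> p ` {..n}" and d: "d \<in> p ` {..n}" and cd: "c \<le> d"
  shows "(\<Sum>j<n. of_bool (c < p (Suc j) \<and> p (Suc j) \<le> d) * (\<phi> (p (Suc j)) - \<phi> (p j))) = \<phi> d - \<phi> c"
proof -
  define \<psi> where "\<psi> q = \<phi> (max c (min q d))" for q
  obtain a b where ab: "a \<le> n" "c = p a" "b \<le> n" "d = p b" using c d by auto
  have pm: "i \<le> j \<Longrightarrow> j \<le> n \<Longrightarrow> p i \<le> p j" for i j
    using p by (auto simp: mono_on_def)
  have "(\<Sum>j<n. of_bool (c < p (Suc j) \<and> p (Suc j) \<le> d) * (\<phi> (p (Suc j)) - \<phi> (p j))) =
      (\<Sum>j<n. \<psi> (p (Suc j)) - \<psi> (p j))"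
  proof (rule sum.cong)
    fix j assume "j \<in> {..<n}"
    then have j: "j < n" by simp
    consider "p (Suc j) \<le> c" | "c < p (Suc j)" "p (Suc j) \<le> d" | "d < p (Suc j)" by linarith
    then show "of_bool (c < p (Suc j) \<and> p (Suc j) \<le> d) * (\<phi> (p (Suc j)) - \<phi> (p j)) = \<psi> (p (Suc j)) - \<psi> (p j)"
    proof cases
      case 1
      then have "p j \<le> c" using pm[of j "Suc j"] j by simp
      with 1 cd show ?thesis by (simp add: \<psi>_def min_absorb1 max_absorb1)
    next
      case 2
      then have "\<not> Suc j \<le> a" using pm[of "Suc j" a] ab by auto
      then have "c \<le> p j" using pm[of a j] ab j by auto
      moreover have "p j \<le> p (Suc j)" using pm[of j "Suc j"] j by simp
      ultimately show ?thesis using 2 by (simp add: \<psi>_def min_absorb1 max_absorb2)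
    next
      case 3
      then have "\<not> Suc j \<le> b" using pm[of "Suc j" b] ab by auto
      then have "d \<le> p j" using pm[of b j] ab j by auto
      with 3 cd show ?thesis by (simp add: \<psi>_def min_absorb2 max_absorb2)
    qed
  qed simp
  also have "\<dots> = \<psi> (p n) - \<psi> (p 0)"
    by (rule sum_lessThan_telescope)
  also have "\<dots> = \<phi> d - \<phi> c"
    using pm[of 0 a] pm[of b n] ab cd by (simp add: \<psi>_def min_absorb2 max_absorb2 max_absorb1 min_absorb1)
  finally show ?thesis .
qed

lemma grid_exists:
  assumes "finite P" "P \<noteq> {}"
  obtains n and p :: "nat \<Rightarrow> real" where "mono_on {..n} p" "p ` {..n} = P"
proof -
  let ?xs = "sorted_list_of_set P"
  have n: "length ?xs = card P" "0 < card P" using assms by (auto simp: card_gt_0_iff)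
  have "(\<lambda>i. ?xs ! i) ` {..<length ?xs} = set ?xs"
    by (auto simp: in_set_conv_nth)
  moreover have "{..<length ?xs} = {..card P - 1}" using n by auto
  ultimately have "(\<lambda>i. ?xs ! i) ` {..card P - 1} = P" using assms by simp
  moreover have "mono_on {..card P - 1} (\<lambda>i. ?xs ! i)"
    using n by (intro mono_onI sorted_nth_mono[OF sorted_sorted_list_of_set]) auto
  ultimately show thesis by (rule that[rotated])
qed

text \<open>Quantifying over all grids that contain a given finite set makes the class of such pairs
  closed under differences.\<close>

definition elementary_integral ::
    "'a measure \<Rightarrow> (real \<Rightarrow> 'a measure) \<Rightarrow> real \<Rightarrow> (real \<Rightarrow> 'a \<Rightarrow> real) \<Rightarrow>
     (real \<Rightarrow> 'a \<Rightarrow> real) \<Rightarrow> (real \<Rightarrow> 'a \<Rightarrow> real) \<Rightarrow> bool" where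
  "elementary_integral M F T B h J \<longleftrightarrow>
     (\<exists>P. finite P \<and> P \<subseteq> {0..T} \<and>
        (\<forall>n p. mono_on {..n} p \<longrightarrow> p ` {..n} \<subseteq> {0..T} \<longrightarrow> P \<subseteq> p ` {..n} \<longrightarrow>
           (\<exists>\<xi>. simple_integrand M F T n p \<xi> \<and> h = simple_value n p \<xi> \<and> J = simple_integral B n p \<xi>)))"

lemma elementary_integral_diff:
  assumes "elementary_integral M F T B h J" "elementary_integral M F T B h' J'"
  shows "elementary_integral M F T B (\<lambda>t \<omega>. h t \<omega> - h' t \<omega>) (\<lambda>t \<omega>. J t \<omega> - J' t \<omega>)"
proof -
  obtain P where P: "finite P" "P \<subseteq> {0..T}"
    "\<And>n p. mono_on {..n} p \<Longrightarrow> p ` {..n} \<subseteq> {0..T} \<Longrightarrow> P \<subseteq> p ` {..n} \<Longrightarrow>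
           \<exists>\<xi>. simple_integrand M F T n p \<xi> \<and> h = simple_value n p \<xi> \<and> J = simple_integral B n p \<xi>"
    using assms(1) unfolding elementary_integral_def by blast
  obtain P' where P': "finite P'" "P' \<subseteq> {0..T}"
    "\<And>n p. mono_on {..n} p \<Longrightarrow> p ` {..n} \<subseteq> {0..T} \<Longrightarrow> P' \<subseteq> p ` {..n} \<Longrightarrow>
           \<exists>\<xi>. simple_integrand M F T n p \<xi> \<and> h' = simple_value n p \<xi> \<and> J' = simple_integral B n p \<xi>"
    using assms(2) unfolding elementary_integral_def by blast
  show ?thesis
    unfolding elementary_integral_def
  proof (intro exI[of _ "P \<union> P'"] conjI allI impI)
    fix n and p :: "nat \<Rightarrow> real" assume p: "mono_on {..n} p" "p ` {..n} \<subseteq> {0..T}" "P \<union> P' \<subseteq> p ` {..n}"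
    obtain \<xi> where \<xi>: "simple_integrand M F T n p \<xi>" "h = simple_value n p \<xi>" "J = simple_integral B n p \<xi>"
      using P(3)[OF p(1,2)] p(3) by blast
    obtain \<xi>' where \<xi>': "simple_integrand M F T n p \<xi>'" "h' = simple_value n p \<xi>'" "J' = simple_integral B n p \<xi>'"
      using P'(3)[OF p(1,2)] p(3) by blast
    show "\<exists>\<xi>. simple_integrand M F T n p \<xi> \<and> (\<lambda>t \<omega>. h t \<omega> - h' t \<omega>) = simple_value n p \<xi> \<and>
        (\<lambda>t \<omega>. J t \<omega> - J' t \<omega>) = simple_integral B n p \<xi>"
    proof (intro exI[of _ "\<lambda>k \<omega>. \<xi> k \<omega> - \<xi>' k \<omega>"] conjI)
      have "\<exists>C. \<forall>\<omega>\<in>space M. \<bar>\<xi> k \<omega> - \<xi>' k \<omega>\<bar> \<le> C" if k: "k < n" for k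
      proof -
        obtain C where C: "\<forall>\<omega>\<in>space M. \<bar>\<xi> k \<omega>\<bar> \<le> C"
          using \<xi>(1) k unfolding simple_integrand_def by blast
        obtain C' where C': "\<forall>\<omega>\<in>space M. \<bar>\<xi>' k \<omega>\<bar> \<le> C'"
          using \<xi>'(1) k unfolding simple_integrand_def by blast
        have "\<bar>\<xi> k \<omega> - \<xi>' k \<omega>\<bar> \<le> C + C'" if "\<omega> \<in> space M" for \<omega>
          using bspec[OF C that] bspec[OF C' that] by linarith
        then show ?thesis by blast
      qed
      then show "simple_integrand M F T n p (\<lambda>k \<omega>. \<xi> k \<omega> - \<xi>' k \<omega>)"
        using \<xi>(1) \<xi>'(1) by (auto simp: simple_integrand_def intro!: borel_measurable_diff)
      show "(\<lambda>t \<omega>. h t \<omega> - h' t \<omega>) = simple_value n p (\<lambda>k \<omega>. \<xi> k \<omega> - \<xi>' k \<omega>)"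
        by (simp add: \<xi> \<xi>' simple_value_def fun_eq_iff sum_subtractf left_diff_distrib)
      show "(\<lambda>t \<omega>. J t \<omega> - J' t \<omega>) = simple_integral B n p (\<lambda>k \<omega>. \<xi> k \<omega> - \<xi>' k \<omega>)"
        by (simp add: \<xi> \<xi>' simple_integral_def fun_eq_iff sum_subtractf left_diff_distrib)
    qed
  qed (use P P' in auto)
qed

context usual_filtered_prob_space
begin

lemma elementary_integral_simple:
  assumes \<xi>: "simple_integrand M F T n s \<xi>"
  shows "elementary_integral M F T B (simple_value n s \<xi>) (simple_integral B n s \<xi>)"
  unfolding elementary_integral_def
proof (intro exI[of _ "s ` {..n}"] conjI allI impI)
  have s: "mono_on {..n} s" "s ` {..n} \<subseteq> {0..T}"
    and \<xi>_meas: "\<And>k. k < n \<Longrightarrow> \<xi> k \<in> borel_measurable (F (s k))"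
    and \<xi>_bd: "\<And>k. k < n \<Longrightarrow> \<exists>C. \<forall>\<omega>\<in>space M. \<bar>\<xi> k \<omega>\<bar> \<le> C"
    using \<xi> by (auto simp: simple_integrand_def)
  show "s ` {..n} \<subseteq> {0..T}" "finite (s ` {..n})" using s by auto
  fix m and p :: "nat \<Rightarrow> real" assume p: "mono_on {..m} p" "p ` {..m} \<subseteq> {0..T}" and sp: "s ` {..n} \<subseteq> p ` {..m}"
  \<comment> \<open>The value at the right end is the value on the whole cell, because every jump
    time \<open>s k\<close> is a point of the finer grid.\<close>
  define \<eta> where "\<eta> j \<omega> = simple_value n s \<xi> (p (Suc j)) \<omega>" for j :: nat and \<omega> :: 'a
  have s_mono: "k < n \<Longrightarrow> s k \<le> s (Suc k)" for k
    using s(1) by (auto simp: mono_on_def)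
  \<comment> \<open>Kept general in \<open>\<phi>\<close> because two choices are made below:
    \<open>of_bool (t \<le> q)\<close> compares the integrands, \<open>B (min q t) \<omega>\<close>
    the integrals.\<close>
  have eq: "(\<Sum>j<m. \<eta> j \<omega> * (\<phi> (p (Suc j)) - \<phi> (p j))) = (\<Sum>k<n. \<xi> k \<omega> * (\<phi> (s (Suc k)) - \<phi> (s k)))"
    for \<phi> :: "real \<Rightarrow> real" and \<omega>
  proof -
    have "(\<Sum>j<m. \<eta> j \<omega> * (\<phi> (p (Suc j)) - \<phi> (p j))) =
      (\<Sum>k<n. \<xi> k \<omega> * (\<Sum>j<m. of_bool (s k < p (Suc j) \<and> p (Suc j) \<le> s (Suc k)) * (\<phi> (p (Suc j)) - \<phi> (p j))))"
      unfolding \<eta>_def simple_value_def sum_distrib_left sum_distrib_right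
      by (subst sum.swap) (simp add: indicator_def mult.assoc)
    also have "\<dots> = (\<Sum>k<n. \<xi> k \<omega> * (\<phi> (s (Suc k)) - \<phi> (s k)))"
      using sp s_mono by (intro sum.cong arg_cong2[where f="(*)"] sum_increments_between[OF p(1)]) auto
    finally show ?thesis .
  qed
  have p_mono: "k < m \<Longrightarrow> p k \<le> p (Suc k)" for k
    using p(1) by (auto simp: mono_on_def)
  have ind: "indicator {a<..b} t = of_bool (t \<le> b) - (of_bool (t \<le> a) :: real)" if "a \<le> b" for a b t :: real
    using that by (auto simp: indicator_def)
  show "\<exists>\<eta>. simple_integrand M F T m p \<eta> \<and> simple_value n s \<xi> = simple_value m p \<eta> \<and>
      simple_integral B n s \<xi> = simple_integral B m p \<eta>"
  proof (intro exI[of _ \<eta>] conjI ext)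
    show "simple_value n s \<xi> t \<omega> = simple_value m p \<eta> t \<omega>" for t \<omega>
      using eq[of \<omega> "\<lambda>q. of_bool (t \<le> q)"] s_mono p_mono
      by (simp add: simple_value_def ind)
    show "simple_integral B n s \<xi> t \<omega> = simple_integral B m p \<eta> t \<omega>" for t \<omega>
      using eq[of \<omega> "\<lambda>q. B (min q t) \<omega>"] by (simp add: simple_integral_def)
    have "\<eta> j \<in> borel_measurable (F (p j))" if j: "j < m" for j
      unfolding \<eta>_def simple_value_def
    proof (rule borel_measurable_sum)
      fix k assume "k \<in> {..<n}"
      then have k: "k < n" by simp
      show "(\<lambda>\<omega>. \<xi> k \<omega> * indicator {s k<..s (Suc k)} (p (Suc j))) \<in> borel_measurable (F (p j))"
      \<comment> \<open>If the \<open>k\<close>-th term is active on the cell, then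
        \<open>s k\<close>, being a grid point, is at most \<open>p j\<close>, so
        \<open>\<xi> k\<close> is already known there. Otherwise the indicator vanishes.\<close>
      proof (cases "s k < p (Suc j)")
        case True
        obtain i where i: "i \<le> m" "s k = p i"
          using subsetD[OF sp, of "s k"] k by auto
        have "\<not> Suc j \<le> i" using True i mono_onD[OF p(1), of "Suc j" i] j by auto
        then have "s k \<le> p j" using i p(1) j by (auto simp: mono_on_def)
        moreover have "0 \<le> s k" "p j \<le> T" using s(2) p(2) k j by (auto simp: image_subset_iff)
        ultimately have "\<xi> k \<in> borel_measurable (F (p j))"
          using measurable_F_mono[OF _ _ _ \<xi>_meas[OF k]] by auto
        then show ?thesis by simp
      qed simp
    qed
    moreover have "\<exists>C. \<forall>\<omega>\<in>space M. \<bar>\<eta> j \<omega>\<bar> \<le> C" for j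
    proof -
      obtain C where C: "\<And>k \<omega>. k < n \<Longrightarrow> \<omega> \<in> space M \<Longrightarrow> \<bar>\<xi> k \<omega>\<bar> \<le> C k"
        using \<xi>_bd by metis
      have "\<bar>\<eta> j \<omega>\<bar> \<le> (\<Sum>k<n. C k)" if "\<omega> \<in> space M" for \<omega>
        unfolding \<eta>_def simple_value_def
        using C[OF _ that] by (intro order_trans[OF sum_abs] sum_mono) (fastforce simp: indicator_def)
      then show ?thesis by blast
    qed
    ultimately show "simple_integrand M F T m p \<eta>"
      using p by (auto simp: simple_integrand_def)
  qed
qed

end

subsection \<open>Almost sure convergence\<close>

text \<open>Borel-Cantelli: along \<open>r\<close> the \<open>k\<close>-th exceptional event has
  probability below \<open>(1/2) ^ k\<close>. Almost sure convergence is what Fatou's lemma needs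
  later.\<close>

lemma tendsto_zero_in_prob_AE_subseq:
  assumes meas: "\<And>n. Z n \<in> borel_measurable M" and lim: "tendsto_zero_in_prob M Z"
  obtains r :: "nat \<Rightarrow> nat" where "strict_mono r" "AE \<omega> in M. (\<lambda>n. Z (r n) \<omega>) \<longlonglongrightarrow> 0"
proof -
  define E where "E k n = {\<omega> \<in> space M. ennreal ((1/2) ^ k) < Z n \<omega>}" for k n :: nat
  have [measurable]: "E k n \<in> sets M" for k n
    using meas unfolding E_def by measurable
  have ex: "\<exists>n>m. emeasure M (E k n) < ennreal ((1/2) ^ k)" for k m
  proof -
    have "(\<lambda>n. emeasure M (E k n)) \<longlonglongrightarrow> 0"
      using lim unfolding tendsto_zero_in_prob_def E_def by simp
    then have "\<forall>\<^sub>F n in sequentially. emeasure M (E k n) < ennreal ((1/2) ^ k)"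
      by (rule order_tendstoD) simp
    then have "\<forall>\<^sub>F n in sequentially. m < n \<and> emeasure M (E k n) < ennreal ((1/2) ^ k)"
      using eventually_gt_at_top[of m] by eventually_elim simp
    then show ?thesis by (rule eventually_happens'[OF sequentially_bot])
  qed
  define r where "r = rec_nat (SOME n. emeasure M (E 0 n) < ennreal ((1/2) ^ 0))
    (\<lambda>k m. SOME n. m < n \<and> emeasure M (E (Suc k) n) < ennreal ((1/2) ^ Suc k))"
  have r_Suc: "r k < r (Suc k) \<and> emeasure M (E (Suc k) (r (Suc k))) < ennreal ((1/2) ^ Suc k)" for k
    using someI_ex[OF ex[of "r k" "Suc k"]] by (simp add: r_def)
  have "emeasure M (E 0 (r 0)) < ennreal ((1/2) ^ 0)"
    using someI_ex[of "\<lambda>n. emeasure M (E 0 n) < ennreal ((1/2) ^ 0)"] ex[of 0 0] by (auto simp: r_def)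
  then have small: "emeasure M (E k (r k)) < ennreal ((1/2) ^ k)" for k
    using r_Suc by (cases k) auto
  have "AE \<omega> in M. \<forall>\<^sub>F k in sequentially. \<omega> \<in> space M - E k (r k)"
  proof (rule borel_cantelli_AE1)
    show "emeasure M (E k (r k)) < \<infinity>" for k
      using small[of k] by (auto intro: less_trans)
    have "measure M (E k (r k)) \<le> (1/2) ^ k" for k
      using small[of k] by (simp add: measure_def enn2real_leI less_imp_le)
    then show "summable (\<lambda>k. measure M (E k (r k)))"
      by (intro summable_comparison_test'[OF summable_geometric[of "1/2::real"]]) auto
  qed measurable
  then have "AE \<omega> in M. (\<lambda>n. Z (r n) \<omega>) \<longlonglongrightarrow> 0"
  proof eventually_elim
    case (elim \<omega>)
    have "(\<lambda>k. ennreal ((1/2) ^ k)) \<longlonglongrightarrow> ennreal 0"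
      by (intro tendsto_ennrealI LIMSEQ_realpow_zero) auto
    then show ?case
      using elim by (intro tendsto_sandwich[of "\<lambda>_. 0" "\<lambda>k. Z (r k) \<omega>" _ "\<lambda>k. ennreal ((1/2) ^ k)"])
        (auto simp: E_def not_less elim!: eventually_mono)
  qed
  moreover have "strict_mono r" using r_Suc by (simp add: strict_mono_Suc_iff)
  ultimately show thesis by (rule that[rotated])
qed

lemma tendsto_zero_in_prob_subseq:
  assumes "tendsto_zero_in_prob M Z" "strict_mono r"
  shows "tendsto_zero_in_prob M (\<lambda>n. Z (r n))"
  unfolding tendsto_zero_in_prob_def
proof (intro allI impI)
  fix \<epsilon> :: real assume "0 < \<epsilon>"
  then have "(\<lambda>n. emeasure M {\<omega> \<in> space M. ennreal \<epsilon> < Z n \<omega>}) \<longlonglongrightarrow> 0"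
    using assms(1) by (simp add: tendsto_zero_in_prob_def)
  from LIMSEQ_subseq_LIMSEQ[OF this assms(2)]
  show "(\<lambda>n. emeasure M {\<omega> \<in> space M. ennreal \<epsilon> < Z (r n) \<omega>}) \<longlonglongrightarrow> 0"
    by (simp add: comp_def)
qed

text \<open>Here the completeness of \<open>M\<close> enters. It makes suprema over all of
  \<open>{0..T}\<close> measurable, since they agree almost surely with suprema over the
  rationals.\<close>

lemma (in complete_measure) measurable_AE_cong:
  fixes f g :: "'a \<Rightarrow> ennreal"
  assumes f: "f \<in> borel_measurable M" and eq: "AE \<omega> in M. f \<omega> = g \<omega>"
  shows "g \<in> borel_measurable M"
proof (rule measurableI)
  fix A :: "ennreal set" assume A: "A \<in> sets borel"
  show "g -` A \<inter> space M \<in> sets M"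
  proof (rule in_sets_AE)
    show "AE \<omega> in M. \<omega> \<in> f -` A \<inter> space M \<longleftrightarrow> \<omega> \<in> g -` A \<inter> space M"
      using eq by eventually_elim auto
  qed (use f A in \<open>auto intro: measurable_sets\<close>)
qed simp

text \<open>Approximation from the left keeps the rationals inside \<open>{0..T}\<close> even at an
  irrational \<open>T\<close>, and before any time up to which a path is known to survive.\<close>

lemma rational_left_limit:
  fixes t :: real
  assumes "0 < t"
  obtains q where "\<And>n. q n \<in> \<rat>" "\<And>n. 0 \<le> q n" "\<And>n. q n < t" "q \<longlonglongrightarrow> t"
proof -
  have "\<exists>q\<in>\<rat>. max 0 (t - inverse (real (Suc n))) < q \<and> q < t" for n
    using assms by (intro Rats_dense_in_real) auto
  then obtain q where q: "\<And>n. q n \<in> \<rat>" "\<And>n. max 0 (t - inverse (real (Suc n))) < q n" "\<And>n. q n < t"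
    by metis
  have l: "(\<lambda>n. t - inverse (real (Suc n))) \<longlonglongrightarrow> t"
    using tendsto_diff[OF tendsto_const[of t] LIMSEQ_inverse_real_of_nat] by simp
  have "q \<longlonglongrightarrow> t"
    using q by (intro tendsto_sandwich[OF _ _ l tendsto_const]) (auto intro!: always_eventually less_imp_le)
  with q show thesis by (intro that[of q]) (auto intro: less_imp_le)
qed

lemma SUP_ennreal_rationals:
  fixes \<phi> :: "real \<Rightarrow> real"
  assumes \<phi>: "continuous_on {0..T} \<phi>"
  shows "(SUP t\<in>{0..T}. ennreal (\<phi> t)) = (SUP t\<in>\<rat> \<inter> {0..T}. ennreal (\<phi> t))"
proof (rule antisym)
  show "(SUP t\<in>{0..T}. ennreal (\<phi> t)) \<le> (SUP t\<in>\<rat> \<inter> {0..T}. ennreal (\<phi> t))"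
  proof (rule SUP_least)
    fix t assume t: "t \<in> {0..T}"
    show "ennreal (\<phi> t) \<le> (SUP t\<in>\<rat> \<inter> {0..T}. ennreal (\<phi> t))"
    proof (cases "t = 0")
      case True
      with t show ?thesis by (intro SUP_upper) auto
    next
      case False
      then obtain q where q: "\<And>n. q n \<in> \<rat>" "\<And>n. 0 \<le> q n" "\<And>n. q n < t" "q \<longlonglongrightarrow> t"
        using t rational_left_limit[of t] by auto
      have qT: "q n \<in> {0..T}" for n using q(2,3)[of n] t by auto
      have "(\<lambda>n. ennreal (\<phi> (q n))) \<longlonglongrightarrow> ennreal (\<phi> t)"
        using \<phi> q(4) t qT by (intro tendsto_ennrealI continuous_on_tendsto_compose[OF \<phi> q(4)]) auto
      then show ?thesis
        using q qT by (intro LIMSEQ_le_const2) (auto intro!: SUP_upper)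
    qed
  qed
qed (auto intro!: SUP_subset_mono)

lemma countable_rationals_interval: "countable (\<rat> \<inter> {0..T :: real})"
  using countable_rat by auto

section \<open>Joint measurability and almost sure Ito limits\<close>

context usual_filtered_prob_space
begin

lemma measurable_SUP_continuous:
  fixes Y :: "real \<Rightarrow> 'a \<Rightarrow> real"
  assumes Y: "\<And>t. t \<in> {0..T} \<Longrightarrow> Y t \<in> borel_measurable M" "ae_continuous M T Y"
  shows "(\<lambda>\<omega>. SUP t\<in>{0..T}. ennreal \<bar>Y t \<omega>\<bar>) \<in> borel_measurable M"
proof (rule measurable_AE_cong)
  show "(\<lambda>\<omega>. SUP t\<in>\<rat> \<inter> {0..T}. ennreal \<bar>Y t \<omega>\<bar>) \<in> borel_measurable M"
    using Y(1) by (intro borel_measurable_SUP countable_rationals_interval) auto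
  show "AE \<omega> in M. (SUP t\<in>\<rat> \<inter> {0..T}. ennreal \<bar>Y t \<omega>\<bar>) = (SUP t\<in>{0..T}. ennreal \<bar>Y t \<omega>\<bar>)"
    using Y(2) unfolding ae_continuous_def
    by eventually_elim (auto intro!: SUP_ennreal_rationals[symmetric] continuous_intros)
qed

abbreviation time :: "real measure" where
  "time \<equiv> restrict_space lborel {0..T}"

lemma space_time: "space time = {0..T}"
  by (simp add: space_restrict_space)

lemma emeasure_time: "0 \<le> a \<Longrightarrow> a \<le> b \<Longrightarrow> b \<le> T \<Longrightarrow> emeasure time {a<..b} = ennreal (b - a)"
  by (subst emeasure_restrict_space) (auto simp: subset_eq)

lemma sets_time_Ioc: "0 \<le> a \<Longrightarrow> b \<le> T \<Longrightarrow> {a<..b} \<in> sets time"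
  by (subst sets_restrict_space_iff) (auto simp: subset_eq)

lemma finite_measure_time: "finite_measure time"
  using T_pos by (intro finite_measureI) (simp add: emeasure_restrict_space space_time)

lemma sigma_finite_time: "sigma_finite_measure time"
proof -
  interpret finite_measure time by (rule finite_measure_time)
  show ?thesis ..
qed

lemma nn_integral_time_measurable:
  fixes f :: "'a \<Rightarrow> real \<Rightarrow> ennreal"
  assumes "(\<lambda>(\<omega>, t). f \<omega> t) \<in> borel_measurable (M \<Otimes>\<^sub>M time)"
  shows "(\<lambda>\<omega>. \<integral>\<^sup>+t. f \<omega> t \<partial>time) \<in> borel_measurable M"
  using sigma_finite_measure.borel_measurable_nn_integral[OF sigma_finite_time, of "\<lambda>\<omega> t. f \<omega> t" M] assms by simp

lemma section_measurable:
  assumes "(\<lambda>(\<omega>, t). f \<omega> t) \<in> measurable (M \<Otimes>\<^sub>M time) N" "\<omega> \<in> space M"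
  shows "f \<omega> \<in> measurable time N"
  using measurable_Pair2[OF assms] by simp

lemma progressively_measurable_joint:
  assumes H: "progressively_measurable F T H"
  shows "(\<lambda>(\<omega>, t). H t \<omega>) \<in> borel_measurable (M \<Otimes>\<^sub>M time)"
proof -
  have TT: "T \<in> {0..T}" using T_pos by simp
  have H': "(\<lambda>(s, \<omega>). H s \<omega>) \<in> borel_measurable (restrict_space borel {0..T} \<Otimes>\<^sub>M F T)"
    using H TT by (simp add: progressively_measurable_def)
  have "(\<lambda>x. x) \<in> measurable M (F T)"
    using subalgebra_F[OF TT] by (auto intro!: measurableI simp: subalgebra_def)
  then have f: "fst \<in> measurable (M \<Otimes>\<^sub>M time) (F T)"
    using measurable_compose[OF measurable_fst] by auto
  have "sets time = sets (restrict_space borel {0..T})"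
    by (simp add: sets_restrict_space)
  then have s: "snd \<in> measurable (M \<Otimes>\<^sub>M time) (restrict_space borel {0..T})"
    using measurable_snd[of M time] by (simp cong: measurable_cong_sets)
  from measurable_compose[OF measurable_Pair[OF s f] H'] show ?thesis
    by (simp add: split_beta')
qed

text \<open>The form in which Ito integrals are used: along a subsequence the approximations of
  \<^const>\<open>ito_integral\<close> converge almost surely.\<close>

definition ito_limit ::
    "(real \<Rightarrow> 'a \<Rightarrow> real) \<Rightarrow> (real \<Rightarrow> 'a \<Rightarrow> real) \<Rightarrow> (real \<Rightarrow> 'a \<Rightarrow> real) \<Rightarrow> bool" where
  "ito_limit B H I \<longleftrightarrow>
     (\<lambda>(\<omega>, t). H t \<omega>) \<in> borel_measurable (M \<Otimes>\<^sub>M time) \<and>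
     (AE \<omega> in M. (\<integral>\<^sup>+t. ennreal ((H t \<omega>)\<^sup>2) \<partial>time) < \<infinity>) \<and>
     (\<forall>t\<in>{0..T}. I t \<in> borel_measurable M) \<and>
     (\<exists>h J. (\<forall>l::nat. elementary_integral M F T B (h l) (J l)) \<and>
        (AE \<omega> in M. (\<lambda>l. \<integral>\<^sup>+t. ennreal ((h l t \<omega> - H t \<omega>)\<^sup>2) \<partial>time) \<longlonglongrightarrow> 0) \<and>
        (AE \<omega> in M. \<forall>t\<in>{0..T}. (\<lambda>l. J l t \<omega>) \<longlonglongrightarrow> I t \<omega>))"

lemma ito_limitI:
  assumes "(\<lambda>(\<omega>, t). H t \<omega>) \<in> borel_measurable (M \<Otimes>\<^sub>M time)"
    and "AE \<omega> in M. (\<integral>\<^sup>+t. ennreal ((H t \<omega>)\<^sup>2) \<partial>time) < \<infinity>"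
    and "\<And>t. t \<in> {0..T} \<Longrightarrow> I t \<in> borel_measurable M"
    and "\<And>l::nat. elementary_integral M F T B (h l) (J l)"
    and "AE \<omega> in M. (\<lambda>l. \<integral>\<^sup>+t. ennreal ((h l t \<omega> - H t \<omega>)\<^sup>2) \<partial>time) \<longlonglongrightarrow> 0"
    and "AE \<omega> in M. \<forall>t\<in>{0..T}. (\<lambda>l. J l t \<omega>) \<longlonglongrightarrow> I t \<omega>"
  shows "ito_limit B H I"
  unfolding ito_limit_def using assms by blast

lemma simple_value_joint_measurable:
  assumes "simple_integrand M F T n s \<xi>"
  shows "(\<lambda>(\<omega>, t). simple_value n s \<xi> t \<omega>) \<in> borel_measurable (M \<Otimes>\<^sub>M time)"
proof -
  have \<xi>: "\<xi> k \<in> borel_measurable M" if "k < n" for k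
    using assms that by (auto simp: simple_integrand_def image_subset_iff intro!: measurable_F_M[of "s k"])
  have "(\<lambda>t. indicator {s k<..s (Suc k)} t) \<in> borel_measurable time" for k
    by (intro measurable_restrict_space1) auto
  then have "(\<lambda>z. \<Sum>k<n. \<xi> k (fst z) * indicator {s k<..s (Suc k)} (snd z)) \<in> borel_measurable (M \<Otimes>\<^sub>M time)"
    using \<xi> by (intro borel_measurable_sum borel_measurable_times measurable_compose[OF measurable_fst]
        measurable_compose[OF measurable_snd]) auto
  then show ?thesis by (simp add: simple_value_def split_beta')
qed

lemma square_distance_measurable:
  fixes h H :: "real \<Rightarrow> 'a \<Rightarrow> real"
  assumes "(\<lambda>(\<omega>, t). h t \<omega>) \<in> borel_measurable (M \<Otimes>\<^sub>M time)"
    and "(\<lambda>(\<omega>, t). H t \<omega>) \<in> borel_measurable (M \<Otimes>\<^sub>M time)"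
  shows "(\<lambda>(\<omega>, t). ennreal ((h t \<omega> - H t \<omega>)\<^sup>2)) \<in> borel_measurable (M \<Otimes>\<^sub>M time)"
  using assms unfolding split_beta' by measurable

lemma elementary_integral_simpleE:
  assumes "elementary_integral M F T B h J"
  obtains n p \<xi> where "simple_integrand M F T n p \<xi>" "h = simple_value n p \<xi>" "J = simple_integral B n p \<xi>"
proof -
  obtain P where P: "finite P" "P \<subseteq> {0..T}"
    "\<And>n p. mono_on {..n} p \<Longrightarrow> p ` {..n} \<subseteq> {0..T} \<Longrightarrow> P \<subseteq> p ` {..n} \<Longrightarrow>
           \<exists>\<xi>. simple_integrand M F T n p \<xi> \<and> h = simple_value n p \<xi> \<and> J = simple_integral B n p \<xi>"
    using assms unfolding elementary_integral_def by blast
  obtain n and p :: "nat \<Rightarrow> real" where p: "mono_on {..n} p" "p ` {..n} = insert 0 P"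
    using grid_exists[of "insert 0 P"] P(1) by auto
  then show thesis using P(3)[OF p(1)] P(2) T_pos that by auto
qed

lemma elementary_integral_joint_measurable:
  assumes "elementary_integral M F T B h J"
  shows "(\<lambda>(\<omega>, t). h t \<omega>) \<in> borel_measurable (M \<Otimes>\<^sub>M time)"
  using assms by (rule elementary_integral_simpleE) (simp add: simple_value_joint_measurable)

lemma nn_integral_square_le:
  assumes [measurable]: "f \<in> borel_measurable N" "g \<in> borel_measurable N"
    and le: "\<And>x. x \<in> space N \<Longrightarrow> \<bar>k x\<bar> \<le> \<bar>f x\<bar> + \<bar>g x\<bar>"
  shows "(\<integral>\<^sup>+x. ennreal ((k x :: real)\<^sup>2) \<partial>N)
    \<le> 2 * (\<integral>\<^sup>+x. ennreal ((f x)\<^sup>2) \<partial>N) + 2 * (\<integral>\<^sup>+x. ennreal ((g x)\<^sup>2) \<partial>N)"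
proof -
  have sq: "u\<^sup>2 \<le> 2 * v\<^sup>2 + 2 * w\<^sup>2" if "\<bar>u\<bar> \<le> \<bar>v\<bar> + \<bar>w\<bar>" for u v w :: real
  proof -
    have "u\<^sup>2 \<le> (\<bar>v\<bar> + \<bar>w\<bar>)\<^sup>2"
      using power_mono[OF that, of 2] by simp
    also have "\<dots> \<le> 2 * v\<^sup>2 + 2 * w\<^sup>2"
      using zero_le_power2[of "\<bar>v\<bar> - \<bar>w\<bar>"] by (simp add: power2_eq_square algebra_simps)
    finally show ?thesis .
  qed
  have "(\<integral>\<^sup>+x. ennreal ((k x)\<^sup>2) \<partial>N) \<le> (\<integral>\<^sup>+x. 2 * ennreal ((f x)\<^sup>2) + 2 * ennreal ((g x)\<^sup>2) \<partial>N)"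
  proof (rule nn_integral_mono)
    fix x assume "x \<in> space N"
    then have "ennreal ((k x)\<^sup>2) \<le> ennreal (2 * (f x)\<^sup>2 + 2 * (g x)\<^sup>2)"
      by (intro ennreal_leI sq le)
    then show "ennreal ((k x)\<^sup>2) \<le> 2 * ennreal ((f x)\<^sup>2) + 2 * ennreal ((g x)\<^sup>2)"
      by (simp add: ennreal_mult')
  qed
  also have "\<dots> = 2 * (\<integral>\<^sup>+x. ennreal ((f x)\<^sup>2) \<partial>N) + 2 * (\<integral>\<^sup>+x. ennreal ((g x)\<^sup>2) \<partial>N)"
    by (simp add: nn_integral_add nn_integral_cmult)
  finally show ?thesis .
qed

lemma tendsto_0_le_ennreal:
  fixes f g :: "nat \<Rightarrow> ennreal"
  assumes "\<And>n. f n \<le> g n" "g \<longlonglongrightarrow> 0"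
  shows "f \<longlonglongrightarrow> 0"
  by (rule tendsto_sandwich[OF _ _ tendsto_const assms(2)]) (simp_all add: assms(1))

text \<open>Needed for the diffusion coefficient of the error. The two approximating sequences live
  on unrelated grids; \<open>elementary_integral_diff\<close> puts them on a common one, and the
  limits combine by the bound of a squared sum by twice the sum of the squares.\<close>

lemma ito_limit_diff:
  assumes "ito_limit B H I" "ito_limit B H' I'"
  shows "ito_limit B (\<lambda>t \<omega>. H t \<omega> - H' t \<omega>) (\<lambda>t \<omega>. I t \<omega> - I' t \<omega>)"
proof -
  have H: "(\<lambda>(\<omega>, t). H t \<omega>) \<in> borel_measurable (M \<Otimes>\<^sub>M time)"
      "AE \<omega> in M. (\<integral>\<^sup>+t. ennreal ((H t \<omega>)\<^sup>2) \<partial>time) < \<infinity>"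
      "\<And>t. t \<in> {0..T} \<Longrightarrow> I t \<in> borel_measurable M"
    and H': "(\<lambda>(\<omega>, t). H' t \<omega>) \<in> borel_measurable (M \<Otimes>\<^sub>M time)"
      "AE \<omega> in M. (\<integral>\<^sup>+t. ennreal ((H' t \<omega>)\<^sup>2) \<partial>time) < \<infinity>"
      "\<And>t. t \<in> {0..T} \<Longrightarrow> I' t \<in> borel_measurable M"
    using assms by (auto simp: ito_limit_def)
  obtain h J where h: "\<And>l. elementary_integral M F T B (h l) (J l)"
      "AE \<omega> in M. (\<lambda>l::nat. \<integral>\<^sup>+t. ennreal ((h l t \<omega> - H t \<omega>)\<^sup>2) \<partial>time) \<longlonglongrightarrow> 0"
      "AE \<omega> in M. \<forall>t\<in>{0..T}. (\<lambda>l. J l t \<omega>) \<longlonglongrightarrow> I t \<omega>"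
    using assms(1) by (auto simp: ito_limit_def)
  obtain h' J' where h': "\<And>l. elementary_integral M F T B (h' l) (J' l)"
      "AE \<omega> in M. (\<lambda>l::nat. \<integral>\<^sup>+t. ennreal ((h' l t \<omega> - H' t \<omega>)\<^sup>2) \<partial>time) \<longlonglongrightarrow> 0"
      "AE \<omega> in M. \<forall>t\<in>{0..T}. (\<lambda>l. J' l t \<omega>) \<longlonglongrightarrow> I' t \<omega>"
    using assms(2) by (auto simp: ito_limit_def)
  note sec = section_measurable[OF H(1)] section_measurable[OF H'(1)]
    section_measurable[OF elementary_integral_joint_measurable[OF h(1)]]
    section_measurable[OF elementary_integral_joint_measurable[OF h'(1)]]
  show ?thesis
  proof (rule ito_limitI)
    show "(\<lambda>(\<omega>, t). H t \<omega> - H' t \<omega>) \<in> borel_measurable (M \<Otimes>\<^sub>M time)"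
      using H(1) H'(1) unfolding split_beta' by (rule borel_measurable_diff)
    show "AE \<omega> in M. (\<integral>\<^sup>+t. ennreal ((H t \<omega> - H' t \<omega>)\<^sup>2) \<partial>time) < \<infinity>"
      using H(2) H'(2) AE_space
    proof eventually_elim
      case (elim \<omega>)
      have "(\<integral>\<^sup>+t. ennreal ((H t \<omega> - H' t \<omega>)\<^sup>2) \<partial>time) \<le>
        2 * (\<integral>\<^sup>+t. ennreal ((H t \<omega>)\<^sup>2) \<partial>time) + 2 * (\<integral>\<^sup>+t. ennreal ((H' t \<omega>)\<^sup>2) \<partial>time)"
        by (intro nn_integral_square_le sec elim(3)) (simp add: abs_triangle_ineq4)
      also have "\<dots> < \<infinity>"
        using elim by (simp add: ennreal_mult_less_top)
      finally show ?case .
    qed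
    show "(\<lambda>\<omega>. I t \<omega> - I' t \<omega>) \<in> borel_measurable M" if "t \<in> {0..T}" for t
      using H(3) H'(3) that by auto
    show "elementary_integral M F T B (\<lambda>t \<omega>. h l t \<omega> - h' l t \<omega>) (\<lambda>t \<omega>. J l t \<omega> - J' l t \<omega>)" for l
      by (intro elementary_integral_diff h h')
    show "AE \<omega> in M. \<forall>t\<in>{0..T}. (\<lambda>l. J l t \<omega> - J' l t \<omega>) \<longlonglongrightarrow> I t \<omega> - I' t \<omega>"
      using h(3) h'(3) by eventually_elim (auto intro!: tendsto_diff)
    show "AE \<omega> in M. (\<lambda>l. \<integral>\<^sup>+t. ennreal ((h l t \<omega> - h' l t \<omega> - (H t \<omega> - H' t \<omega>))\<^sup>2) \<partial>time) \<longlonglongrightarrow> 0"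
      using h(2) h'(2) AE_space
    proof eventually_elim
      case (elim \<omega>)
      have le: "(\<integral>\<^sup>+t. ennreal ((h l t \<omega> - h' l t \<omega> - (H t \<omega> - H' t \<omega>))\<^sup>2) \<partial>time) \<le>
        2 * (\<integral>\<^sup>+t. ennreal ((h l t \<omega> - H t \<omega>)\<^sup>2) \<partial>time) + 2 * (\<integral>\<^sup>+t. ennreal ((h' l t \<omega> - H' t \<omega>)\<^sup>2) \<partial>time)" for l
        by (intro nn_integral_square_le borel_measurable_diff sec elim(3)) linarith
      have "(\<lambda>l. 2 * (\<integral>\<^sup>+t. ennreal ((h l t \<omega> - H t \<omega>)\<^sup>2) \<partial>time) + 2 * (\<integral>\<^sup>+t. ennreal ((h' l t \<omega> - H' t \<omega>)\<^sup>2) \<partial>time))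
          \<longlonglongrightarrow> 2 * 0 + 2 * 0"
        by (intro tendsto_add ennreal_tendsto_cmult elim(1,2)) simp_all
      then show ?case
        by (intro tendsto_0_le_ennreal[OF le]) simp
    qed
  qed
qed

end

lemma (in scalar_wiener) simple_integral_measurable:
  assumes s: "simple_integrand M F T n s \<xi>" and t: "t \<in> {0..T}"
  shows "simple_integral B n s \<xi> t \<in> borel_measurable M"
proof -
  have s_in: "k \<le> n \<Longrightarrow> s k \<in> {0..T}" for k
    using s by (auto simp: simple_integrand_def)
  have "\<xi> k \<in> borel_measurable M" if "k < n" for k
    using s s_in[of k] that by (auto simp: simple_integrand_def intro!: measurable_F_M[of "s k"])
  moreover have "B (min (s k) t) \<in> borel_measurable M" if "k \<le> n" for k
  proof -
    have "min (s k) t \<in> {0..T}" using s_in[OF that] t by auto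
    then show ?thesis by (intro measurable_F_M[OF _ B_adapted])
  qed
  ultimately have "(\<lambda>\<omega>. \<Sum>k<n. \<xi> k \<omega> * (B (min (s (Suc k)) t) \<omega> - B (min (s k) t) \<omega>)) \<in> borel_measurable M"
    by (intro borel_measurable_sum borel_measurable_times borel_measurable_diff) auto
  then show ?thesis by (simp add: simple_integral_def[abs_def])
qed

lemma (in scalar_wiener) ito_integral_imp_limit:
  assumes "ito_integral M F T B H I"
  shows "ito_limit B H I"
proof -
  have prog: "progressively_measurable F T H"
    and fin: "AE \<omega> in M. (\<integral>\<^sup>+t\<in>{0..T}. ennreal ((H t \<omega>)\<^sup>2) \<partial>lborel) < \<infinity>"
    and I: "adapted F T I" "ae_continuous M T I"
    using assms by (auto simp: ito_integral_def)
  obtain n s \<xi> where si: "\<And>l::nat. simple_integrand M F T (n l) (s l) (\<xi> l)"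
    and z1: "tendsto_zero_in_prob M
          (\<lambda>l \<omega>. \<integral>\<^sup>+t\<in>{0..T}. ennreal ((simple_value (n l) (s l) (\<xi> l) t \<omega> - H t \<omega>)\<^sup>2) \<partial>lborel)"
    and z2: "tendsto_zero_in_prob M
          (\<lambda>l \<omega>. SUP t\<in>{0..T}. ennreal \<bar>simple_integral B (n l) (s l) (\<xi> l) t \<omega> - I t \<omega>\<bar>)"
    using assms unfolding ito_integral_def by blast
  define h where "h l = simple_value (n l) (s l) (\<xi> l)" for l
  define J where "J l = simple_integral B (n l) (s l) (\<xi> l)" for l
  have conv: "(\<integral>\<^sup>+t\<in>{0..T}. f t \<partial>lborel) = (\<integral>\<^sup>+t. f t \<partial>time)" for f :: "real \<Rightarrow> ennreal"
    by (subst nn_integral_restrict_space) auto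
  note joint = progressively_measurable_joint[OF prog]
  have IM: "I t \<in> borel_measurable M" if "t \<in> {0..T}" for t
    using I(1) that by (auto simp: adapted_def intro: measurable_F_M)
  have s_in: "k \<le> n l \<Longrightarrow> s l k \<in> {0..T}" for k l
    using si[of l] by (auto simp: simple_integrand_def)
  have JM: "J l t \<in> borel_measurable M" if "t \<in> {0..T}" for l t
    unfolding J_def by (rule simple_integral_measurable[OF si that])
  have J_cont: "ae_continuous M T (\<lambda>t \<omega>. J l t \<omega> - I t \<omega>)" for l
    using B_continuous I(2) unfolding ae_continuous_def
  proof eventually_elim
    case (elim \<omega>)
    have "continuous_on {0..T} (\<lambda>t. B (min (s l k) t) \<omega>)" if "k \<le> n l" for k
      using s_in[OF that]
      by (intro continuous_on_compose2[OF elim(1)] continuous_intros) auto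
    then show ?case
      unfolding J_def simple_integral_def
      by (intro continuous_on_diff continuous_on_sum continuous_on_mult continuous_on_const elim(2)) auto
  qed
  obtain r where r: "strict_mono r"
    "AE \<omega> in M. (\<lambda>l. \<integral>\<^sup>+t. ennreal ((h (r l) t \<omega> - H t \<omega>)\<^sup>2) \<partial>time) \<longlonglongrightarrow> 0"
  proof (rule tendsto_zero_in_prob_AE_subseq)
    show "(\<lambda>\<omega>. \<integral>\<^sup>+t. ennreal ((h l t \<omega> - H t \<omega>)\<^sup>2) \<partial>time) \<in> borel_measurable M" for l
      unfolding h_def
      by (intro nn_integral_time_measurable square_distance_measurable simple_value_joint_measurable si joint)
    show "tendsto_zero_in_prob M (\<lambda>l \<omega>. \<integral>\<^sup>+t. ennreal ((h l t \<omega> - H t \<omega>)\<^sup>2) \<partial>time)"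
      using z1 by (simp add: conv h_def)
  qed
  \<comment> \<open>Extracted from within \<open>r\<close>, so that the convergence of the
    integrands survives along the composed subsequence.\<close>
  obtain r' where r': "strict_mono r'"
    "AE \<omega> in M. (\<lambda>l. SUP t\<in>{0..T}. ennreal \<bar>J (r (r' l)) t \<omega> - I t \<omega>\<bar>) \<longlonglongrightarrow> 0"
  proof (rule tendsto_zero_in_prob_AE_subseq)
    show "(\<lambda>\<omega>. SUP t\<in>{0..T}. ennreal \<bar>J (r l) t \<omega> - I t \<omega>\<bar>) \<in> borel_measurable M" for l
      using JM IM by (intro measurable_SUP_continuous J_cont) auto
    show "tendsto_zero_in_prob M (\<lambda>l \<omega>. SUP t\<in>{0..T}. ennreal \<bar>J (r l) t \<omega> - I t \<omega>\<bar>)"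
      using tendsto_zero_in_prob_subseq[OF z2 r(1)] by (simp add: J_def)
  qed
  show ?thesis
  proof (rule ito_limitI[OF joint _ IM])
    show "AE \<omega> in M. (\<integral>\<^sup>+t. ennreal ((H t \<omega>)\<^sup>2) \<partial>time) < \<infinity>"
      using fin by (simp add: conv)
    show "elementary_integral M F T B (h (r (r' l))) (J (r (r' l)))" for l
      unfolding h_def J_def by (rule elementary_integral_simple[OF si])
    show "AE \<omega> in M. (\<lambda>l. \<integral>\<^sup>+t. ennreal ((h (r (r' l)) t \<omega> - H t \<omega>)\<^sup>2) \<partial>time) \<longlonglongrightarrow> 0"
      using r(2)
    proof eventually_elim
      case (elim \<omega>)
      from LIMSEQ_subseq_LIMSEQ[OF elim r'(1)] show ?case by (simp add: comp_def)
    qed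
    show "AE \<omega> in M. \<forall>t\<in>{0..T}. (\<lambda>l. J (r (r' l)) t \<omega>) \<longlonglongrightarrow> I t \<omega>"
      using r'(2)
    proof eventually_elim
      case (elim \<omega>)
      show ?case
      proof
        fix t assume t: "t \<in> {0..T}"
        have "(\<lambda>l. ennreal \<bar>J (r (r' l)) t \<omega> - I t \<omega>\<bar>) \<longlonglongrightarrow> 0"
          by (rule tendsto_0_le_ennreal[OF SUP_upper[OF t] elim])
        then have "(\<lambda>l. ennreal \<bar>J (r (r' l)) t \<omega> - I t \<omega>\<bar>) \<longlonglongrightarrow> ennreal 0" by simp
        then have "(\<lambda>l. \<bar>J (r (r' l)) t \<omega> - I t \<omega>\<bar>) \<longlonglongrightarrow> 0"
          by (subst (asm) tendsto_ennreal_iff) auto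
        then show "(\<lambda>l. J (r (r' l)) t \<omega>) \<longlonglongrightarrow> I t \<omega>"
          by (rule Lim_null[THEN iffD2, OF tendsto_rabs_zero_cancel])
      qed
    qed
  qed
qed

subsection \<open>A maximal inequality up to a stopping time\<close>

text \<open>The test includes the current term, so the last term kept cannot overshoot
  \<open>c\<close>.\<close>

lemma sum_truncated_le:
  fixes a :: "nat \<Rightarrow> real"
  assumes "\<And>j. 0 \<le> a j" "0 \<le> c"
  shows "(\<Sum>j<n. if (\<Sum>i\<le>j. a i) \<le> c then a j else 0) \<le> c"
proof (induction n)
  case (Suc n)
  show ?case
  proof (cases "(\<Sum>i\<le>n. a i) \<le> c")
    case True
    have "(\<Sum>j<Suc n. if (\<Sum>i\<le>j. a i) \<le> c then a j else 0) \<le> (\<Sum>j<Suc n. a j)"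
      using assms by (intro sum_mono) auto
    also have "\<dots> \<le> c" using True by (simp add: lessThan_Suc_atMost)
    finally show ?thesis .
  next
    case False
    then show ?thesis using Suc by simp
  qed
qed (use assms in simp)

lemma grid_cell_unique:
  fixes p :: "nat \<Rightarrow> real"
  assumes "mono_on {..n} p" "i < n" "j < n" "t \<in> {p i<..p (Suc i)}" "t \<in> {p j<..p (Suc j)}"
  shows "i = j"
proof -
  have "\<not> Suc i \<le> j" using mono_onD[OF assms(1), of "Suc i" j] assms(2-5) by auto
  moreover have "\<not> Suc j \<le> i" using mono_onD[OF assms(1), of "Suc j" i] assms(2-5) by auto
  ultimately show ?thesis by simp
qed

lemma sum_grid_cell:
  fixes p :: "nat \<Rightarrow> real" and f :: "nat \<Rightarrow> 'b::semiring_1"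
  assumes "mono_on {..n} p" "j < n" "t \<in> {p j<..p (Suc j)}"
  shows "(\<Sum>i<n. f i * indicator {p i<..p (Suc i)} t) = f j"
proof -
  have "(\<Sum>i<n. f i * indicator {p i<..p (Suc i)} t) = (\<Sum>i<n. if i = j then f i else 0)"
    using assms grid_cell_unique[OF assms(1)] by (intro sum.cong) (auto simp: indicator_def)
  also have "\<dots> = f j" using assms(2) by simp
  finally show ?thesis .
qed

lemma fine_grid_exists:
  fixes T \<delta> :: real
  assumes "finite P" "P \<subseteq> {0..T}" "0 < T" "0 < \<delta>"
  obtains n and p :: "nat \<Rightarrow> real" where "mono_on {..n} p" "p ` {..n} \<subseteq> {0..T}" "P \<subseteq> p ` {..n}"
    "\<And>j. j < n \<Longrightarrow> p (Suc j) - p j \<le> \<delta>"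
proof -
  define Q where "Q = P \<union> {0, T} \<union> ((\<lambda>i. real i * \<delta>) ` {..nat \<lceil>T / \<delta>\<rceil>} \<inter> {0..T})"
  have "finite Q" "Q \<noteq> {}" using assms(1) by (auto simp: Q_def)
  then obtain n and p :: "nat \<Rightarrow> real" where p: "mono_on {..n} p" "p ` {..n} = Q"
    by (rule grid_exists)
  have QT: "Q \<subseteq> {0..T}" using assms by (auto simp: Q_def)
  have "p (Suc j) - p j \<le> \<delta>" if j: "j < n" for j
  proof (rule ccontr)
    assume gap: "\<not> p (Suc j) - p j \<le> \<delta>"
    have pj: "0 \<le> p j" "p (Suc j) \<le> T" using p(2) QT j by (auto simp: image_subset_iff)
    \<comment> \<open>The first multiple of \<open>\<delta>\<close> strictly beyond
      \<open>p j\<close>. A gap longer than \<open>\<delta>\<close> would contain it strictly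
      between two neighbouring grid points.\<close>
    define i where "i = nat \<lfloor>p j / \<delta>\<rfloor> + 1"
    have ri: "real i = of_int \<lfloor>p j / \<delta>\<rfloor> + 1" using pj assms(4) by (simp add: i_def)
    have "p j / \<delta> < real i" "real i \<le> p j / \<delta> + 1" unfolding ri by linarith+
    then have i: "p j < real i * \<delta>" "real i * \<delta> \<le> p j + \<delta>"
      using assms(4) by (auto simp: field_simps)
    with gap have i2: "real i * \<delta> < p (Suc j)" by linarith
    then have "real i < T / \<delta>" using pj assms(4) by (simp add: field_simps)
    then have "i \<le> nat \<lceil>T / \<delta>\<rceil>" by linarith
    then have "real i * \<delta> \<in> Q" using i i2 pj assms(4) by (auto simp: Q_def)
    then obtain k where k: "k \<le> n" "p k = real i * \<delta>" using p(2) by force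
    have "\<not> k \<le> j" using mono_onD[OF p(1), of k j] k i j by auto
    moreover have "\<not> Suc j \<le> k" using mono_onD[OF p(1), of "Suc j" k] k i2 j by auto
    ultimately show False by simp
  qed
  moreover have "P \<subseteq> Q" by (auto simp: Q_def)
  ultimately show thesis using p QT by (intro that[of n p]) simp_all
qed

context usual_filtered_prob_space
begin

text \<open>The indicator of \<open>{t \<le> \<tau>}\<close> for a stopping time \<open>\<tau>\<close>, stated without mentioning \<open>\<tau>\<close>:
  a decreasing and left-continuous adapted process.\<close>

definition survival :: "(real \<Rightarrow> 'a \<Rightarrow> bool) \<Rightarrow> bool" where
  "survival A \<longleftrightarrow>
     (\<forall>t\<in>{0..T}. Measurable.pred (F t) (A t)) \<and>
     Measurable.pred (M \<Otimes>\<^sub>M time) (\<lambda>(\<omega>, t). A t \<omega>) \<and>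
     (\<forall>\<omega>\<in>space M. \<forall>s t. 0 \<le> s \<longrightarrow> s \<le> t \<longrightarrow> t \<le> T \<longrightarrow> A t \<omega> \<longrightarrow> A s \<omega>) \<and>
     (\<forall>\<omega>\<in>space M. \<forall>t\<in>{0<..T}. \<not> A t \<omega> \<longrightarrow> (\<exists>s\<in>{0..<t}. \<not> A s \<omega>))"

lemma survival_measurable: "survival A \<Longrightarrow> t \<in> {0..T} \<Longrightarrow> Measurable.pred M (A t)"
  by (auto simp: survival_def intro: measurable_F_M)

lemma survival_antimono:
  "survival A \<Longrightarrow> \<omega> \<in> space M \<Longrightarrow> 0 \<le> s \<Longrightarrow> s \<le> t \<Longrightarrow> t \<le> T \<Longrightarrow> A t \<omega> \<Longrightarrow> A s \<omega>"
  unfolding survival_def by blast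

text \<open>The delay accounts for stopping at left ends of cells: when the mesh is at most
  \<open>\<delta>\<close>, survival at the left end of the cell of \<open>t\<close> guarantees
  survival at \<open>max 0 (t - \<delta>)\<close>, though perhaps not at \<open>t\<close>.\<close>

lemma survival_shift_joint:
  assumes "survival A" "0 \<le> \<delta>"
  shows "Measurable.pred (M \<Otimes>\<^sub>M time) (\<lambda>(\<omega>, t). A (max 0 (t - \<delta>)) \<omega>)"
proof -
  have A: "Measurable.pred (M \<Otimes>\<^sub>M time) (\<lambda>(\<omega>, t). A t \<omega>)"
    using assms by (simp add: survival_def)
  have "(\<lambda>t. max 0 (t - \<delta>)) \<in> measurable time time"
    using assms(2) by (intro measurable_restrict_space3) auto
  then have "(\<lambda>z. (fst z, max 0 (snd z - \<delta>))) \<in> measurable (M \<Otimes>\<^sub>M time) (M \<Otimes>\<^sub>M time)"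
    by (intro measurable_Pair measurable_compose[OF measurable_snd]) auto
  from measurable_compose[OF this A] show ?thesis by (simp add: split_beta')
qed

end

context scalar_wiener
begin

lemma elementary_integral_measurable:
  assumes "elementary_integral M F T B h J" "t \<in> {0..T}"
  shows "J t \<in> borel_measurable M"
  using assms(1) by (rule elementary_integral_simpleE) (use simple_integral_measurable[OF _ assms(2)] in simp)

text \<open>\<open>U\<close> dominates the energy of the stopped integrand: \<open>h\<close> is
  split into \<open>H\<close> and \<open>h - H\<close>, and only the part from \<open>H\<close>
  keeps the delayed survival indicator. The cap \<open>c\<close> bounds the right-hand side by a
  constant, which later permits dominated convergence, and changes nothing on the event
  \<open>U \<omega> \<le> ennreal c\<close>.\<close>

lemma maximal_inequality_elementary:
  assumes el: "elementary_integral M F T B h J" and A: "survival A"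
    and H: "(\<lambda>(\<omega>, t). H t \<omega>) \<in> borel_measurable (M \<Otimes>\<^sub>M time)"
    and S: "finite S" "S \<subseteq> {0..T}" and \<delta>: "0 < \<delta>" and c: "0 \<le> c"
  defines "U \<equiv> \<lambda>\<omega>. 2 * (\<integral>\<^sup>+t. (if A (max 0 (t - \<delta>)) \<omega> then ennreal ((H t \<omega>)\<^sup>2) else 0) \<partial>time)
    + 2 * (\<integral>\<^sup>+t. ennreal ((h t \<omega> - H t \<omega>)\<^sup>2) \<partial>time)"
  shows "(\<integral>\<^sup>+\<omega>. (SUP t\<in>S. if A t \<omega> \<and> U \<omega> \<le> ennreal c then ennreal ((J t \<omega>)\<^sup>2) else 0) \<partial>M)
    \<le> 4 * (\<integral>\<^sup>+\<omega>. min (U \<omega>) (ennreal c) \<partial>M)"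
proof -
  obtain P where P: "finite P" "P \<subseteq> {0..T}"
    "\<And>n p. mono_on {..n} p \<Longrightarrow> p ` {..n} \<subseteq> {0..T} \<Longrightarrow> P \<subseteq> p ` {..n} \<Longrightarrow>
           \<exists>\<xi>. simple_integrand M F T n p \<xi> \<and> h = simple_value n p \<xi> \<and> J = simple_integral B n p \<xi>"
    using el unfolding elementary_integral_def by blast
  \<comment> \<open>The grid contains \<open>P\<close>, so that \<open>h\<close> and
    \<open>J\<close> are simple on it, and \<open>S\<close>, so that the supremum runs over grid
    points.\<close>
  obtain n and p :: "nat \<Rightarrow> real" where p: "mono_on {..n} p" "p ` {..n} \<subseteq> {0..T}" "P \<union> S \<subseteq> p ` {..n}"
    and mesh: "\<And>j. j < n \<Longrightarrow> p (Suc j) - p j \<le> \<delta>"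
    using fine_grid_exists[of "P \<union> S" T \<delta>] P S \<delta> T_pos by auto
  obtain \<xi> where \<xi>: "simple_integrand M F T n p \<xi>" and h: "h = simple_value n p \<xi>"
    and J: "J = simple_integral B n p \<xi>"
    using P(3)[OF p(1,2)] p(3) by auto
  have p_in: "j \<le> n \<Longrightarrow> 0 \<le> p j \<and> p j \<le> T" for j
    using p(2) by (auto simp: image_subset_iff)
  have p_mono: "i \<le> j \<Longrightarrow> j \<le> n \<Longrightarrow> p i \<le> p j" for i j
    using mono_onD[OF p(1), of i j] by simp
  define a where "a j \<omega> = (if A (p j) \<omega> then (\<xi> j \<omega>)\<^sup>2 * (p (Suc j) - p j) else 0)" for j \<omega>
  \<comment> \<open>The coefficient is kept while the path survives and the energy up to and
    including the current cell is at most \<open>c\<close>. That energy is known at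
    \<open>p j\<close>, since the length of the cell is deterministic, so \<open>\<eta> j\<close> is
    an admissible coefficient.\<close>
  define \<eta> where "\<eta> j \<omega> = (if A (p j) \<omega> \<and> (\<Sum>i\<le>j. a i \<omega>) \<le> c then \<xi> j \<omega> else 0)" for j \<omega>
  define X where "X \<omega> k = (\<Sum>j<k. \<eta> j \<omega> * (B (p (Suc j)) \<omega> - B (p j) \<omega>))" for \<omega> k
  have \<xi>_meas: "\<xi> j \<in> borel_measurable (F (p j))" if "j < n" for j
    using \<xi> that by (auto simp: simple_integrand_def)
  have A_meas: "Measurable.pred (F (p j)) (A (p j))" if "j \<le> n" for j
    using A p_in[OF that] by (auto simp: survival_def)
  have a_meas: "a i \<in> borel_measurable (F (p j))" if "i \<le> j" "j < n" for i j
  proof -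
    have [measurable]: "\<xi> i \<in> borel_measurable (F (p j))" "Measurable.pred (F (p j)) (A (p i))"
      using that p_in[of i] p_in[of j] p_mono[of i j]
        measurable_F_mono[of "p i" "p j", OF _ _ _ \<xi>_meas[of i]]
        measurable_F_mono[of "p i" "p j", OF _ _ _ A_meas[of i]] by auto
    show ?thesis unfolding a_def by measurable
  qed
  have \<eta>_meas: "\<eta> j \<in> borel_measurable (F (p j))" if j: "j < n" for j
  proof -
    note [measurable] = \<xi>_meas[OF j] A_meas[OF less_imp_le[OF j]]
    define s where "s \<omega> = (\<Sum>i\<le>j. a i \<omega>)" for \<omega>
    have [measurable]: "s \<in> borel_measurable (F (p j))"
      unfolding s_def using a_meas j by (intro borel_measurable_sum) auto
    show ?thesis unfolding \<eta>_def s_def[symmetric] by measurable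
  qed
  have \<eta>_bd: "\<exists>C. \<forall>\<omega>\<in>space M. \<bar>\<eta> j \<omega>\<bar> \<le> C" if "j < n" for j
  proof -
    have "\<exists>C. \<forall>\<omega>\<in>space M. \<bar>\<xi> j \<omega>\<bar> \<le> C"
      using \<xi> that by (simp add: simple_integrand_def)
    then obtain C where "\<forall>\<omega>\<in>space M. \<bar>\<xi> j \<omega>\<bar> \<le> C" ..
    then have "\<forall>\<omega>\<in>space M. \<bar>\<eta> j \<omega>\<bar> \<le> max C 0"
      by (simp add: \<eta>_def max.coboundedI1)
    then show ?thesis by blast
  qed
  have a_nonneg: "0 \<le> a j \<omega>" if "j < n" for j \<omega>
    using that p_mono[of j "Suc j"] by (auto simp: a_def)
  have sum_a: "ennreal (\<Sum>j<n. a j \<omega>) \<le> U \<omega>" if \<omega>: "\<omega> \<in> space M" for \<omega>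
  proof -
    have [measurable]: "(\<lambda>t. H t \<omega>) \<in> borel_measurable time" "(\<lambda>t. h t \<omega>) \<in> borel_measurable time"
      "Measurable.pred time (\<lambda>t. A (max 0 (t - \<delta>)) \<omega>)"
      using section_measurable[OF H \<omega>] section_measurable[OF elementary_integral_joint_measurable[OF el] \<omega>]
        section_measurable[OF survival_shift_joint[OF A] \<omega>, of \<delta>] \<delta> by auto
    define w where "w j = (if A (p j) \<omega> then ennreal ((\<xi> j \<omega>)\<^sup>2) else 0)" for j
    have "ennreal (\<Sum>j<n. a j \<omega>) = (\<Sum>j<n. ennreal (a j \<omega>))"
      using a_nonneg by (intro sum_ennreal[symmetric]) auto
    also have "\<dots> = (\<Sum>j<n. \<integral>\<^sup>+t. w j * indicator {p j<..p (Suc j)} t \<partial>time)"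
    proof (rule sum.cong)
      fix j assume "j \<in> {..<n}"
      then have j: "j < n" by simp
      then have "0 \<le> p j" "p j \<le> p (Suc j)" "p (Suc j) \<le> T"
        using p_in[of j] p_in[of "Suc j"] p_mono[of j "Suc j"] by auto
      then show "ennreal (a j \<omega>) = (\<integral>\<^sup>+t. w j * indicator {p j<..p (Suc j)} t \<partial>time)"
        by (simp add: nn_integral_cmult_indicator sets_time_Ioc emeasure_time a_def w_def ennreal_mult')
    qed simp
    also have "\<dots> = (\<integral>\<^sup>+t. (\<Sum>j<n. w j * indicator {p j<..p (Suc j)} t) \<partial>time)"
    proof (rule nn_integral_sum[symmetric])
      fix j assume "j \<in> {..<n}"
      then have "{p j<..p (Suc j)} \<in> sets time"
        using p_in[of j] p_in[of "Suc j"] by (intro sets_time_Ioc) auto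
      then show "(\<lambda>t. w j * indicator {p j<..p (Suc j)} t) \<in> borel_measurable time"
        by (intro borel_measurable_times_ennreal borel_measurable_indicator) auto
    qed
    also have "\<dots> \<le> (\<integral>\<^sup>+t. 2 * (if A (max 0 (t - \<delta>)) \<omega> then ennreal ((H t \<omega>)\<^sup>2) else 0)
        + 2 * ennreal ((h t \<omega> - H t \<omega>)\<^sup>2) \<partial>time)"
    proof (rule nn_integral_mono)
      fix t assume "t \<in> space time"
      then have t: "0 \<le> t" "t \<le> T" by (auto simp: space_time)
      show "(\<Sum>j<n. w j * indicator {p j<..p (Suc j)} t) \<le>
        2 * (if A (max 0 (t - \<delta>)) \<omega> then ennreal ((H t \<omega>)\<^sup>2) else 0) + 2 * ennreal ((h t \<omega> - H t \<omega>)\<^sup>2)"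
      proof (cases "\<exists>j<n. t \<in> {p j<..p (Suc j)}")
        case False
        then have "(\<Sum>j<n. w j * indicator {p j<..p (Suc j)} t) = 0"
          by (intro sum.neutral) (auto simp: indicator_def)
        then show ?thesis by simp
      next
        case True
        then obtain j where j: "j < n" "t \<in> {p j<..p (Suc j)}" by auto
        have h_eq: "h t \<omega> = \<xi> j \<omega>"
          unfolding h simple_value_def by (rule sum_grid_cell[OF p(1) j])
        have sum_eq: "(\<Sum>j<n. w j * indicator {p j<..p (Suc j)} t) = w j"
          by (rule sum_grid_cell[OF p(1) j])
        show ?thesis
        proof (cases "A (p j) \<omega>")
          case True
          have "max 0 (t - \<delta>) \<le> p j"
            using mesh[OF j(1)] j(2) p_in[of j] j(1) by auto
          then have A': "A (max 0 (t - \<delta>)) \<omega>"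
            using survival_antimono[OF A \<omega> _ _ _ True] p_in[of j] j(1) by auto
          have "(h t \<omega>)\<^sup>2 \<le> 2 * (H t \<omega>)\<^sup>2 + 2 * (h t \<omega> - H t \<omega>)\<^sup>2"
            using zero_le_power2[of "2 * H t \<omega> - h t \<omega>"] by (simp add: power2_eq_square algebra_simps)
          then have "ennreal ((h t \<omega>)\<^sup>2) \<le> ennreal (2 * (H t \<omega>)\<^sup>2 + 2 * (h t \<omega> - H t \<omega>)\<^sup>2)"
            by (rule ennreal_leI)
          then show ?thesis
            using True A' unfolding sum_eq by (simp add: w_def h_eq ennreal_mult')
        next
          case False
          then have "w j = 0" by (simp add: w_def)
          then show ?thesis unfolding sum_eq by simp
        qed
      qed
    qed
    also have "\<dots> = U \<omega>"
      unfolding U_def by (simp add: nn_integral_add nn_integral_cmult)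
    finally show ?thesis .
  qed
  have "(\<integral>\<^sup>+\<omega>. (SUP t\<in>S. if A t \<omega> \<and> U \<omega> \<le> ennreal c then ennreal ((J t \<omega>)\<^sup>2) else 0) \<partial>M)
      \<le> (\<integral>\<^sup>+\<omega>. ennreal ((running_max (X \<omega>) n)\<^sup>2) \<partial>M)"
  proof (intro nn_integral_mono SUP_least)
    fix \<omega> t assume \<omega>: "\<omega> \<in> space M" and t: "t \<in> S"
    show "(if A t \<omega> \<and> U \<omega> \<le> ennreal c then ennreal ((J t \<omega>)\<^sup>2) else 0) \<le> ennreal ((running_max (X \<omega>) n)\<^sup>2)"
    proof (cases "A t \<omega> \<and> U \<omega> \<le> ennreal c")
      case True
      obtain k where k: "k \<le> n" "t = p k" using t p(3) by auto
      have small: "(\<Sum>i\<le>j. a i \<omega>) \<le> c" if "j < n" for j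
      proof -
        have "(\<Sum>i\<le>j. a i \<omega>) \<le> (\<Sum>i<n. a i \<omega>)"
          using that a_nonneg by (intro sum_mono2) auto
        moreover have "(\<Sum>i<n. a i \<omega>) \<le> c"
          using order_trans[OF sum_a[OF \<omega>] conjunct2[OF True]] c by (simp add: ennreal_le_iff)
        ultimately show ?thesis by simp
      qed
      \<comment> \<open>Clipping at \<open>p k\<close> removes the cells from \<open>k\<close> on.
        On the earlier cells neither survival nor the energy test fails, so \<open>\<xi>\<close> and
        \<open>\<eta>\<close> agree there.\<close>
      have "J t \<omega> = (\<Sum>j<n. if j < k then \<xi> j \<omega> * (B (p (Suc j)) \<omega> - B (p j) \<omega>) else 0)"
        unfolding J simple_integral_def k(2)
      proof (rule sum.cong)
        fix j assume "j \<in> {..<n}"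
        then show "\<xi> j \<omega> * (B (min (p (Suc j)) (p k)) \<omega> - B (min (p j) (p k)) \<omega>) =
          (if j < k then \<xi> j \<omega> * (B (p (Suc j)) \<omega> - B (p j) \<omega>) else 0)"
          using p_mono[of "Suc j" k] p_mono[of j k] p_mono[of k j] p_mono[of k "Suc j"] k(1)
          by (cases "j < k") (auto simp: min_absorb1 min_absorb2)
      qed simp
      also have "\<dots> = (\<Sum>j\<in>{..<k}. \<xi> j \<omega> * (B (p (Suc j)) \<omega> - B (p j) \<omega>))"
        using k(1) by (intro sum.mono_neutral_cong_right) auto
      also have "\<dots> = X \<omega> k"
        unfolding X_def
      proof (rule sum.cong)
        fix j assume "j \<in> {..<k}"
        then have j: "j < k" by simp
        have "A (p j) \<omega>"
          using survival_antimono[OF A \<omega>, of "p j" "p k"] True k p_in[of j] p_in[of k] p_mono[of j k] j by auto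
        then show "\<xi> j \<omega> * (B (p (Suc j)) \<omega> - B (p j) \<omega>) = \<eta> j \<omega> * (B (p (Suc j)) \<omega> - B (p j) \<omega>)"
          using small[of j] j k(1) by (simp add: \<eta>_def)
      qed simp
      finally have "\<bar>J t \<omega>\<bar> \<le> running_max (X \<omega>) n"
        using abs_le_running_max[OF k(1), of "X \<omega>"] by simp
      then have "(J t \<omega>)\<^sup>2 \<le> (running_max (X \<omega>) n)\<^sup>2"
        using power_mono[of "\<bar>J t \<omega>\<bar>" _ 2] by simp
      then show ?thesis using True by (simp add: ennreal_leI)
    next
      case False
      then show ?thesis by (subst if_not_P) simp_all
    qed
  qed
  also have "\<dots> \<le> 4 * (\<integral>\<^sup>+\<omega>. ennreal (\<Sum>j<n. (\<eta> j \<omega>)\<^sup>2 * (p (Suc j) - p j)) \<partial>M)"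
    unfolding X_def by (rule maximal_inequality_simple[OF p(1,2) \<eta>_meas \<eta>_bd])
  also have "\<dots> \<le> 4 * (\<integral>\<^sup>+\<omega>. min (U \<omega>) (ennreal c) \<partial>M)"
  proof (intro mult_left_mono nn_integral_mono min.boundedI)
    fix \<omega> assume \<omega>: "\<omega> \<in> space M"
    have *: "(\<Sum>j<n. (\<eta> j \<omega>)\<^sup>2 * (p (Suc j) - p j)) = (\<Sum>j<n. if (\<Sum>i\<le>j. a i \<omega>) \<le> c then a j \<omega> else 0)"
      by (intro sum.cong) (auto simp: \<eta>_def a_def)
    have "(\<Sum>j<n. (\<eta> j \<omega>)\<^sup>2 * (p (Suc j) - p j)) \<le> (\<Sum>j<n. a j \<omega>)"
      unfolding * using a_nonneg by (intro sum_mono) auto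
    then show "ennreal (\<Sum>j<n. (\<eta> j \<omega>)\<^sup>2 * (p (Suc j) - p j)) \<le> U \<omega>"
      using sum_a[OF \<omega>] by (meson ennreal_leI order_trans)
    \<comment> \<open>Extended by 0 beyond \<open>n\<close>, because \<open>sum_truncated_le\<close>
      asks for nonnegative terms at every index.\<close>
    have "(\<Sum>j<n. (\<eta> j \<omega>)\<^sup>2 * (p (Suc j) - p j)) =
        (\<Sum>j<n. if (\<Sum>i\<le>j. if i < n then a i \<omega> else 0) \<le> c then (if j < n then a j \<omega> else 0) else 0)"
      unfolding * by (intro sum.cong if_cong arg_cong2[where f="(\<le>)"]) auto
    also have "\<dots> \<le> c"
      using a_nonneg c by (intro sum_truncated_le) auto
    finally show "ennreal (\<Sum>j<n. (\<eta> j \<omega>)\<^sup>2 * (p (Suc j) - p j)) \<le> ennreal c"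
      by (rule ennreal_leI)
  qed simp
  finally show ?thesis .
qed

text \<open>Fatou's lemma on the left and dominated convergence on the right, with the cap as
  dominating constant. The factor 8 is Doob's 4 times the 2 lost in splitting
  \<open>h\<close>.\<close>

lemma maximal_inequality_finite:
  assumes ito: "ito_limit B H I" and A: "survival A" and S: "finite S" "S \<subseteq> {0..T}" and K: "0 \<le> K"
    and bd: "AE \<omega> in M. (\<integral>\<^sup>+t. (if A t \<omega> then ennreal ((H t \<omega>)\<^sup>2) else 0) \<partial>time) \<le> ennreal K"
  shows "(\<integral>\<^sup>+\<omega>. (SUP t\<in>S. if A t \<omega> then ennreal ((I t \<omega>)\<^sup>2) else 0) \<partial>M)
    \<le> 8 * (\<integral>\<^sup>+\<omega>. \<integral>\<^sup>+t. (if A t \<omega> then ennreal ((H t \<omega>)\<^sup>2) else 0) \<partial>time \<partial>M)"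
proof -
  have H: "(\<lambda>(\<omega>, t). H t \<omega>) \<in> borel_measurable (M \<Otimes>\<^sub>M time)"
    and fin: "AE \<omega> in M. (\<integral>\<^sup>+t. ennreal ((H t \<omega>)\<^sup>2) \<partial>time) < \<infinity>"
    using ito by (auto simp: ito_limit_def)
  obtain h J where el: "\<And>l. elementary_integral M F T B (h l) (J l)"
    and hl: "AE \<omega> in M. (\<lambda>l::nat. \<integral>\<^sup>+t. ennreal ((h l t \<omega> - H t \<omega>)\<^sup>2) \<partial>time) \<longlonglongrightarrow> 0"
    and Jl: "AE \<omega> in M. \<forall>t\<in>{0..T}. (\<lambda>l. J l t \<omega>) \<longlonglongrightarrow> I t \<omega>"
    using ito by (auto simp: ito_limit_def)
  define \<delta> where "\<delta> l = inverse (real (Suc l))" for l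
  define V where "V \<omega> = (\<integral>\<^sup>+t. (if A t \<omega> then ennreal ((H t \<omega>)\<^sup>2) else 0) \<partial>time)" for \<omega>
  define a where "a l \<omega> = (\<integral>\<^sup>+t. (if A (max 0 (t - \<delta> l)) \<omega> then ennreal ((H t \<omega>)\<^sup>2) else 0) \<partial>time)" for l \<omega>
  define b where "b l \<omega> = (\<integral>\<^sup>+t. ennreal ((h l t \<omega> - H t \<omega>)\<^sup>2) \<partial>time)" for l \<omega>
  define U where "U l \<omega> = 2 * a l \<omega> + 2 * b l \<omega>" for l \<omega>
  \<comment> \<open>Strictly above the limit \<open>2 * V \<omega>\<close> of
    \<open>U l \<omega>\<close>, so that almost surely the cap is eventually inactive.\<close>
  define c where "c = 2 * K + 1"
  let ?I = "\<lambda>t \<omega>. if A t \<omega> then ennreal ((I t \<omega>)\<^sup>2) else 0"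
    and ?Z = "\<lambda>l \<omega>. SUP t\<in>S. if A t \<omega> \<and> U l \<omega> \<le> ennreal c then ennreal ((J l t \<omega>)\<^sup>2) else 0"
  have \<delta>_pos: "0 < \<delta> l" for l by (simp add: \<delta>_def)
  have AJ: "Measurable.pred (M \<Otimes>\<^sub>M time) (\<lambda>(\<omega>, t). A t \<omega>)"
    using A by (simp add: survival_def)
  have V_meas [measurable]: "V \<in> borel_measurable M"
    unfolding V_def by (rule nn_integral_time_measurable)
      (use AJ H in \<open>unfold split_beta', measurable\<close>)
  have a_meas [measurable]: "a l \<in> borel_measurable M" for l
    unfolding a_def by (rule nn_integral_time_measurable)
      (use survival_shift_joint[OF A less_imp_le[OF \<delta>_pos[of l]]] H in \<open>unfold split_beta', measurable\<close>)
  have b_meas [measurable]: "b l \<in> borel_measurable M" for l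
    unfolding b_def
    by (intro nn_integral_time_measurable square_distance_measurable elementary_integral_joint_measurable[OF el] H)
  have U_meas [measurable]: "U l \<in> borel_measurable M" for l
    unfolding U_def by measurable
  have step: "(\<integral>\<^sup>+\<omega>. ?Z l \<omega> \<partial>M)
      \<le> 4 * (\<integral>\<^sup>+\<omega>. min (U l \<omega>) (ennreal c) \<partial>M)" for l
    using maximal_inequality_elementary[OF el A H S \<delta>_pos, of c l l] K
    by (simp add: U_def a_def b_def c_def)
  have U_lim: "AE \<omega> in M. (\<lambda>l. U l \<omega>) \<longlonglongrightarrow> 2 * V \<omega>"
    using hl fin AE_space
  proof eventually_elim
    case (elim \<omega>)
    have secs: "(\<lambda>t. H t \<omega>) \<in> borel_measurable time" "Measurable.pred time (\<lambda>t. A t \<omega>)"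
      using section_measurable[OF H elim(3)] section_measurable[OF AJ elim(3)] by auto
    have secs': "Measurable.pred time (\<lambda>t. A (max 0 (t - \<delta> l)) \<omega>)" for l
      using section_measurable[OF survival_shift_joint[OF A less_imp_le[OF \<delta>_pos]] elim(3)] .
    note [measurable] = secs secs'
    \<comment> \<open>The delayed indicators converge at every \<open>t\<close>: a surviving path
      also survived earlier, and a path dead at \<open>t > 0\<close> was dead at some
      \<open>s < t\<close>, which the delay no longer reaches once it is below \<open>t - s\<close>.
      At \<open>t = 0\<close> the maximum with 0 removes the delay.\<close>
    have "(\<lambda>l. a l \<omega>) \<longlonglongrightarrow> V \<omega>"
      unfolding a_def V_def
    proof (rule nn_integral_dominated_convergence[where w="\<lambda>t. ennreal ((H t \<omega>)\<^sup>2)"])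
      show "AE t in time. (\<lambda>l. if A (max 0 (t - \<delta> l)) \<omega> then ennreal ((H t \<omega>)\<^sup>2) else 0) \<longlonglongrightarrow>
          (if A t \<omega> then ennreal ((H t \<omega>)\<^sup>2) else 0)"
      proof (rule AE_I2, rule tendsto_eventually)
        fix t assume "t \<in> space time"
        then have t: "0 \<le> t" "t \<le> T" by (auto simp: space_time)
        have "\<forall>\<^sub>F l in sequentially. A (max 0 (t - \<delta> l)) \<omega> = A t \<omega>"
        proof (cases "A t \<omega>")
          case True
          have "A (max 0 (t - \<delta> l)) \<omega>" for l
            using survival_antimono[OF A elim(3) _ _ t(2) True] t \<delta>_pos[of l] by auto
          with True show ?thesis by simp
        next
          case False
          show ?thesis
          proof (cases "t = 0")
            case True
            then show ?thesis using \<delta>_pos by (simp add: max_absorb1 less_imp_le)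
          next
            case t0: False
            then have "t \<in> {0<..T}" using t by auto
            then obtain s where s: "0 \<le> s" "s < t" "\<not> A s \<omega>"
              using A False elim(3) unfolding survival_def by fastforce
            have "\<delta> \<longlonglongrightarrow> 0" unfolding \<delta>_def by (rule LIMSEQ_inverse_real_of_nat)
            then have "\<forall>\<^sub>F l in sequentially. \<delta> l < t - s"
              using s by (intro order_tendstoD) auto
            then show ?thesis
            proof eventually_elim
              case el2: (elim l)
              have "\<not> A (max 0 (t - \<delta> l)) \<omega>"
                using survival_antimono[OF A elim(3) s(1), of "max 0 (t - \<delta> l)"] s t el2 \<delta>_pos[of l] by auto
              with False show ?case by simp
            qed
          qed
        qed
        then show "\<forall>\<^sub>F l in sequentially. (if A (max 0 (t - \<delta> l)) \<omega> then ennreal ((H t \<omega>)\<^sup>2) else 0) =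
          (if A t \<omega> then ennreal ((H t \<omega>)\<^sup>2) else 0)"
          by eventually_elim simp
      qed
    qed (use elim(2) in auto)
    moreover have "(\<lambda>l. b l \<omega>) \<longlonglongrightarrow> 0" using elim(1) by (simp add: b_def)
    ultimately have "(\<lambda>l. U l \<omega>) \<longlonglongrightarrow> 2 * V \<omega> + 2 * 0"
      unfolding U_def by (intro tendsto_add ennreal_tendsto_cmult) simp_all
    then show ?case by simp
  qed
  have bdV: "AE \<omega> in M. V \<omega> \<le> ennreal K" using bd by (simp add: V_def)
  have "(\<integral>\<^sup>+\<omega>. (SUP t\<in>S. ?I t \<omega>) \<partial>M)
      \<le> (\<integral>\<^sup>+\<omega>. liminf (\<lambda>l. ?Z l \<omega>) \<partial>M)"
  proof (rule nn_integral_mono_AE)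
    show "AE \<omega> in M. (SUP t\<in>S. ?I t \<omega>) \<le>
      liminf (\<lambda>l. ?Z l \<omega>)"
      using U_lim bdV Jl
    proof eventually_elim
      case (elim \<omega>)
      have "2 * V \<omega> \<le> 2 * ennreal K" using elim(2) by (intro mult_left_mono) auto
      also have "\<dots> = ennreal (2 * K)" using K by (simp add: ennreal_mult')
      also have "\<dots> < ennreal c" using K by (simp add: c_def ennreal_lessI)
      finally have ev: "\<forall>\<^sub>F l in sequentially. U l \<omega> < ennreal c"
        using elim(1) by (intro order_tendstoD)
      show ?case
      proof (rule SUP_least)
        fix t assume t: "t \<in> S"
        have "(\<lambda>l. ennreal ((J l t \<omega>)\<^sup>2)) \<longlonglongrightarrow> ennreal ((I t \<omega>)\<^sup>2)"
          using elim(3) t S by (intro tendsto_ennrealI tendsto_power) auto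
        then have "(\<lambda>l. if A t \<omega> then ennreal ((J l t \<omega>)\<^sup>2) else 0)
            \<longlonglongrightarrow> ?I t \<omega>"
          by (cases "A t \<omega>") simp_all
        moreover have "\<forall>\<^sub>F l in sequentially. (if A t \<omega> then ennreal ((J l t \<omega>)\<^sup>2) else 0) =
            (if A t \<omega> \<and> U l \<omega> \<le> ennreal c then ennreal ((J l t \<omega>)\<^sup>2) else 0)"
          using ev by eventually_elim (simp add: less_imp_le)
        ultimately have "(\<lambda>l. if A t \<omega> \<and> U l \<omega> \<le> ennreal c then ennreal ((J l t \<omega>)\<^sup>2) else 0)
            \<longlonglongrightarrow> ?I t \<omega>"
          by (rule Lim_transform_eventually)
        then have "?I t \<omega> =
          liminf (\<lambda>l. if A t \<omega> \<and> U l \<omega> \<le> ennreal c then ennreal ((J l t \<omega>)\<^sup>2) else 0)"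
          by (intro lim_imp_Liminf[symmetric]) auto
        also have "\<dots> \<le> liminf (\<lambda>l. ?Z l \<omega>)"
          by (intro Liminf_mono always_eventually allI SUP_upper2[OF t order_refl])
        finally show "?I t \<omega> \<le>
          liminf (\<lambda>l. ?Z l \<omega>)" .
      qed
    qed
  qed
  also have "\<dots> \<le> liminf (\<lambda>l. \<integral>\<^sup>+\<omega>. ?Z l \<omega> \<partial>M)"
  proof (rule nn_integral_liminf)
    fix l
    have "J l t \<in> borel_measurable M" if "t \<in> S" for t
      using elementary_integral_measurable[OF el] that S by auto
    then show "(\<lambda>\<omega>. ?Z l \<omega>) \<in> borel_measurable M"
      using S survival_measurable[OF A]
      by (intro borel_measurable_SUP countable_finite measurable_If) auto
  qed
  also have "\<dots> \<le> liminf (\<lambda>l. 4 * (\<integral>\<^sup>+\<omega>. min (U l \<omega>) (ennreal c) \<partial>M))"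
    by (intro Liminf_mono always_eventually allI step)
  also have "\<dots> = 4 * (\<integral>\<^sup>+\<omega>. min (2 * V \<omega>) (ennreal c) \<partial>M)"
  proof (rule lim_imp_Liminf)
    have "(\<lambda>l. \<integral>\<^sup>+\<omega>. min (U l \<omega>) (ennreal c) \<partial>M) \<longlonglongrightarrow> (\<integral>\<^sup>+\<omega>. min (2 * V \<omega>) (ennreal c) \<partial>M)"
    proof (rule nn_integral_dominated_convergence[where w="\<lambda>_. ennreal c"])
      show "AE \<omega> in M. (\<lambda>l. min (U l \<omega>) (ennreal c)) \<longlonglongrightarrow> min (2 * V \<omega>) (ennreal c)"
        using U_lim by eventually_elim (intro tendsto_min tendsto_const)
    qed (auto simp: emeasure_space_1)
    then show "(\<lambda>l. 4 * (\<integral>\<^sup>+\<omega>. min (U l \<omega>) (ennreal c) \<partial>M)) \<longlonglongrightarrow> 4 * (\<integral>\<^sup>+\<omega>. min (2 * V \<omega>) (ennreal c) \<partial>M)"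
      by (intro ennreal_tendsto_cmult) simp_all
  qed simp
  also have "\<dots> \<le> 4 * (\<integral>\<^sup>+\<omega>. 2 * V \<omega> \<partial>M)"
    by (intro mult_left_mono nn_integral_mono) auto
  also have "\<dots> = 8 * (\<integral>\<^sup>+\<omega>. V \<omega> \<partial>M)"
    by (simp add: nn_integral_cmult mult.assoc[symmetric])
  finally show ?thesis by (simp add: V_def)
qed

lemma maximal_inequality:
  assumes ito: "ito_limit B H I" and A: "survival A" and S: "countable S" "S \<subseteq> {0..T}" and K: "0 \<le> K"
    and bd: "AE \<omega> in M. (\<integral>\<^sup>+t. (if A t \<omega> then ennreal ((H t \<omega>)\<^sup>2) else 0) \<partial>time) \<le> ennreal K"
  shows "(\<integral>\<^sup>+\<omega>. (SUP t\<in>S. if A t \<omega> then ennreal ((I t \<omega>)\<^sup>2) else 0) \<partial>M)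
    \<le> 8 * (\<integral>\<^sup>+\<omega>. \<integral>\<^sup>+t. (if A t \<omega> then ennreal ((H t \<omega>)\<^sup>2) else 0) \<partial>time \<partial>M)"
proof (cases "S = {}")
  case False
  define e where "e = from_nat_into S"
  have S_eq: "S = (\<Union>n. e ` {..n})"
    using range_from_nat_into[OF False S(1)] by (fastforce simp: e_def)
  let ?f = "\<lambda>t \<omega>. if A t \<omega> then ennreal ((I t \<omega>)\<^sup>2) else 0"
  have e_S: "e n \<in> {0..T}" for n
    using subsetD[OF S(2) from_nat_into[OF False]] by (simp add: e_def)
  have IM: "I t \<in> borel_measurable M" if "t \<in> {0..T}" for t
    using ito that by (auto simp: ito_limit_def)
  have "(SUP t\<in>S. ?f t \<omega>) = (SUP n. SUP t\<in>e ` {..n}. ?f t \<omega>)" for \<omega>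
    unfolding S_eq by (rule SUP_UNION)
  then have "(\<integral>\<^sup>+\<omega>. (SUP t\<in>S. ?f t \<omega>) \<partial>M) = (\<integral>\<^sup>+\<omega>. (SUP n. SUP t\<in>e ` {..n}. ?f t \<omega>) \<partial>M)"
    by simp
  also have "\<dots> = (SUP n. \<integral>\<^sup>+\<omega>. (SUP t\<in>e ` {..n}. ?f t \<omega>) \<partial>M)"
  proof (rule nn_integral_monotone_convergence_SUP)
    show "incseq (\<lambda>n \<omega>. SUP t\<in>e ` {..n}. ?f t \<omega>)"
      by (intro incseq_SucI le_funI SUP_subset_mono image_mono) auto
    show "(\<lambda>\<omega>. SUP t\<in>e ` {..n}. ?f t \<omega>) \<in> borel_measurable M" for n
      using e_S IM survival_measurable[OF A]
      by (intro borel_measurable_SUP countable_finite measurable_If) auto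
  qed
  also have "\<dots> \<le> 8 * (\<integral>\<^sup>+\<omega>. \<integral>\<^sup>+t. (if A t \<omega> then ennreal ((H t \<omega>)\<^sup>2) else 0) \<partial>time \<partial>M)"
    using e_S by (intro SUP_least maximal_inequality_finite[OF ito A _ _ K bd]) auto
  finally show ?thesis .
qed (simp add: bot_ennreal)

end

subsection \<open>The error of a stopped approximation\<close>

lemma square_sum_le_card:
  fixes f :: "'a \<Rightarrow> real"
  shows "(\<Sum>i\<in>S. f i)\<^sup>2 \<le> real (card S) * (\<Sum>i\<in>S. (f i)\<^sup>2)"
  using Cauchy_Schwarz_ineq_sum[of "\<lambda>_. 1" f S] by simp

lemma norm_square_vec: "(norm (v :: real ^ 'n))\<^sup>2 = (\<Sum>i\<in>UNIV. (v $ i)\<^sup>2)"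
  unfolding power2_norm_eq_inner inner_vec_def by (simp add: power2_eq_square)

text \<open>First summand: 2 from squaring drift plus noise, \<open>2 * (T + 1)\<close> from the
  squared drift integral, and \<open>d\<close> components. Second summand: the same 2,
  \<open>m\<close> from Cauchy-Schwarz over the noises, 8 from the maximal inequality, and
  \<open>d * m\<close> integrals.\<close>

definition noise_const :: "real \<Rightarrow> nat \<Rightarrow> nat \<Rightarrow> real" where
  "noise_const T d m = 4 * (T + 1) * d + 16 * m * m * d"

text \<open>The step size makes the coefficient of the error on the current step at most \<open>1/2\<close>, so that
  it can be absorbed; iterating over the steps replaces Gronwall's lemma.\<close>

definition step_size :: "real \<Rightarrow> nat \<Rightarrow> nat \<Rightarrow> real \<Rightarrow> real" where
  "step_size T d m C = 1 / (16 * noise_const T d m * C\<^sup>2 + 1)"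

text \<open>The factor of one step: \<open>8 * noise_const T d m * C\<^sup>2 * (T + 1)\<close>,
  doubled when half of the unknown is moved to the left.\<close>

definition growth :: "real \<Rightarrow> nat \<Rightarrow> nat \<Rightarrow> real \<Rightarrow> real" where
  "growth T d m C = 16 * noise_const T d m * C\<^sup>2 * (T + 1)"

text \<open>The factor of \<open>\<eta>\<^sup>2\<close> after \<open>k\<close> steps, started from 0
  because the supremum of the error before time 0 is empty. Neither \<Delta> nor \<eta> enters, so
  both can be chosen afterwards.\<close>

definition error_const :: "real \<Rightarrow> nat \<Rightarrow> nat \<Rightarrow> real \<Rightarrow> nat \<Rightarrow> real" where
  "error_const T d m C k = ((\<lambda>K. growth T d m C * (K + 1)) ^^ k) 0"

text \<open>The past up to \<open>v\<close> costs the full length \<open>T\<close>, the current step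
  only \<open>h\<close>; this asymmetry makes the absorption possible. In the first step of the
  iteration \<open>v\<close> is negative.\<close>

lemma (in usual_filtered_prob_space) nn_integral_time_step_le:
  assumes "v \<le> u" "u \<le> v + h"
    and le: "\<And>s. 0 \<le> s \<Longrightarrow> s \<le> T \<Longrightarrow> \<phi> s \<le> (if s \<le> v then P else if s \<le> u then Q else 0)"
  shows "(\<integral>\<^sup>+s. \<phi> s \<partial>time) \<le> ennreal T * P + ennreal h * Q"
proof -
  let ?D = "{v<..u} \<inter> {0..T}"
  have D: "?D \<in> sets time" by (auto simp: sets_restrict_space_iff)
  have "emeasure time ?D = emeasure lborel ?D"
    by (rule emeasure_restrict_space) auto
  also have "\<dots> \<le> emeasure lborel {v<..u}"
    by (rule emeasure_mono) auto
  also have "\<dots> = ennreal (u - v)" using assms(1) by simp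
  also have "\<dots> \<le> ennreal h" using assms(2) by (intro ennreal_leI) simp
  finally have eD: "emeasure time ?D \<le> ennreal h" .
  have eT: "emeasure time (space time) = ennreal T"
    using T_pos by (simp add: space_time emeasure_restrict_space)
  have "(\<integral>\<^sup>+s. \<phi> s \<partial>time) \<le> (\<integral>\<^sup>+s. P + Q * indicator ?D s \<partial>time)"
  proof (rule nn_integral_mono)
    fix s assume "s \<in> space time"
    then have s: "0 \<le> s" "s \<le> T" by (auto simp: space_time)
    show "\<phi> s \<le> P + Q * indicator ?D s"
      using le[OF s] s by (auto simp: indicator_def add_increasing add_increasing2 split: if_splits intro: order_trans)
  qed
  also have "\<dots> = ennreal T * P + Q * emeasure time ?D"
    using D by (subst nn_integral_add) (auto simp: nn_integral_cmult_indicator eT[unfolded space_time] space_time mult.commute)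
  also have "\<dots> \<le> ennreal T * P + ennreal h * Q"
    using mult_left_mono[OF eD, of Q] by (simp add: mult.commute add_left_mono)
  finally show ?thesis .
qed

section \<open>The running error of an abstract stopped process\<close>

locale error_process = usual_filtered_prob_space M F T
  for M :: "'a measure" and F T +
  fixes B :: "'m::finite \<Rightarrow> real \<Rightarrow> 'a \<Rightarrow> real" and e :: "real \<Rightarrow> 'a \<Rightarrow> real ^ 'd"
    and \<alpha> :: "'d \<Rightarrow> real \<Rightarrow> 'a \<Rightarrow> real" and \<beta> I :: "'d \<Rightarrow> 'm \<Rightarrow> real \<Rightarrow> 'a \<Rightarrow> real"
    and A :: "real \<Rightarrow> 'a \<Rightarrow> bool" and C \<eta> R :: real
  assumes driver: "\<And>j. scalar_wiener M F T (B j)"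
    and e_measurable: "\<And>t. t \<in> {0..T} \<Longrightarrow> e t \<in> borel_measurable M"
    and e_continuous: "ae_continuous M T e"
    and survival_A: "survival A"
    and nonneg: "0 \<le> C" "0 \<le> \<eta>" "0 \<le> R"
    and drift_integrable: "\<And>i. AE \<omega> in M. set_integrable lborel {0..T} (\<lambda>s. \<alpha> i s \<omega>)"
    and diffusion: "\<And>i j. ito_limit (B j) (\<beta> i j) (I i j)"
    and e_eq: "\<And>i. AE \<omega> in M. \<forall>t\<in>{0..T}.
      e t \<omega> $ i = (LINT s:{0..t}|lborel. \<alpha> i s \<omega>) + (\<Sum>j\<in>UNIV. I i j t \<omega>)"
    and e_bounded: "AE \<omega> in M. \<forall>t\<in>{0..T}. A t \<omega> \<longrightarrow> norm (e t \<omega>) \<le> R"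
    and coefficients: "AE \<omega> in M. \<forall>s\<in>{0..T}. \<forall>\<rho>. A s \<omega> \<longrightarrow> (\<forall>r\<in>{0..s}. norm (e r \<omega>) \<le> \<rho>) \<longrightarrow>
      (\<forall>i. \<bar>\<alpha> i s \<omega>\<bar> \<le> C * (2 * \<rho> + \<eta>)) \<and> (\<forall>i j. \<bar>\<beta> i j s \<omega>\<bar> \<le> C * (2 * \<rho> + \<eta>))"
begin

text \<open>Rational times give measurability; \<open>norm_le_err\<close> recovers the real times by
  left limits. For negative \<open>u\<close> the index set is empty and the value is 0.\<close>

definition err :: "real \<Rightarrow> 'a \<Rightarrow> ennreal" where
  "err u \<omega> = (SUP t\<in>\<rat> \<inter> {0..T} \<inter> {..u}. if A t \<omega> then ennreal ((norm (e t \<omega>))\<^sup>2) else 0)"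

lemma err_measurable [measurable]: "err u \<in> borel_measurable M"
proof -
  have "(\<lambda>\<omega>. if A t \<omega> then ennreal ((norm (e t \<omega>))\<^sup>2) else 0) \<in> borel_measurable M"
    if "t \<in> \<rat> \<inter> {0..T} \<inter> {..u}" for t
  proof -
    have [measurable]: "e t \<in> borel_measurable M" "Measurable.pred M (A t)"
      using that e_measurable survival_measurable[OF survival_A] by auto
    show ?thesis by measurable
  qed
  moreover have "countable (\<rat> \<inter> {0..T} \<inter> {..u})" using countable_rat by auto
  ultimately show ?thesis unfolding err_def by (intro borel_measurable_SUP)
qed

lemma norm_le_err:
  assumes \<omega>: "\<omega> \<in> space M" and cont: "continuous_on {0..T} (\<lambda>t. e t \<omega>)"
    and err: "err w \<omega> \<le> ennreal (\<rho>\<^sup>2)" and \<rho>: "0 \<le> \<rho>"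
    and s: "A s \<omega>" "s \<le> w" "s \<le> T" and r: "0 \<le> r" "r \<le> s"
  shows "norm (e r \<omega>) \<le> \<rho>"
proof -
  have rat: "norm (e q \<omega>) \<le> \<rho>" if "q \<in> \<rat>" "0 \<le> q" "q \<le> r" for q
  proof -
    have "A q \<omega>" using survival_antimono[OF survival_A \<omega> _ _ s(3,1)] that r by auto
    then have "ennreal ((norm (e q \<omega>))\<^sup>2) = (if A q \<omega> then ennreal ((norm (e q \<omega>))\<^sup>2) else 0)" by simp
    also have "\<dots> \<le> err w \<omega>"
      unfolding err_def using that r s by (intro SUP_upper) auto
    finally have "ennreal ((norm (e q \<omega>))\<^sup>2) \<le> ennreal (\<rho>\<^sup>2)" using err by (rule order_trans)
    then have "(norm (e q \<omega>))\<^sup>2 \<le> \<rho>\<^sup>2" by (simp add: ennreal_le_iff)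
    then show ?thesis using \<rho> by (rule power2_le_imp_le)
  qed
  show ?thesis
  proof (cases "r = 0")
    case False
    then obtain q where q: "\<And>n. q n \<in> \<rat>" "\<And>n. 0 \<le> q n" "\<And>n. q n < r" "q \<longlonglongrightarrow> r"
      using rational_left_limit[of r] r by auto
    have "q n \<in> {0..T}" for n using q(2,3)[of n] r s by auto
    then have "(\<lambda>n. e (q n) \<omega>) \<longlonglongrightarrow> e r \<omega>"
      using r s by (intro continuous_on_tendsto_compose[OF cont q(4)]) auto
    from tendsto_norm[OF this] show ?thesis
      by (rule LIMSEQ_le_const2) (use rat[OF q(1,2) less_imp_le[OF q(3)]] in auto)
  qed (use rat[of 0] in simp)
qed

lemma AE_good: "AE \<omega> in M. \<omega> \<in> space M \<and> continuous_on {0..T} (\<lambda>t. e t \<omega>) \<and>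
    (\<forall>i. set_integrable lborel {0..T} (\<lambda>s. \<alpha> i s \<omega>)) \<and>
    (\<forall>i. \<forall>t\<in>{0..T}. e t \<omega> $ i = (LINT s:{0..t}|lborel. \<alpha> i s \<omega>) + (\<Sum>j\<in>UNIV. I i j t \<omega>)) \<and>
    (\<forall>t\<in>{0..T}. A t \<omega> \<longrightarrow> norm (e t \<omega>) \<le> R) \<and>
    (\<forall>s\<in>{0..T}. \<forall>\<rho>. A s \<omega> \<longrightarrow> (\<forall>r\<in>{0..s}. norm (e r \<omega>) \<le> \<rho>) \<longrightarrow>
      (\<forall>i. \<bar>\<alpha> i s \<omega>\<bar> \<le> C * (2 * \<rho> + \<eta>)) \<and> (\<forall>i j. \<bar>\<beta> i j s \<omega>\<bar> \<le> C * (2 * \<rho> + \<eta>)))"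
proof -
  have "AE \<omega> in M. \<forall>i\<in>UNIV. set_integrable lborel {0..T} (\<lambda>s. \<alpha> i s \<omega>)"
    using drift_integrable by (rule AE_finite_allI[OF finite])
  moreover have "AE \<omega> in M. \<forall>i\<in>UNIV. \<forall>t\<in>{0..T}.
      e t \<omega> $ i = (LINT s:{0..t}|lborel. \<alpha> i s \<omega>) + (\<Sum>j\<in>UNIV. I i j t \<omega>)"
    using e_eq by (rule AE_finite_allI[OF finite])
  ultimately show ?thesis
    using AE_space e_continuous e_bounded coefficients unfolding ae_continuous_def
    by eventually_elim blast
qed

text \<open>An upper bound for \<open>T * P\<^sup>2 + h * Q\<^sup>2\<close>, where \<open>P\<close>
  bounds the coefficients up to \<open>v\<close> and \<open>Q\<close> bounds them on the current
  step. The unknown \<open>err u\<close> carries the small factor \<open>h\<close>.\<close>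

definition err_rate :: "real \<Rightarrow> real \<Rightarrow> real \<Rightarrow> 'a \<Rightarrow> ennreal" where
  "err_rate h v u \<omega> = ennreal (8 * T * C\<^sup>2) * err v \<omega> + ennreal (8 * h * C\<^sup>2) * err u \<omega>
     + ennreal (2 * (T + h) * C\<^sup>2 * \<eta>\<^sup>2)"

lemma err_le: "AE \<omega> in M. err u \<omega> \<le> ennreal (R\<^sup>2)"
  using e_bounded
proof eventually_elim
  case (elim \<omega>)
  show ?case
    unfolding err_def
  proof (rule SUP_least)
    fix t assume t: "t \<in> \<rat> \<inter> {0..T} \<inter> {..u}"
    show "(if A t \<omega> then ennreal ((norm (e t \<omega>))\<^sup>2) else 0) \<le> ennreal (R\<^sup>2)"
      using elim t by (auto intro!: ennreal_leI power_mono)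
  qed
qed

text \<open>Up to time \<open>v\<close> the coefficients see only the error already estimated,
  \<open>err v\<close>; only on the current step must \<open>err u\<close> be used. Both bounds are
  real numbers because \<open>err T\<close> is finite.\<close>

lemma coefficient_square_le:
  assumes good: "\<omega> \<in> space M" "continuous_on {0..T} (\<lambda>t. e t \<omega>)"
      "\<forall>s\<in>{0..T}. \<forall>\<rho>. A s \<omega> \<longrightarrow> (\<forall>r\<in>{0..s}. norm (e r \<omega>) \<le> \<rho>) \<longrightarrow>
        (\<forall>i. \<bar>\<alpha> i s \<omega>\<bar> \<le> C * (2 * \<rho> + \<eta>)) \<and> (\<forall>i j. \<bar>\<beta> i j s \<omega>\<bar> \<le> C * (2 * \<rho> + \<eta>))"
    and fin: "err T \<omega> < \<infinity>"
    and vu: "v \<le> u" "u \<le> v + h" "u \<le> T" and h: "0 \<le> h"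
  obtains P Q where "0 \<le> P" "0 \<le> Q"
    "\<And>s i. 0 \<le> s \<Longrightarrow> s \<le> T \<Longrightarrow> s \<le> u \<Longrightarrow> A s \<omega> \<Longrightarrow> \<bar>\<alpha> i s \<omega>\<bar> \<le> (if s \<le> v then P else Q)"
    "\<And>s i j. 0 \<le> s \<Longrightarrow> s \<le> T \<Longrightarrow> s \<le> u \<Longrightarrow> A s \<omega> \<Longrightarrow> \<bar>\<beta> i j s \<omega>\<bar> \<le> (if s \<le> v then P else Q)"
    "ennreal (T * P\<^sup>2 + h * Q\<^sup>2) \<le> err_rate h v u \<omega>"
proof -
  define \<rho> where "\<rho> w = sqrt (enn2real (err w \<omega>))" for w
  let ?G = "\<lambda>w. C * (2 * \<rho> w + \<eta>)"
  have \<rho>_nonneg: "0 \<le> \<rho> w" for w by (simp add: \<rho>_def)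
  have err_eq: "err w \<omega> = ennreal ((\<rho> w)\<^sup>2)" for w
  proof -
    have "err w \<omega> \<le> err T \<omega>" unfolding err_def by (intro SUP_subset_mono) auto
    from le_less_trans[OF this fin] have "err w \<omega> < top" by simp
    then show ?thesis by (simp add: \<rho>_def)
  qed
  have coef: "(\<forall>i. \<bar>\<alpha> i s \<omega>\<bar> \<le> ?G w) \<and> (\<forall>i j. \<bar>\<beta> i j s \<omega>\<bar> \<le> ?G w)"
    if s: "0 \<le> s" "s \<le> T" "s \<le> w" "A s \<omega>" for s w
  proof -
    have "\<forall>r\<in>{0..s}. norm (e r \<omega>) \<le> \<rho> w"
      using norm_le_err[OF good(1,2) eq_refl[OF err_eq] \<rho>_nonneg s(4,3,2)] by auto
    then show ?thesis using good(3) s by auto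
  qed
  show thesis
  proof (rule that[of "?G v" "?G u"])
    show "0 \<le> ?G v" "0 \<le> ?G u"
      using nonneg \<rho>_nonneg by auto
    show "\<bar>\<alpha> i s \<omega>\<bar> \<le> (if s \<le> v then ?G v else ?G u)"
      if "0 \<le> s" "s \<le> T" "s \<le> u" "A s \<omega>" for s i
      using coef[of s v] coef[of s u] that by auto
    show "\<bar>\<beta> i j s \<omega>\<bar> \<le> (if s \<le> v then ?G v else ?G u)"
      if "0 \<le> s" "s \<le> T" "s \<le> u" "A s \<omega>" for s i j
      using coef[of s v] coef[of s u] that by auto
    have sq: "(C * (2 * r + \<eta>))\<^sup>2 \<le> C\<^sup>2 * (8 * r\<^sup>2 + 2 * \<eta>\<^sup>2)" for r
    proof -
      have "(2 * r + \<eta>)\<^sup>2 \<le> 8 * r\<^sup>2 + 2 * \<eta>\<^sup>2"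
        using zero_le_power2[of "2 * r - \<eta>"] by (simp add: power2_eq_square algebra_simps)
      then show ?thesis by (simp add: power_mult_distrib mult_left_mono)
    qed
    have "T * (?G v)\<^sup>2 + h * (?G u)\<^sup>2 \<le>
        T * (C\<^sup>2 * (8 * (\<rho> v)\<^sup>2 + 2 * \<eta>\<^sup>2)) + h * (C\<^sup>2 * (8 * (\<rho> u)\<^sup>2 + 2 * \<eta>\<^sup>2))"
      using T_pos h by (intro add_mono mult_left_mono sq) auto
    also have "\<dots> = 8 * T * C\<^sup>2 * (\<rho> v)\<^sup>2 + 8 * h * C\<^sup>2 * (\<rho> u)\<^sup>2 + 2 * (T + h) * C\<^sup>2 * \<eta>\<^sup>2"
      by (simp add: algebra_simps)
    finally have "ennreal (T * (?G v)\<^sup>2 + h * (?G u)\<^sup>2) \<le>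
        ennreal (8 * T * C\<^sup>2 * (\<rho> v)\<^sup>2 + 8 * h * C\<^sup>2 * (\<rho> u)\<^sup>2 + 2 * (T + h) * C\<^sup>2 * \<eta>\<^sup>2)"
      by (rule ennreal_leI)
    also have "\<dots> = err_rate h v u \<omega>"
      using T_pos h unfolding err_rate_def err_eq by (simp add: ennreal_mult[symmetric] ennreal_plus[symmetric] del: ennreal_plus)
    finally show "ennreal (T * (?G v)\<^sup>2 + h * (?G u)\<^sup>2) \<le> err_rate h v u \<omega>" .
  qed
qed

lemma diffusion_energy_le:
  assumes vu: "v \<le> u" "u \<le> v + h" "u \<le> T" and h: "0 \<le> h"
  shows "AE \<omega> in M. (\<integral>\<^sup>+s. (if A s \<omega> \<and> s \<le> u then ennreal ((\<beta> i j s \<omega>)\<^sup>2) else 0) \<partial>time) \<le> err_rate h v u \<omega>"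
  using AE_good err_le[of T]
proof eventually_elim
  case (elim \<omega>)
  have fin: "err T \<omega> < \<infinity>" using elim(2) by (auto intro: le_less_trans)
  obtain P Q where PQ: "0 \<le> P" "0 \<le> Q"
    "\<And>s i j. 0 \<le> s \<Longrightarrow> s \<le> T \<Longrightarrow> s \<le> u \<Longrightarrow> A s \<omega> \<Longrightarrow> \<bar>\<beta> i j s \<omega>\<bar> \<le> (if s \<le> v then P else Q)"
    "ennreal (T * P\<^sup>2 + h * Q\<^sup>2) \<le> err_rate h v u \<omega>"
    using coefficient_square_le[OF _ _ _ fin vu h] elim(1) by metis
  have "(\<integral>\<^sup>+s. (if A s \<omega> \<and> s \<le> u then ennreal ((\<beta> i j s \<omega>)\<^sup>2) else 0) \<partial>time)
      \<le> ennreal T * ennreal (P\<^sup>2) + ennreal h * ennreal (Q\<^sup>2)"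
  proof (rule nn_integral_time_step_le[OF vu(1,2)])
    fix s assume s: "0 \<le> s" "s \<le> T"
    have "(\<beta> i j s \<omega>)\<^sup>2 \<le> (if s \<le> v then P else Q)\<^sup>2" if "s \<le> u" "A s \<omega>"
      using power_mono[OF PQ(3)[OF s that], of i j 2] by simp
    then show "(if A s \<omega> \<and> s \<le> u then ennreal ((\<beta> i j s \<omega>)\<^sup>2) else 0) \<le>
        (if s \<le> v then ennreal (P\<^sup>2) else if s \<le> u then ennreal (Q\<^sup>2) else 0)"
      using vu(1) by (auto intro!: ennreal_leI)
  qed
  also have "\<dots> = ennreal (T * P\<^sup>2 + h * Q\<^sup>2)"
    using T_pos h by (simp add: ennreal_mult)
  finally show ?case using PQ(4) by (rule order_trans)
qed

lemma drift_square_le: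
  assumes vu: "v \<le> u" "u \<le> v + h" "u \<le> T" and h: "0 \<le> h" "h \<le> 1"
  shows "AE \<omega> in M. \<forall>t\<in>{0..T} \<inter> {..u}. \<forall>i. A t \<omega> \<longrightarrow>
    ennreal ((LINT s:{0..t}|lborel. \<alpha> i s \<omega>)\<^sup>2) \<le> ennreal (2 * (T + 1)) * err_rate h v u \<omega>"
  using AE_good err_le[of T]
proof eventually_elim
  case (elim \<omega>)
  have fin: "err T \<omega> < \<infinity>" using elim(2) by (auto intro: le_less_trans)
  obtain P Q where PQ: "0 \<le> P" "0 \<le> Q"
    "\<And>s i. 0 \<le> s \<Longrightarrow> s \<le> T \<Longrightarrow> s \<le> u \<Longrightarrow> A s \<omega> \<Longrightarrow> \<bar>\<alpha> i s \<omega>\<bar> \<le> (if s \<le> v then P else Q)"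
    "ennreal (T * P\<^sup>2 + h * Q\<^sup>2) \<le> err_rate h v u \<omega>"
    using coefficient_square_le[OF _ _ _ fin vu h(1)] elim(1) by metis
  have good: "\<omega> \<in> space M" "\<forall>i. set_integrable lborel {0..T} (\<lambda>s. \<alpha> i s \<omega>)"
    using elim(1) by blast+
  show ?case
  proof (intro ballI allI impI)
    fix t i assume t: "t \<in> {0..T} \<inter> {..u}" and At: "A t \<omega>"
    have As: "A s \<omega>" if "0 \<le> s" "s \<le> t" for s
      using survival_antimono[OF survival_A good(1) _ _ _ At] t that by auto
    have int: "set_integrable lborel {0..t} (\<lambda>s. \<alpha> i s \<omega>)"
      using t by (intro set_integrable_subset[OF good(2)[rule_format]]) auto
    have "ennreal \<bar>LINT s:{0..t}|lborel. \<alpha> i s \<omega>\<bar> \<le> (\<integral>\<^sup>+s. ennreal (norm (indicator {0..t} s *\<^sub>R \<alpha> i s \<omega>)) \<partial>lborel)"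
      using integral_norm_bound_ennreal[OF int[unfolded set_integrable_def]]
      by (simp add: set_lebesgue_integral_def)
    also have "\<dots> = (\<integral>\<^sup>+s. ennreal (norm (indicator {0..t} s *\<^sub>R \<alpha> i s \<omega>)) \<partial>time)"
      using t by (subst nn_integral_restrict_space) (auto intro!: nn_integral_cong simp: indicator_def)
    also have "\<dots> \<le> ennreal T * ennreal P + ennreal h * ennreal Q"
    proof (rule nn_integral_time_step_le[OF vu(1,2)])
      fix s assume s: "0 \<le> s" "s \<le> T"
      have "\<bar>\<alpha> i s \<omega>\<bar> \<le> (if s \<le> v then P else Q)" if "s \<le> t"
        using PQ(3)[OF s _ As] s that t by auto
      then show "ennreal (norm (indicator {0..t} s *\<^sub>R \<alpha> i s \<omega>)) \<le>
          (if s \<le> v then ennreal P else if s \<le> u then ennreal Q else 0)"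
        using t by (auto intro!: ennreal_leI simp: indicator_def)
    qed
    also have "\<dots> = ennreal (T * P + h * Q)"
      using T_pos h PQ by (simp add: ennreal_mult)
    finally have le: "\<bar>LINT s:{0..t}|lborel. \<alpha> i s \<omega>\<bar> \<le> T * P + h * Q"
      using T_pos h PQ by (subst (asm) ennreal_le_iff) auto
    have "(LINT s:{0..t}|lborel. \<alpha> i s \<omega>)\<^sup>2 \<le> (T * P + h * Q)\<^sup>2"
      using power_mono[OF le, of 2] by simp
    \<comment> \<open>Each square keeps a spare factor \<open>T\<close> or \<open>h\<close>, both at
      most \<open>T + 1\<close>. This brings the drift under the same \<open>err_rate\<close> as the
      diffusion.\<close>
    also have "\<dots> \<le> 2 * (T * (T * P\<^sup>2)) + 2 * (h * (h * Q\<^sup>2))"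
      using zero_le_power2[of "T * P - h * Q"] by (simp add: power2_eq_square algebra_simps)
    also have "\<dots> \<le> 2 * ((T + 1) * (T * P\<^sup>2)) + 2 * ((T + 1) * (h * Q\<^sup>2))"
      using T_pos h by (intro add_mono mult_left_mono mult_right_mono) auto
    also have "\<dots> = 2 * (T + 1) * (T * P\<^sup>2 + h * Q\<^sup>2)"
      by (simp add: algebra_simps)
    finally have "ennreal ((LINT s:{0..t}|lborel. \<alpha> i s \<omega>)\<^sup>2) \<le> ennreal (2 * (T + 1) * (T * P\<^sup>2 + h * Q\<^sup>2))"
      by (rule ennreal_leI)
    also have "\<dots> = ennreal (2 * (T + 1)) * ennreal (T * P\<^sup>2 + h * Q\<^sup>2)"
      using T_pos by (simp add: ennreal_mult')
    also have "\<dots> \<le> ennreal (2 * (T + 1)) * err_rate h v u \<omega>"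
      by (intro mult_left_mono PQ(4)) simp
    finally show "ennreal ((LINT s:{0..t}|lborel. \<alpha> i s \<omega>)\<^sup>2) \<le> ennreal (2 * (T + 1)) * err_rate h v u \<omega>" .
  qed
qed

text \<open>The body carries \<open>t \<le> u\<close> so that it is an instance of
  \<open>maximal_inequality\<close> for the survival process of
  \<open>survival_until\<close>.\<close>

definition sup_diffusion :: "real \<Rightarrow> 'd \<Rightarrow> 'm \<Rightarrow> 'a \<Rightarrow> ennreal" where
  "sup_diffusion u i j \<omega> = (SUP t\<in>\<rat> \<inter> {0..T} \<inter> {..u}. if A t \<omega> \<and> t \<le> u then ennreal ((I i j t \<omega>)\<^sup>2) else 0)"

text \<open>Stopping at the minimum of \<tau> and \<open>u\<close>, so that the maximal inequality
  charges only the energy up to \<open>u\<close>.\<close>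

lemma survival_until:
  assumes "u \<le> T"
  shows "survival (\<lambda>t \<omega>. A t \<omega> \<and> t \<le> u)"
proof -
  have s: "\<And>t. t \<in> {0..T} \<Longrightarrow> Measurable.pred (F t) (A t)"
    "Measurable.pred (M \<Otimes>\<^sub>M time) (\<lambda>(\<omega>, t). A t \<omega>)"
    "\<forall>\<omega>\<in>space M. \<forall>s t. 0 \<le> s \<longrightarrow> s \<le> t \<longrightarrow> t \<le> T \<longrightarrow> A t \<omega> \<longrightarrow> A s \<omega>"
    "\<forall>\<omega>\<in>space M. \<forall>t\<in>{0<..T}. \<not> A t \<omega> \<longrightarrow> (\<exists>s\<in>{0..<t}. \<not> A s \<omega>)"
    using survival_A unfolding survival_def by blast+
  have "Measurable.pred time (\<lambda>t. t \<le> u)"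
    by (intro measurable_restrict_space1) auto
  then have "Measurable.pred (M \<Otimes>\<^sub>M time) (\<lambda>z. snd z \<le> u)"
    by (intro measurable_compose[OF measurable_snd])
  with s(2) have j: "Measurable.pred (M \<Otimes>\<^sub>M time) (\<lambda>(\<omega>, t). A t \<omega> \<and> t \<le> u)"
    unfolding split_beta' by (rule pred_intros_logic(3))
  have l: "\<exists>s\<in>{0..<t}. \<not> (A s \<omega> \<and> s \<le> u)" if "\<omega> \<in> space M" "t \<in> {0<..T}" "\<not> (A t \<omega> \<and> t \<le> u)" for \<omega> t
  proof (cases "A t \<omega>")
    case True
    then have "u < t" using that by simp
    \<comment> \<open>A time before \<open>t\<close> but beyond \<open>u\<close> witnesses the
      death; the maximum with 0 covers negative \<open>u\<close>.\<close>
    then have "max 0 ((u + t) / 2) \<in> {0..<t}" "\<not> max 0 ((u + t) / 2) \<le> u"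
      using that(2) by auto
    then show ?thesis by blast
  qed (use s(4) that in blast)
  show ?thesis
    unfolding survival_def
  proof (intro conjI ballI)
    show "Measurable.pred (F t) (\<lambda>\<omega>. A t \<omega> \<and> t \<le> u)" if "t \<in> {0..T}" for t
      using s(1)[OF that] by measurable
    show "\<forall>s t. 0 \<le> s \<longrightarrow> s \<le> t \<longrightarrow> t \<le> T \<longrightarrow> A t \<omega> \<and> t \<le> u \<longrightarrow> A s \<omega> \<and> s \<le> u" if "\<omega> \<in> space M" for \<omega>
      using s(3) that by fastforce
  qed (use j l in auto)
qed

lemma sup_diffusion_measurable [measurable]:
  assumes "u \<le> T"
  shows "sup_diffusion u i j \<in> borel_measurable M"
proof -
  have "(\<lambda>\<omega>. if A t \<omega> \<and> t \<le> u then ennreal ((I i j t \<omega>)\<^sup>2) else 0) \<in> borel_measurable M"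
    if "t \<in> \<rat> \<inter> {0..T} \<inter> {..u}" for t
  proof -
    have [measurable]: "Measurable.pred M (\<lambda>\<omega>. A t \<omega> \<and> t \<le> u)"
      by (intro survival_measurable[OF survival_until[OF assms]]) (use that in auto)
    have [measurable]: "I i j t \<in> borel_measurable M"
      using that diffusion[of j i] by (auto simp: ito_limit_def)
    show ?thesis by measurable
  qed
  moreover have "countable (\<rat> \<inter> {0..T} \<inter> {..u})" using countable_rat by auto
  ultimately show ?thesis unfolding sup_diffusion_def by (intro borel_measurable_SUP)
qed

lemma err_rate_measurable [measurable]: "err_rate h v u \<in> borel_measurable M"
  unfolding err_rate_def by measurable

text \<open>The bound \<open>R\<close> on the stopped error yields the deterministic energy bound
  \<open>K\<close> demanded by \<open>maximal_inequality\<close>; the conclusion depends on the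
  expected energy only.\<close>

lemma sup_diffusion_le:
  assumes vu: "v \<le> u" "u \<le> v + h" "u \<le> T" and h: "0 \<le> h"
  shows "(\<integral>\<^sup>+\<omega>. sup_diffusion u i j \<omega> \<partial>M) \<le> 8 * (\<integral>\<^sup>+\<omega>. err_rate h v u \<omega> \<partial>M)"
proof -
  interpret scalar_wiener M F T "B j" by (rule driver)
  define K where "K = 8 * T * C\<^sup>2 * R\<^sup>2 + 8 * h * C\<^sup>2 * R\<^sup>2 + 2 * (T + h) * C\<^sup>2 * \<eta>\<^sup>2"
  note energy = diffusion_energy_le[OF vu h, of i j]
  have "AE \<omega> in M. (\<integral>\<^sup>+s. (if A s \<omega> \<and> s \<le> u then ennreal ((\<beta> i j s \<omega>)\<^sup>2) else 0) \<partial>time) \<le> ennreal K"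
    using energy err_le[of v] err_le[of u]
  proof eventually_elim
    case (elim \<omega>)
    note elim(1)
    also have "err_rate h v u \<omega> \<le> ennreal (8 * T * C\<^sup>2) * ennreal (R\<^sup>2) + ennreal (8 * h * C\<^sup>2) * ennreal (R\<^sup>2)
       + ennreal (2 * (T + h) * C\<^sup>2 * \<eta>\<^sup>2)"
      unfolding err_rate_def using elim by (intro add_mono mult_left_mono) auto
    also have "\<dots> = ennreal K"
      using T_pos h by (simp add: K_def ennreal_mult[symmetric] ennreal_plus[symmetric] del: ennreal_plus)
    finally show ?case .
  qed
  moreover have "countable (\<rat> \<inter> {0..T} \<inter> {..u})" using countable_rat by auto
  moreover have "0 \<le> K" using T_pos h by (simp add: K_def)
  ultimately have "(\<integral>\<^sup>+\<omega>. sup_diffusion u i j \<omega> \<partial>M) \<le>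
      8 * (\<integral>\<^sup>+\<omega>. \<integral>\<^sup>+s. (if A s \<omega> \<and> s \<le> u then ennreal ((\<beta> i j s \<omega>)\<^sup>2) else 0) \<partial>time \<partial>M)"
    unfolding sup_diffusion_def
    by (intro maximal_inequality[OF diffusion survival_until[OF vu(3)]]) auto
  also have "\<dots> \<le> 8 * (\<integral>\<^sup>+\<omega>. err_rate h v u \<omega> \<partial>M)"
    using energy by (intro mult_left_mono nn_integral_mono_AE) auto
  finally show ?thesis .
qed

lemma err_le_parts:
  assumes vu: "v \<le> u" "u \<le> v + h" "u \<le> T" and h: "0 \<le> h" "h \<le> 1"
  shows "AE \<omega> in M. err u \<omega> \<le> ennreal (4 * (T + 1) * CARD('d)) * err_rate h v u \<omega>
    + ennreal (2 * CARD('m)) * (\<Sum>i\<in>UNIV. \<Sum>j\<in>UNIV. sup_diffusion u i j \<omega>)"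
  using AE_good drift_square_le[OF vu h]
proof eventually_elim
  case (elim \<omega>)
  let ?rhs = "ennreal (4 * (T + 1) * CARD('d)) * err_rate h v u \<omega>
    + ennreal (2 * CARD('m)) * (\<Sum>i\<in>UNIV. \<Sum>j\<in>UNIV. sup_diffusion u i j \<omega>)"
    and ?c = "\<lambda>i. 2 * (ennreal (2 * (T + 1)) * err_rate h v u \<omega>)
      + ennreal (2 * CARD('m)) * (\<Sum>j\<in>UNIV. sup_diffusion u i j \<omega>)"
  have good: "\<forall>i. \<forall>t\<in>{0..T}. e t \<omega> $ i = (LINT s:{0..t}|lborel. \<alpha> i s \<omega>) + (\<Sum>j\<in>UNIV. I i j t \<omega>)"
    using elim(1) by blast
  show ?case
    unfolding err_def
  proof (rule SUP_least)
    fix t assume t: "t \<in> \<rat> \<inter> {0..T} \<inter> {..u}"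
    show "(if A t \<omega> then ennreal ((norm (e t \<omega>))\<^sup>2) else 0) \<le>
      ?rhs"
    proof (cases "A t \<omega>")
      case True
      have comp: "ennreal ((e t \<omega> $ i)\<^sup>2) \<le> ?c i" for i
      proof -
        define D where "D = (LINT s:{0..t}|lborel. \<alpha> i s \<omega>)"
        have "(e t \<omega> $ i)\<^sup>2 = (D + (\<Sum>j\<in>UNIV. I i j t \<omega>))\<^sup>2"
          using good t by (simp add: D_def)
        also have "\<dots> \<le> 2 * D\<^sup>2 + 2 * (\<Sum>j\<in>UNIV. I i j t \<omega>)\<^sup>2"
          using zero_le_power2[of "D - (\<Sum>j\<in>UNIV. I i j t \<omega>)"] by (simp add: power2_eq_square algebra_simps)
        also have "\<dots> \<le> 2 * D\<^sup>2 + 2 * (CARD('m) * (\<Sum>j\<in>UNIV. (I i j t \<omega>)\<^sup>2))"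
          by (intro add_left_mono mult_left_mono square_sum_le_card) auto
        finally have "ennreal ((e t \<omega> $ i)\<^sup>2) \<le> ennreal (2 * D\<^sup>2 + 2 * (CARD('m) * (\<Sum>j\<in>UNIV. (I i j t \<omega>)\<^sup>2)))"
          by (rule ennreal_leI)
        also have "\<dots> = 2 * ennreal (D\<^sup>2) + ennreal (2 * CARD('m)) * (\<Sum>j\<in>UNIV. ennreal ((I i j t \<omega>)\<^sup>2))"
          by (simp add: ennreal_mult' sum_nonneg sum_ennreal mult.assoc)
        also have "\<dots> \<le> ?c i"
        proof (intro add_mono mult_left_mono sum_mono)
          show "ennreal (D\<^sup>2) \<le> ennreal (2 * (T + 1)) * err_rate h v u \<omega>"
            using elim(2) t True by (auto simp: D_def)
          show "ennreal ((I i j t \<omega>)\<^sup>2) \<le> sup_diffusion u i j \<omega>" for j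
            unfolding sup_diffusion_def using t True by (intro SUP_upper2[OF t]) auto
        qed auto
        finally show ?thesis .
      qed
      have "ennreal ((norm (e t \<omega>))\<^sup>2) = (\<Sum>i\<in>UNIV. ennreal ((e t \<omega> $ i)\<^sup>2))"
        by (simp add: norm_square_vec sum_ennreal)
      also have "\<dots> \<le> (\<Sum>i\<in>(UNIV :: 'd set). ?c i)"
        by (intro sum_mono comp)
      also have "\<dots> = of_nat CARD('d) * (2 * (ennreal (2 * (T + 1)) * err_rate h v u \<omega>)) +
          ennreal (2 * CARD('m)) * (\<Sum>i\<in>UNIV. \<Sum>j\<in>UNIV. sup_diffusion u i j \<omega>)"
        by (simp add: sum.distrib sum_distrib_left)
      also have "of_nat CARD('d) * (2 * (ennreal (2 * (T + 1)) * err_rate h v u \<omega>)) =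
          ennreal (4 * (T + 1) * CARD('d)) * err_rate h v u \<omega>"
      proof -
        have "4 * (T + 1) * CARD('d) = real CARD('d) * (2 * (2 * (T + 1)))" by simp
        then have "ennreal (4 * (T + 1) * CARD('d)) = of_nat CARD('d) * (2 * ennreal (2 * (T + 1)))"
          using T_pos by (simp only: ennreal_mult' of_nat_0_le_iff ennreal_of_nat_eq_real_of_nat) (simp add: ennreal_mult')
        then show ?thesis by (simp add: mult.assoc)
      qed
      finally show ?thesis using True by simp
    qed simp
  qed
qed

lemma expected_err_le:
  assumes vu: "v \<le> u" "u \<le> v + h" "u \<le> T" and h: "0 \<le> h" "h \<le> 1"
  shows "(\<integral>\<^sup>+\<omega>. err u \<omega> \<partial>M) \<le> ennreal (noise_const T CARD('d) CARD('m)) * (\<integral>\<^sup>+\<omega>. err_rate h v u \<omega> \<partial>M)"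
proof -
  note [measurable] = sup_diffusion_measurable[OF vu(3)]
  let ?E = "\<integral>\<^sup>+\<omega>. err_rate h v u \<omega> \<partial>M"
  have "(\<integral>\<^sup>+\<omega>. err u \<omega> \<partial>M) \<le> (\<integral>\<^sup>+\<omega>. ennreal (4 * (T + 1) * CARD('d)) * err_rate h v u \<omega>
    + ennreal (2 * CARD('m)) * (\<Sum>i\<in>UNIV. \<Sum>j\<in>UNIV. sup_diffusion u i j \<omega>) \<partial>M)"
    by (rule nn_integral_mono_AE[OF err_le_parts[OF vu h]])
  also have "\<dots> = ennreal (4 * (T + 1) * CARD('d)) * ?E
    + ennreal (2 * CARD('m)) * (\<Sum>i\<in>UNIV. \<Sum>j\<in>UNIV. \<integral>\<^sup>+\<omega>. sup_diffusion u i j \<omega> \<partial>M)"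
    by (simp add: nn_integral_add nn_integral_cmult nn_integral_sum)
  also have "\<dots> \<le> ennreal (4 * (T + 1) * CARD('d)) * ?E
    + ennreal (2 * CARD('m)) * (\<Sum>i\<in>(UNIV :: 'd set). \<Sum>j\<in>(UNIV :: 'm set). 8 * ?E)"
    by (intro add_left_mono mult_left_mono sum_mono sup_diffusion_le vu h) auto
  also have "\<dots> = ennreal (noise_const T CARD('d) CARD('m)) * ?E"
  proof -
    have "ennreal (2 * CARD('m)) * (\<Sum>i\<in>(UNIV :: 'd set). \<Sum>j\<in>(UNIV :: 'm set). 8 * ?E)
      = (ennreal (2 * CARD('m)) * (ennreal CARD('d) * (ennreal CARD('m) * ennreal 8))) * ?E"
      by (simp add: ennreal_of_nat_eq_real_of_nat mult.assoc)
    also have "ennreal (2 * CARD('m)) * (ennreal CARD('d) * (ennreal CARD('m) * ennreal 8))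
      = ennreal (16 * CARD('m) * CARD('m) * CARD('d))"
      by (simp only: ennreal_mult[symmetric] of_nat_0_le_iff mult_nonneg_nonneg zero_le_numeral) (simp add: mult_ac)
    finally show ?thesis
      using T_pos unfolding noise_const_def by (simp add: ennreal_plus distrib_right)
  qed
  finally show ?thesis .
qed

lemma noise_const_nonneg: "0 \<le> noise_const T CARD('d) CARD('m)"
  using T_pos by (simp add: noise_const_def)

lemma step_size_bounds: "0 < step_size T CARD('d) CARD('m) C" "step_size T CARD('d) CARD('m) C \<le> 1" "8 * step_size T CARD('d) CARD('m) C * C\<^sup>2 * noise_const T CARD('d) CARD('m) \<le> 1 / 2"
  using noise_const_nonneg by (auto simp: step_size_def field_simps add_pos_nonneg)

lemma expected_err_step:
  assumes vu: "v \<le> u" "u \<le> v + step_size T CARD('d) CARD('m) C" "u \<le> T"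
    and K: "0 \<le> K" "(\<integral>\<^sup>+\<omega>. err v \<omega> \<partial>M) \<le> ennreal (K * \<eta>\<^sup>2)"
  shows "(\<integral>\<^sup>+\<omega>. err u \<omega> \<partial>M) \<le> ennreal (growth T CARD('d) CARD('m) C * (K + 1) * \<eta>\<^sup>2)"
proof -
  let ?h = "step_size T CARD('d) CARD('m) C"
  \<comment> \<open>Finiteness comes first: the unknown occurs on both sides below, and half of it
    may be subtracted only as a real number.\<close>
  have "(\<integral>\<^sup>+\<omega>. err u \<omega> \<partial>M) \<le> (\<integral>\<^sup>+\<omega>. ennreal (R\<^sup>2) \<partial>M)"
    by (rule nn_integral_mono_AE[OF err_le])
  also have "\<dots> < \<infinity>" by (simp add: emeasure_space_1)
  finally have fin: "(\<integral>\<^sup>+\<omega>. err u \<omega> \<partial>M) < \<infinity>" .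
  define q where "q = enn2real (\<integral>\<^sup>+\<omega>. err u \<omega> \<partial>M)"
  have q: "(\<integral>\<^sup>+\<omega>. err u \<omega> \<partial>M) = ennreal q" "0 \<le> q"
    using fin by (auto simp: q_def)
  let ?Y = "8 * T * C\<^sup>2 * (K * \<eta>\<^sup>2) + 8 * ?h * C\<^sup>2 * q + 2 * (T + ?h) * C\<^sup>2 * \<eta>\<^sup>2"
  have "(\<integral>\<^sup>+\<omega>. err u \<omega> \<partial>M) \<le> ennreal (noise_const T CARD('d) CARD('m)) * (\<integral>\<^sup>+\<omega>. err_rate ?h v u \<omega> \<partial>M)"
    using step_size_bounds by (intro expected_err_le vu) auto
  also have "(\<integral>\<^sup>+\<omega>. err_rate ?h v u \<omega> \<partial>M) = ennreal (8 * T * C\<^sup>2) * (\<integral>\<^sup>+\<omega>. err v \<omega> \<partial>M)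
      + ennreal (8 * ?h * C\<^sup>2) * ennreal q + ennreal (2 * (T + ?h) * C\<^sup>2 * \<eta>\<^sup>2)"
    unfolding err_rate_def q(1)[symmetric]
    by (simp add: nn_integral_add nn_integral_cmult emeasure_space_1)
  also have "\<dots> \<le> ennreal (8 * T * C\<^sup>2) * ennreal (K * \<eta>\<^sup>2)
      + ennreal (8 * ?h * C\<^sup>2) * ennreal q + ennreal (2 * (T + ?h) * C\<^sup>2 * \<eta>\<^sup>2)"
    by (intro add_mono mult_left_mono K) auto
  also have "\<dots> = ennreal ?Y"
    using T_pos step_size_bounds K q by (simp add: ennreal_mult[symmetric] ennreal_plus[symmetric] del: ennreal_plus)
  finally have "ennreal q \<le> ennreal (noise_const T CARD('d) CARD('m)) * ennreal ?Y"
    unfolding q(1) by (simp add: mult_left_mono)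
  also have "\<dots> = ennreal (noise_const T CARD('d) CARD('m) * ?Y)"
    using noise_const_nonneg by (simp add: ennreal_mult')
  finally have "q \<le> noise_const T CARD('d) CARD('m) * ?Y"
    using T_pos step_size_bounds K q noise_const_nonneg by (subst (asm) ennreal_le_iff) auto
  also have "\<dots> = noise_const T CARD('d) CARD('m) * C\<^sup>2 * (8 * T * (K * \<eta>\<^sup>2) + 2 * (T + ?h) * \<eta>\<^sup>2) + (8 * ?h * C\<^sup>2 * noise_const T CARD('d) CARD('m)) * q"
    by (simp add: algebra_simps)
  \<comment> \<open>The choice of the step size makes the coefficient of \<open>q\<close> at most
    \<open>1 / 2\<close>; the other two coefficients are enlarged to a common
    \<open>8 * (T + 1)\<close>.\<close>
  also have "\<dots> \<le> noise_const T CARD('d) CARD('m) * C\<^sup>2 * (8 * (T + 1) * (K * \<eta>\<^sup>2) + 8 * (T + 1) * \<eta>\<^sup>2) + 1 / 2 * q"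
    using T_pos step_size_bounds K q noise_const_nonneg
    by (intro add_mono mult_left_mono mult_right_mono) auto
  finally have "q \<le> growth T CARD('d) CARD('m) C * (K + 1) * \<eta>\<^sup>2"
    by (simp add: growth_def algebra_simps)
  then show ?thesis unfolding q(1) by (rule ennreal_leI)
qed

lemma growth_nonneg: "0 \<le> growth T CARD('d) CARD('m) C"
  using T_pos noise_const_nonneg by (simp add: growth_def)

lemma expected_err_bound:
  assumes k: "T \<le> (real k - 1) * step_size T CARD('d) CARD('m) C"
  shows "(\<integral>\<^sup>+\<omega>. err T \<omega> \<partial>M) \<le> ennreal (error_const T CARD('d) CARD('m) C k * \<eta>\<^sup>2)"
proof -
  define K where "K = error_const T CARD('d) CARD('m) C"
  \<comment> \<open>The iteration starts one step before 0, where the error is an empty supremum, so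
    the first step reaches only time 0. This accounts for \<open>real k - 1\<close> in the
    hypothesis.\<close>
  define u where "u n = min T (real n * step_size T CARD('d) CARD('m) C - step_size T CARD('d) CARD('m) C)" for n :: nat
  have "0 \<le> K n \<and> (\<integral>\<^sup>+\<omega>. err (u n) \<omega> \<partial>M) \<le> ennreal (K n * \<eta>\<^sup>2)" for n
  proof (induction n)
    case 0
    have "u 0 < 0" using step_size_bounds by (simp add: u_def min_def)
    then have "\<rat> \<inter> {0..T} \<inter> {..u 0} = {}" by auto
    then have "err (u 0) \<omega> = 0" for \<omega> by (simp add: err_def bot_ennreal)
    then show ?case by (simp add: K_def error_const_def)
  next
    case (Suc n)
    have "u n \<le> u (Suc n)" "u (Suc n) \<le> u n + step_size T CARD('d) CARD('m) C" "u (Suc n) \<le> T"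
      using step_size_bounds by (auto simp: u_def algebra_simps min_def)
    with Suc have "(\<integral>\<^sup>+\<omega>. err (u (Suc n)) \<omega> \<partial>M) \<le> ennreal (growth T CARD('d) CARD('m) C * (K n + 1) * \<eta>\<^sup>2)"
      by (intro expected_err_step) auto
    moreover have "K (Suc n) = growth T CARD('d) CARD('m) C * (K n + 1)" by (simp add: K_def error_const_def)
    ultimately show ?case using Suc growth_nonneg by simp
  qed
  from this[of k] show ?thesis
    using k by (simp add: u_def K_def min_absorb1 algebra_simps)
qed

end

subsection \<open>Stopping the semi-discrete approximation\<close>

lemma grid_point_bounds:
  assumes "0 < \<Delta>" "0 \<le> s"
  shows "0 \<le> grid_point \<Delta> s" "grid_point \<Delta> s \<le> s" "s < grid_point \<Delta> s + \<Delta>"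
proof -
  have "of_int \<lfloor>s / \<Delta>\<rfloor> * \<Delta> \<le> (s / \<Delta>) * \<Delta>"
    using assms by (intro mult_right_mono of_int_floor_le) simp
  also have "\<dots> = s" using assms by simp
  finally show "grid_point \<Delta> s \<le> s" by (simp add: grid_point_def)
  have "s = (s / \<Delta>) * \<Delta>" using assms by simp
  also have "\<dots> < (of_int \<lfloor>s / \<Delta>\<rfloor> + 1) * \<Delta>"
    using assms by (intro mult_strict_right_mono) linarith+
  finally show "s < grid_point \<Delta> s + \<Delta>" by (simp only: grid_point_def distrib_right mult_1_left)
  show "0 \<le> grid_point \<Delta> s" using assms by (simp add: grid_point_def)
qed

lemma grid_point_cong:
  assumes "0 < \<Delta>" "0 \<le> s" "grid_point \<Delta> s \<le> r" "r \<le> s"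
  shows "grid_point \<Delta> r = grid_point \<Delta> s"
proof -
  have "\<lfloor>r / \<Delta>\<rfloor> = \<lfloor>s / \<Delta>\<rfloor>"
  proof (rule floor_unique)
    show "of_int \<lfloor>s / \<Delta>\<rfloor> \<le> r / \<Delta>"
      using assms by (simp add: grid_point_def field_simps)
    have "r / \<Delta> \<le> s / \<Delta>" using assms by (simp add: divide_right_mono)
    also have "\<dots> < of_int \<lfloor>s / \<Delta>\<rfloor> + 1" by linarith
    finally show "r / \<Delta> < of_int \<lfloor>s / \<Delta>\<rfloor> + 1" .
  qed
  then show ?thesis by (simp add: grid_point_def)
qed

lemma pred_countable_Bex:
  assumes "countable X" "\<And>i. i \<in> X \<Longrightarrow> Measurable.pred M (P i)"
  shows "Measurable.pred M (\<lambda>x. \<exists>i\<in>X. P i x)"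
proof -
  have "(\<Union>i\<in>X. {x \<in> space M. P i x}) \<in> sets M"
    using assms by (intro sets.countable_UN'') (auto simp: pred_def)
  also have "(\<Union>i\<in>X. {x \<in> space M. P i x}) = {x \<in> space M. \<exists>i\<in>X. P i x}" by auto
  finally show ?thesis by (simp add: pred_def)
qed

lemma pred_countable_Ball:
  assumes "countable X" "\<And>i. i \<in> X \<Longrightarrow> Measurable.pred M (P i)"
  shows "Measurable.pred M (\<lambda>x. \<forall>i\<in>X. P i x)"
proof -
  have "Measurable.pred M (\<lambda>x. \<not> (\<exists>i\<in>X. \<not> P i x))"
    using assms by (intro pred_intros_logic(2) pred_countable_Bex) auto
  then show ?thesis by simp
qed

context usual_filtered_prob_space
begin

text \<open>Only rational times are tested, to keep the event measurable; path continuity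
  extends the bounds to all times (lemma \<open>alive_bounds\<close>).\<close>

definition alive ::
    "(real \<Rightarrow> 'a \<Rightarrow> real ^ 'd) \<Rightarrow> (real \<Rightarrow> 'a \<Rightarrow> real ^ 'd) \<Rightarrow> real \<Rightarrow> real \<Rightarrow> real \<Rightarrow> real \<Rightarrow> 'a \<Rightarrow> bool"
  where
  "alive x y \<Delta> R \<eta> t \<omega> \<longleftrightarrow> (\<forall>r\<in>\<rat> \<inter> {0..T}. r = 0 \<or> r < t \<longrightarrow>
     norm (x r \<omega>) \<le> R \<and> norm (y r \<omega>) \<le> R \<and> norm (x r \<omega> - x (grid_point \<Delta> r) \<omega>) \<le> \<eta>)"

lemma adapted_measurable: "adapted F T X \<Longrightarrow> 0 \<le> s \<Longrightarrow> s \<le> t \<Longrightarrow> t \<le> T \<Longrightarrow> X s \<in> borel_measurable (F t)"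
  by (rule measurable_F_mono) (auto simp: adapted_def)

lemma adapted_measurable_M: "adapted F T X \<Longrightarrow> t \<in> {0..T} \<Longrightarrow> X t \<in> borel_measurable M"
  by (rule measurable_F_M) (auto simp: adapted_def)

text \<open>The strict \<open>r < t\<close> in \<open>alive\<close> gives left-continuity: a
  violation at \<open>r\<close> is already visible at the midpoint of \<open>r\<close> and
  \<open>t\<close>. Strictness alone would test nothing at \<open>t = 0\<close>, hence the clause
  \<open>r = 0\<close>, whose test is known at time 0.\<close>

lemma survival_alive:
  assumes x: "adapted F T x" and y: "adapted F T y" and \<Delta>: "0 < \<Delta>"
  shows "survival (alive x y \<Delta> R \<eta>)"
  unfolding survival_def
proof (intro conjI ballI allI impI)
  let ?Q = "\<lambda>r \<omega>. norm (x r \<omega>) \<le> R \<and> norm (y r \<omega>) \<le> R \<and> norm (x r \<omega> - x (grid_point \<Delta> r) \<omega>) \<le> \<eta>"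
  have Q: "Measurable.pred (F t) (?Q r)" if "0 \<le> r" "r \<le> t" "t \<le> T" for r t
  proof -
    have [measurable]: "x r \<in> borel_measurable (F t)" "y r \<in> borel_measurable (F t)"
      "x (grid_point \<Delta> r) \<in> borel_measurable (F t)"
      using grid_point_bounds[OF \<Delta> that(1)] that
      by (auto intro!: adapted_measurable[OF x] adapted_measurable[OF y])
    show ?thesis by measurable
  qed
  show "Measurable.pred (F t) (alive x y \<Delta> R \<eta> t)" if t: "t \<in> {0..T}" for t
    unfolding alive_def
  proof (rule pred_countable_Ball[OF countable_rationals_interval])
    fix r assume r: "r \<in> \<rat> \<inter> {0..T}"
    show "Measurable.pred (F t) (\<lambda>\<omega>. r = 0 \<or> r < t \<longrightarrow> ?Q r \<omega>)"
    proof (cases "r = 0 \<or> r < t")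
      case True
      then have "Measurable.pred (F t) (?Q r)" using r t by (intro Q) auto
      then show ?thesis using True by simp
    qed simp
  qed
  show "Measurable.pred (M \<Otimes>\<^sub>M time) (\<lambda>(\<omega>, t). alive x y \<Delta> R \<eta> t \<omega>)"
    unfolding alive_def split_beta'
  proof (rule pred_countable_Ball[OF countable_rationals_interval])
    fix r assume r: "r \<in> \<rat> \<inter> {0..T}"
    have q: "Measurable.pred M (?Q r)"
      using r T_pos measurable_F_M[OF _ Q[of r T]] by auto
    have t: "Measurable.pred time (\<lambda>t. r = 0 \<or> r < t)"
      by (intro measurable_restrict_space1) auto
    show "Measurable.pred (M \<Otimes>\<^sub>M time) (\<lambda>z. r = 0 \<or> r < snd z \<longrightarrow> ?Q r (fst z))"
      by (intro pred_intros_logic(4) measurable_compose[OF measurable_snd t] measurable_compose[OF measurable_fst q])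
  qed
  show "alive x y \<Delta> R \<eta> s \<omega>" if "0 \<le> s" "s \<le> t" "t \<le> T" "alive x y \<Delta> R \<eta> t \<omega>" for \<omega> s t
    using that unfolding alive_def by (meson order_less_le_trans)
  show "\<exists>s\<in>{0..<t}. \<not> alive x y \<Delta> R \<eta> s \<omega>"
    if t: "t \<in> {0<..T}" and dead: "\<not> alive x y \<Delta> R \<eta> t \<omega>" for \<omega> t
  proof -
    obtain r where r: "r \<in> \<rat> \<inter> {0..T}" "r = 0 \<or> r < t" "\<not> ?Q r \<omega>"
      using dead unfolding alive_def by blast
    show ?thesis
    proof (cases "r = 0")
      case True
      then have "\<not> alive x y \<Delta> R \<eta> 0 \<omega>" using r unfolding alive_def by blast
      then show ?thesis using t by auto
    next
      case False
      then have "r < (r + t) / 2" "(r + t) / 2 \<in> {0..<t}" using r t by auto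
      moreover from this have "\<not> alive x y \<Delta> R \<eta> ((r + t) / 2) \<omega>"
        using r unfolding alive_def by blast
      ultimately show ?thesis by blast
    qed
  qed
qed

lemma alive_bounds:
  assumes x: "continuous_on {0..T} (\<lambda>t. x t \<omega>)" and y: "continuous_on {0..T} (\<lambda>t. y t \<omega>)"
    and \<Delta>: "0 < \<Delta>" and \<eta>: "0 \<le> \<eta>" and t: "t \<in> {0..T}" and A: "alive x y \<Delta> R \<eta> t \<omega>"
  shows "norm (x t \<omega>) \<le> R" (is ?A)
    and "norm (y t \<omega>) \<le> R" (is ?B)
    and "norm (x t \<omega> - x (grid_point \<Delta> t) \<omega>) \<le> \<eta>" (is ?C)
proof -
  have rat: "norm (x r \<omega>) \<le> R" "norm (y r \<omega>) \<le> R" "norm (x r \<omega> - x (grid_point \<Delta> r) \<omega>) \<le> \<eta>"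
    if "r \<in> \<rat>" "0 \<le> r" "r = 0 \<or> r < t" for r
    using A that t unfolding alive_def by auto
  have "?A \<and> ?B \<and> ?C"
  proof (cases "t = 0")
    case True
    then show ?thesis using rat[of 0] by simp
  next
    case False
    then obtain q where q: "\<And>n. q n \<in> \<rat>" "\<And>n. 0 \<le> q n" "\<And>n. q n < t" "q \<longlonglongrightarrow> t"
      using rational_left_limit[of t] t by auto
    have qT: "q n \<in> {0..T}" for n using q(2,3)[of n] t by auto
    have xl: "(\<lambda>n. x (q n) \<omega>) \<longlonglongrightarrow> x t \<omega>"
      using t qT by (intro continuous_on_tendsto_compose[OF x q(4)]) auto
    have yl: "(\<lambda>n. y (q n) \<omega>) \<longlonglongrightarrow> y t \<omega>"
      using t qT by (intro continuous_on_tendsto_compose[OF y q(4)]) auto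
    have "norm (x t \<omega>) \<le> R"
      using rat(1)[OF q(1,2)] q(3) by (intro LIMSEQ_le_const2[OF tendsto_norm[OF xl]]) auto
    moreover have "norm (y t \<omega>) \<le> R"
      using rat(2)[OF q(1,2)] q(3) by (intro LIMSEQ_le_const2[OF tendsto_norm[OF yl]]) auto
    moreover have "norm (x t \<omega> - x (grid_point \<Delta> t) \<omega>) \<le> \<eta>"
    \<comment> \<open>\<open>grid_point\<close> jumps at grid points, so continuity does not apply
      there; but then the difference is 0. At any other \<open>t\<close> the approximating times
      eventually share the last grid point of \<open>t\<close>.\<close>
    proof (cases "grid_point \<Delta> t = t")
      case False
      then have "grid_point \<Delta> t < t" using grid_point_bounds[OF \<Delta>, of t] t by auto
      then have "\<forall>\<^sub>F n in sequentially. grid_point \<Delta> t < q n"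
        by (rule order_tendstoD(1)[OF q(4)])
      then have "\<forall>\<^sub>F n in sequentially. norm (x (q n) \<omega> - x (grid_point \<Delta> t) \<omega>) \<le> \<eta>"
      proof eventually_elim
        case (elim n)
        have "grid_point \<Delta> (q n) = grid_point \<Delta> t"
          using elim q(3)[of n] t by (intro grid_point_cong \<Delta>) auto
        then show ?case using rat(3)[OF q(1,2), of n] q(3)[of n] by simp
      qed
      then show ?thesis
        by (intro tendsto_upperbound[OF tendsto_norm[OF tendsto_diff[OF xl tendsto_const]]]) auto
    qed (use \<eta> in simp)
    ultimately show ?thesis by blast
  qed
  then show ?A ?B ?C by blast+
qed

text \<open>On the diagonal \<open>f\<close> and \<open>g\<close> are the coefficients of x, so both
  coefficient differences are increments of \<open>f\<close> and \<open>g\<close> between arguments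
  of norm at most \<open>R\<close>, and the local Lipschitz bound applies. The initial value cancels
  in the difference.\<close>

lemma error_process_alive:
  fixes W :: "real \<Rightarrow> 'a \<Rightarrow> real ^ 'm" and x y :: "real \<Rightarrow> 'a \<Rightarrow> real ^ 'd"
  assumes W: "wiener_process M F T W"
    and x: "sde_solution M F T W x0 a b x" and y: "semi_discrete_solution M F T W x0 f g \<Delta> y"
    and diag: "\<And>i u. f i u u = a u $ i" "\<And>i j u. g i j u u = b j u $ i"
    and \<Delta>: "0 < \<Delta>" and C: "0 \<le> C" and R: "0 \<le> R" and \<eta>: "0 \<le> \<eta>"
    and lip: "\<And>i j u1 u2 v1 v2. norm u1 \<le> R \<Longrightarrow> norm u2 \<le> R \<Longrightarrow> norm v1 \<le> R \<Longrightarrow> norm v2 \<le> R \<Longrightarrow>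
         \<bar>f i u1 v1 - f i u2 v2\<bar> + \<bar>g i j u1 v1 - g i j u2 v2\<bar>
           \<le> C * (norm (u1 - u2) + norm (v1 - v2))"
  obtains I where
    "error_process M F T (\<lambda>j t \<omega>. W t \<omega> $ j) (\<lambda>t \<omega>. y t \<omega> - x t \<omega>)
      (\<lambda>i s \<omega>. f i (y s \<omega>) (y (grid_point \<Delta> s) \<omega>) - a (x s \<omega>) $ i)
      (\<lambda>i j s \<omega>. g i j (y s \<omega>) (y (grid_point \<Delta> s) \<omega>) - b j (x s \<omega>) $ i)
      I (alive x y \<Delta> R \<eta>) C \<eta> (2 * R)"
proof -
  let ?\<alpha>x = "\<lambda>i s \<omega>. a (x s \<omega>) $ i" and ?\<alpha>y = "\<lambda>i s \<omega>. f i (y s \<omega>) (y (grid_point \<Delta> s) \<omega>)"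
  let ?\<beta> = "\<lambda>i j s \<omega>. g i j (y s \<omega>) (y (grid_point \<Delta> s) \<omega>) - b j (x s \<omega>) $ i"
  have xa: "adapted F T x" "ae_continuous M T x"
    "\<And>i. AE \<omega> in M. set_integrable lborel {0..T} (\<lambda>s. ?\<alpha>x i s \<omega>)"
    using x by (auto simp: sde_solution_def ito_process_def)
  have ya: "adapted F T y" "ae_continuous M T y"
    "\<And>i. AE \<omega> in M. set_integrable lborel {0..T} (\<lambda>s. ?\<alpha>y i s \<omega>)"
    using y by (auto simp: semi_discrete_solution_def ito_process_def)
  obtain Ix where Ix: "\<And>i j. ito_integral M F T (\<lambda>t \<omega>. W t \<omega> $ j) (\<lambda>t \<omega>. b j (x t \<omega>) $ i) (Ix i j)"
    "\<And>i. AE \<omega> in M. \<forall>t\<in>{0..T}. x t \<omega> $ i = x0 \<omega> $ i + (LINT s:{0..t}|lborel. ?\<alpha>x i s \<omega>) + (\<Sum>j\<in>UNIV. Ix i j t \<omega>)"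
    using x unfolding sde_solution_def ito_process_def by blast
  obtain Iy where Iy: "\<And>i j. ito_integral M F T (\<lambda>t \<omega>. W t \<omega> $ j)
      (\<lambda>t \<omega>. g i j (y t \<omega>) (y (grid_point \<Delta> t) \<omega>)) (Iy i j)"
    "\<And>i. AE \<omega> in M. \<forall>t\<in>{0..T}. y t \<omega> $ i = x0 \<omega> $ i + (LINT s:{0..t}|lborel. ?\<alpha>y i s \<omega>) + (\<Sum>j\<in>UNIV. Iy i j t \<omega>)"
    using y unfolding semi_discrete_solution_def ito_process_def by blast
  have driver: "scalar_wiener M F T (\<lambda>t \<omega>. W t \<omega> $ j)" for j
    by (rule scalar_wiener_component[OF W])
  have basis: "usual_filtered_prob_space M F T" ..
  show thesis
  proof (rule that[of "\<lambda>i j t \<omega>. Iy i j t \<omega> - Ix i j t \<omega>"],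
      rule error_process.intro[OF basis], rule error_process_axioms.intro)
    show "scalar_wiener M F T (\<lambda>t \<omega>. W t \<omega> $ j)" for j by (rule driver)
    show "(\<lambda>\<omega>. y t \<omega> - x t \<omega>) \<in> borel_measurable M" if "t \<in> {0..T}" for t
      using adapted_measurable_M[OF ya(1) that] adapted_measurable_M[OF xa(1) that]
      by (rule borel_measurable_diff)
    show "ae_continuous M T (\<lambda>t \<omega>. y t \<omega> - x t \<omega>)"
      using xa(2) ya(2) unfolding ae_continuous_def by eventually_elim (rule continuous_on_diff)
    show "survival (alive x y \<Delta> R \<eta>)" by (rule survival_alive[OF xa(1) ya(1) \<Delta>])
    show "AE \<omega> in M. set_integrable lborel {0..T} (\<lambda>s. ?\<alpha>y i s \<omega> - ?\<alpha>x i s \<omega>)" for i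
      using xa(3)[of i] ya(3)[of i] by eventually_elim (rule set_integral_diff)
    show "ito_limit (\<lambda>t \<omega>. W t \<omega> $ j)
      (?\<beta> i j) (\<lambda>t \<omega>. Iy i j t \<omega> - Ix i j t \<omega>)" for i j
      by (intro ito_limit_diff scalar_wiener.ito_integral_imp_limit[OF driver] Ix Iy)
    show "AE \<omega> in M. \<forall>t\<in>{0..T}. (y t \<omega> - x t \<omega>) $ i =
      (LINT s:{0..t}|lborel. ?\<alpha>y i s \<omega> - ?\<alpha>x i s \<omega>) + (\<Sum>j\<in>UNIV. Iy i j t \<omega> - Ix i j t \<omega>)" for i
      using xa(3)[of i] ya(3)[of i] Ix(2)[of i] Iy(2)[of i]
    proof eventually_elim
      case (elim \<omega>)
      show ?case
      proof
        fix t assume t: "t \<in> {0..T}"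
        have "set_integrable lborel {0..t} (\<lambda>s. ?\<alpha>y i s \<omega>)" "set_integrable lborel {0..t} (\<lambda>s. ?\<alpha>x i s \<omega>)"
          using t by (auto intro!: set_integrable_subset[OF elim(1)] set_integrable_subset[OF elim(2)])
        then have "(LINT s:{0..t}|lborel. ?\<alpha>y i s \<omega> - ?\<alpha>x i s \<omega>) =
            (LINT s:{0..t}|lborel. ?\<alpha>y i s \<omega>) - (LINT s:{0..t}|lborel. ?\<alpha>x i s \<omega>)"
          by (rule set_integral_diff(2))
        then show "(y t \<omega> - x t \<omega>) $ i =
            (LINT s:{0..t}|lborel. ?\<alpha>y i s \<omega> - ?\<alpha>x i s \<omega>) + (\<Sum>j\<in>UNIV. Iy i j t \<omega> - Ix i j t \<omega>)"
          using bspec[OF elim(3) t] bspec[OF elim(4) t] by (simp add: sum_subtractf)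
      qed
    qed
    show "AE \<omega> in M. \<forall>t\<in>{0..T}. alive x y \<Delta> R \<eta> t \<omega> \<longrightarrow> norm (y t \<omega> - x t \<omega>) \<le> 2 * R"
      using xa(2) ya(2) unfolding ae_continuous_def
    proof eventually_elim
      case (elim \<omega>)
      show ?case
      proof (intro ballI impI)
        fix t assume "t \<in> {0..T}" "alive x y \<Delta> R \<eta> t \<omega>"
        note b = alive_bounds[OF elim \<Delta> \<eta> this]
        show "norm (y t \<omega> - x t \<omega>) \<le> 2 * R"
          using b norm_triangle_ineq4[of "y t \<omega>" "x t \<omega>"] by linarith
      qed
    qed
    show "AE \<omega> in M. \<forall>s\<in>{0..T}. \<forall>\<rho>. alive x y \<Delta> R \<eta> s \<omega> \<longrightarrow> (\<forall>r\<in>{0..s}. norm (y r \<omega> - x r \<omega>) \<le> \<rho>) \<longrightarrow>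
      (\<forall>i. \<bar>?\<alpha>y i s \<omega> - ?\<alpha>x i s \<omega>\<bar> \<le> C * (2 * \<rho> + \<eta>)) \<and>
      (\<forall>i j. \<bar>?\<beta> i j s \<omega>\<bar> \<le> C * (2 * \<rho> + \<eta>))"
      using xa(2) ya(2) AE_space unfolding ae_continuous_def
    proof eventually_elim
      case (elim \<omega>)
      show ?case
      proof (intro ballI allI impI)
        fix s \<rho> assume s: "s \<in> {0..T}" and A: "alive x y \<Delta> R \<eta> s \<omega>" and \<rho>: "\<forall>r\<in>{0..s}. norm (y r \<omega> - x r \<omega>) \<le> \<rho>"
        let ?r = "grid_point \<Delta> s"
        have r: "?r \<in> {0..s}" "?r \<in> {0..T}" using grid_point_bounds[OF \<Delta>, of s] s by auto
        have "alive x y \<Delta> R \<eta> ?r \<omega>"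
          using survival_antimono[OF survival_alive[OF xa(1) ya(1) \<Delta>] elim(3) _ _ _ A] r s by auto
        note b = alive_bounds[OF elim(1,2) \<Delta> \<eta> s A] and b' = alive_bounds[OF elim(1,2) \<Delta> \<eta> r(2) this]
        \<comment> \<open>Split at the value of x at the grid point: the first part is the error at
          an earlier time, the second the oscillation of x.\<close>
        have "norm (y ?r \<omega> - x s \<omega>) = norm ((y ?r \<omega> - x ?r \<omega>) - (x s \<omega> - x ?r \<omega>))" by simp
        also have "\<dots> \<le> norm (y ?r \<omega> - x ?r \<omega>) + norm (x s \<omega> - x ?r \<omega>)" by (rule norm_triangle_ineq4)
        also have "\<dots> \<le> \<rho> + \<eta>" using bspec[OF \<rho> r(1)] b(3) by linarith
        finally have "norm (y s \<omega> - x s \<omega>) + norm (y ?r \<omega> - x s \<omega>) \<le> 2 * \<rho> + \<eta>"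
          using bspec[OF \<rho>, of s] s by simp
        then have "C * (norm (y s \<omega> - x s \<omega>) + norm (y ?r \<omega> - x s \<omega>)) \<le> C * (2 * \<rho> + \<eta>)"
          using C by (rule mult_left_mono)
        moreover have "\<bar>f i (y s \<omega>) (y ?r \<omega>) - f i (x s \<omega>) (x s \<omega>)\<bar> + \<bar>g i j (y s \<omega>) (y ?r \<omega>) - g i j (x s \<omega>) (x s \<omega>)\<bar>
            \<le> C * (norm (y s \<omega> - x s \<omega>) + norm (y ?r \<omega> - x s \<omega>))" for i j
          by (rule lip[OF b(2) b(1) b'(2) b(1)])
        ultimately have le: "\<bar>?\<alpha>y i s \<omega> - ?\<alpha>x i s \<omega>\<bar> + \<bar>?\<beta> i j s \<omega>\<bar>
            \<le> C * (2 * \<rho> + \<eta>)" for i j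
          unfolding diag by (rule order_trans[rotated])
        show "(\<forall>i. \<bar>?\<alpha>y i s \<omega> - ?\<alpha>x i s \<omega>\<bar> \<le> C * (2 * \<rho> + \<eta>)) \<and>
            (\<forall>i j. \<bar>?\<beta> i j s \<omega>\<bar> \<le> C * (2 * \<rho> + \<eta>))"
        proof (intro conjI allI)
          \<comment> \<open>The Lipschitz bound controls the sum of a drift and a noise difference,
            so any noise index serves here; \<open>undefined\<close> is one.\<close>
          show "\<bar>?\<alpha>y i s \<omega> - ?\<alpha>x i s \<omega>\<bar> \<le> C * (2 * \<rho> + \<eta>)" for i
            using le[of i undefined] by linarith
          show "\<bar>?\<beta> i j s \<omega>\<bar> \<le> C * (2 * \<rho> + \<eta>)" for i j
            using le[of i j] by linarith
        qed
      qed
    qed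
  qed (use C \<eta> R in auto)
qed

subsection \<open>Removing the stopping\<close>

text \<open>Here \<open>p > 2\<close> enters: beyond \<open>L\<close> the factor
  \<open>z powr (2 - p)\<close> is at most \<open>L powr (2 - p)\<close>. A large \<open>L\<close>
  makes the second term small in mean, and \<open>L\<^sup>2\<close> will be paid only on an event of
  small probability.\<close>

lemma square_le_truncation:
  fixes z L p :: real
  assumes "0 < L" "2 < p" "0 \<le> z"
  shows "z\<^sup>2 \<le> L\<^sup>2 + L powr (2 - p) * z powr p"
proof (cases "z \<le> L")
  case True
  then have "z\<^sup>2 \<le> L\<^sup>2" using assms by (intro power_mono) auto
  then show ?thesis by (simp add: add_increasing2)
next
  case False
  then have z: "0 < z" using assms by simp
  have "z\<^sup>2 = z powr (2 - p) * z powr p"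
    using z by (simp add: powr_add[symmetric] powr_numeral)
  also have "\<dots> \<le> L powr (2 - p) * z powr p"
    using False assms by (intro mult_right_mono powr_mono2') auto
  finally show ?thesis by (simp add: add_increasing)
qed

lemma norm_diff_powr_le:
  fixes u v :: "'b::real_normed_vector"
  assumes "0 < p"
  shows "norm (u - v) powr p \<le> 2 powr p * (norm u powr p + norm v powr p)"
proof -
  let ?m = "max (norm u) (norm v)"
  have "norm (u - v) \<le> 2 * ?m"
    using norm_triangle_ineq4[of u v] by linarith
  then have "norm (u - v) powr p \<le> (2 * ?m) powr p"
    using assms by (intro powr_mono2) auto
  also have "\<dots> = 2 powr p * ?m powr p" by (simp add: powr_mult max_def)
  also have "?m powr p \<le> norm u powr p + norm v powr p" by (simp add: max_def)
  finally show ?thesis by (simp add: mult_left_mono)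
qed

lemma tendsto_zero_ennrealI:
  fixes \<phi> :: "nat \<Rightarrow> ennreal"
  assumes "\<And>\<epsilon>. 0 < \<epsilon> \<Longrightarrow> \<forall>\<^sub>F n in sequentially. \<phi> n \<le> ennreal \<epsilon>"
  shows "\<phi> \<longlonglongrightarrow> 0"
proof (rule order_tendstoI)
  fix c :: ennreal assume "0 < c"
  then obtain d where d: "0 < d" "d < c" using dense by blast
  from d(2) have "d < top" by (rule less_le_trans) simp
  then have "d = ennreal (enn2real d)" by simp
  moreover from this d(1) have "0 < enn2real d" by (metis ennreal_less_zero_iff)
  ultimately have "d = ennreal (enn2real d)" "0 < enn2real d" .
  with assms[of "enn2real d"] have "\<forall>\<^sub>F n in sequentially. \<phi> n \<le> d" by simp
  then show "\<forall>\<^sub>F n in sequentially. \<phi> n < c"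
    by eventually_elim (use d in simp)
qed simp

text \<open>The part of the failure of \<open>alive\<close> whose probability is made small by
  \<Delta>; exits from the ball are made rare by \<open>R\<close>.\<close>

definition rough :: "(real \<Rightarrow> 'a \<Rightarrow> real ^ 'd) \<Rightarrow> real \<Rightarrow> real \<Rightarrow> 'a set" where
  "rough x \<Delta> \<eta> = {\<omega> \<in> space M. \<exists>r\<in>\<rat> \<inter> {0..T}. \<eta> < norm (x r \<omega> - x (grid_point \<Delta> r) \<omega>)}"

lemma rough_measurable:
  assumes "adapted F T x" "0 < \<Delta>"
  shows "rough x \<Delta> \<eta> \<in> sets M"
proof -
  have "Measurable.pred M (\<lambda>\<omega>. \<exists>r\<in>\<rat> \<inter> {0..T}. \<eta> < norm (x r \<omega> - x (grid_point \<Delta> r) \<omega>))"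
  proof (rule pred_countable_Bex[OF countable_rationals_interval])
    fix r assume r: "r \<in> \<rat> \<inter> {0..T}"
    then have "grid_point \<Delta> r \<in> {0..T}" using grid_point_bounds[OF assms(2), of r] by auto
    with r have [measurable]: "x r \<in> borel_measurable M" "x (grid_point \<Delta> r) \<in> borel_measurable M"
      by (auto intro!: adapted_measurable_M[OF assms(1)])
    show "Measurable.pred M (\<lambda>\<omega>. \<eta> < norm (x r \<omega> - x (grid_point \<Delta> r) \<omega>))" by measurable
  qed
  then show ?thesis by (simp add: rough_def pred_def)
qed

text \<open>Uniform continuity on a compact interval takes each continuous path out of the event for
  all sufficiently fine grids; dominated convergence turns this into a statement on
  probabilities.\<close>

lemma rough_tendsto_0:
  assumes x: "adapted F T x" "ae_continuous M T x" and \<eta>: "0 < \<eta>"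
  shows "(\<lambda>N. emeasure M (rough x (T / real (Suc N)) \<eta>)) \<longlonglongrightarrow> 0"
proof -
  have \<Delta>: "0 < T / real (Suc N)" for N using T_pos by simp
  note [measurable] = rough_measurable[OF x(1) \<Delta>]
  have "(\<lambda>N. \<integral>\<^sup>+\<omega>. indicator (rough x (T / real (Suc N)) \<eta>) \<omega> \<partial>M) \<longlonglongrightarrow> (\<integral>\<^sup>+\<omega>. 0 \<partial>M)"
  proof (rule nn_integral_dominated_convergence[where w="\<lambda>_. 1"])
    show "AE \<omega> in M. (\<lambda>N. indicator (rough x (T / real (Suc N)) \<eta>) \<omega> :: ennreal) \<longlonglongrightarrow> 0"
      using x(2) unfolding ae_continuous_def
    proof eventually_elim
      case (elim \<omega>)
      have "uniformly_continuous_on {0..T} (\<lambda>t. x t \<omega>)"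
        by (intro compact_uniformly_continuous elim) simp
      then obtain d where d: "0 < d"
        "\<And>s t. s \<in> {0..T} \<Longrightarrow> t \<in> {0..T} \<Longrightarrow> dist t s < d \<Longrightarrow> dist (x t \<omega>) (x s \<omega>) < \<eta>"
        using \<eta> unfolding uniformly_continuous_on_def by blast
      have "(\<lambda>N. T * inverse (real (Suc N))) \<longlonglongrightarrow> T * 0"
        by (intro tendsto_mult_left LIMSEQ_inverse_real_of_nat)
      then have "\<forall>\<^sub>F N in sequentially. T * inverse (real (Suc N)) < d"
        using d(1) by (intro order_tendstoD) auto
      then have "\<forall>\<^sub>F N in sequentially. (indicator (rough x (T / real (Suc N)) \<eta>) \<omega> :: ennreal) = 0"
      proof eventually_elim
        case (elim N)
        have "norm (x r \<omega> - x (grid_point (T / real (Suc N)) r) \<omega>) \<le> \<eta>" if r: "r \<in> {0..T}" for r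
        proof -
          let ?g = "grid_point (T / real (Suc N)) r"
          have g: "0 \<le> ?g" "?g \<le> r" "r < ?g + T / real (Suc N)"
            using grid_point_bounds[OF \<Delta>[of N], of r] r by auto
          then have "dist r ?g < d" using elim by (simp add: dist_real_def divide_inverse)
          then have "dist (x r \<omega>) (x ?g \<omega>) < \<eta>" using r g by (intro d(2)) auto
          then show ?thesis by (simp add: dist_norm)
        qed
        then show ?case by (fastforce simp: rough_def indicator_def not_less[symmetric])
      qed
      then show ?case by (rule tendsto_eventually)
    qed
    show "(\<lambda>\<omega>. indicator (rough x (T / real (Suc N)) \<eta>) \<omega> :: ennreal) \<in> borel_measurable M" for N
      by measurable
    show "AE \<omega> in M. (indicator (rough x (T / real (Suc N)) \<eta>) \<omega> :: ennreal) \<le> 1" for N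
      by (simp add: indicator_def)
  qed (simp_all add: emeasure_space_1)
  then show ?thesis
    by (simp only: nn_integral_indicator[OF rough_measurable[OF x(1) \<Delta>]] nn_integral_const mult_zero_left)
qed

lemma sup_powr_measurable:
  assumes "adapted F T (x :: real \<Rightarrow> 'a \<Rightarrow> real ^ 'd)"
  shows "(\<lambda>\<omega>. SUP t\<in>\<rat> \<inter> {0..T}. ennreal (norm (x t \<omega>) powr p)) \<in> borel_measurable M"
proof (rule borel_measurable_SUP[OF countable_rationals_interval])
  fix t assume "t \<in> \<rat> \<inter> {0..T}"
  then have [measurable]: "x t \<in> borel_measurable M" by (auto intro!: adapted_measurable_M[OF assms])
  show "(\<lambda>\<omega>. ennreal (norm (x t \<omega>) powr p)) \<in> borel_measurable M" by measurable
qed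

lemma sup_powr_markov:
  assumes x: "adapted F T (x :: real \<Rightarrow> 'a \<Rightarrow> real ^ 'd)" and R: "0 < R" and p: "0 < p"
    and moment: "(\<integral>\<^sup>+\<omega>. (SUP t\<in>{0..T}. ennreal (norm (x t \<omega>) powr p)) \<partial>M) \<le> ennreal A" "0 \<le> A"
  shows "emeasure M {\<omega> \<in> space M. \<exists>r\<in>\<rat> \<inter> {0..T}. R < norm (x r \<omega>)} \<le> ennreal (A / R powr p)"
proof -
  let ?X = "\<lambda>\<omega>. SUP t\<in>\<rat> \<inter> {0..T}. ennreal (norm (x t \<omega>) powr p)"
  note [measurable] = sup_powr_measurable[OF x]
  have "emeasure M {\<omega> \<in> space M. \<exists>r\<in>\<rat> \<inter> {0..T}. R < norm (x r \<omega>)}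
      \<le> emeasure M ({\<omega> \<in> space M. 1 \<le> ennreal (1 / R powr p) * ?X \<omega>} \<inter> space M)"
  proof (rule emeasure_mono)
    show "{\<omega> \<in> space M. \<exists>r\<in>\<rat> \<inter> {0..T}. R < norm (x r \<omega>)}
      \<subseteq> {\<omega> \<in> space M. 1 \<le> ennreal (1 / R powr p) * ?X \<omega>} \<inter> space M"
    proof clarsimp
      fix \<omega> r assume r: "r \<in> \<rat>" "0 \<le> r" "r \<le> T" "R < norm (x r \<omega>)"
      have "R powr p \<le> norm (x r \<omega>) powr p" using r R p by (intro powr_mono2) auto
      then have "1 \<le> 1 / R powr p * norm (x r \<omega>) powr p" using R by (simp add: field_simps)
      then have "ennreal 1 \<le> ennreal (1 / R powr p * norm (x r \<omega>) powr p)" by (rule ennreal_leI)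
      also have "\<dots> = ennreal (1 / R powr p) * ennreal (norm (x r \<omega>) powr p)" by (rule ennreal_mult') simp
      also have "\<dots> \<le> ennreal (1 / R powr p) * ?X \<omega>"
        using r by (intro mult_left_mono SUP_upper) auto
      finally show "1 \<le> ennreal (1 / R powr p) * ?X \<omega>" by simp
    qed
  qed measurable
  also have "\<dots> \<le> ennreal (1 / R powr p) * (\<integral>\<^sup>+\<omega>. ?X \<omega> * indicator (space M) \<omega> \<partial>M)"
    using nn_integral_Markov_inequality[of ?X "space M" M "ennreal (1 / R powr p)"]
    by (simp add: Int_commute Collect_conj_eq[symmetric])
  also have "(\<integral>\<^sup>+\<omega>. ?X \<omega> * indicator (space M) \<omega> \<partial>M) \<le> ennreal A"
  proof -
    have "(\<integral>\<^sup>+\<omega>. ?X \<omega> * indicator (space M) \<omega> \<partial>M) \<le> (\<integral>\<^sup>+\<omega>. (SUP t\<in>{0..T}. ennreal (norm (x t \<omega>) powr p)) \<partial>M)"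
      by (intro nn_integral_mono) (auto intro!: SUP_subset_mono)
    then show ?thesis using moment(1) by (rule order_trans)
  qed
  finally show ?thesis
    using moment(2) by (simp add: ennreal_mult'[symmetric] mult_left_mono)
qed

text \<open>At a time where the path is alive the error is counted in \<open>stopped\<close>.
  Otherwise the path lies in one of three bad events, and the error is truncated at
  \<open>L\<close>: Markov's inequality bounds the two exit events, and the moments bound the excess
  over \<open>L\<^sup>2\<close>.\<close>

lemma expected_error_le:
  fixes x y :: "real \<Rightarrow> 'a \<Rightarrow> real ^ 'd"
  assumes x: "adapted F T x" "ae_continuous M T x" and y: "adapted F T y" "ae_continuous M T y"
    and \<Delta>: "0 < \<Delta>" and R: "0 < R" and L: "0 < L" and p: "2 < p" and A: "0 \<le> A"
    and x_moment: "(\<integral>\<^sup>+\<omega>. (SUP t\<in>{0..T}. ennreal (norm (x t \<omega>) powr p)) \<partial>M) \<le> ennreal A"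
    and y_moment: "(\<integral>\<^sup>+\<omega>. (SUP t\<in>{0..T}. ennreal (norm (y t \<omega>) powr p)) \<partial>M) \<le> ennreal A"
    and stopped: "(\<integral>\<^sup>+\<omega>. (SUP t\<in>\<rat> \<inter> {0..T} \<inter> {..T}. if alive x y \<Delta> R \<eta> t \<omega>
      then ennreal ((norm (y t \<omega> - x t \<omega>))\<^sup>2) else 0) \<partial>M) \<le> ennreal q"
    and q: "0 \<le> q"
  shows "(\<integral>\<^sup>+\<omega>. (SUP t\<in>{0..T}. ennreal ((norm (y t \<omega> - x t \<omega>))\<^sup>2)) \<partial>M) \<le>
    ennreal (q + 2 * L\<^sup>2 * A / R powr p + 2 * L powr (2 - p) * 2 powr p * A)
      + ennreal (L\<^sup>2) * emeasure M (rough x \<Delta> \<eta>)"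
proof -
  let ?S = "\<lambda>\<omega>. SUP t\<in>\<rat> \<inter> {0..T} \<inter> {..T}. if alive x y \<Delta> R \<eta> t \<omega> then ennreal ((norm (y t \<omega> - x t \<omega>))\<^sup>2) else 0"
  let ?X = "\<lambda>\<omega>. SUP t\<in>\<rat> \<inter> {0..T}. ennreal (norm (x t \<omega>) powr p)"
  let ?Y = "\<lambda>\<omega>. SUP t\<in>\<rat> \<inter> {0..T}. ennreal (norm (y t \<omega>) powr p)"
  let ?c = "L powr (2 - p) * 2 powr p"
  define Dx where "Dx = {\<omega> \<in> space M. \<exists>r\<in>\<rat> \<inter> {0..T}. R < norm (x r \<omega>)}"
  define Dy where "Dy = {\<omega> \<in> space M. \<exists>r\<in>\<rat> \<inter> {0..T}. R < norm (y r \<omega>)}"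
  let ?U = "\<lambda>\<omega>. ?S \<omega> + ennreal (L\<^sup>2) * (indicator Dx \<omega> + indicator Dy \<omega> + indicator (rough x \<Delta> \<eta>) \<omega>)
    + ennreal ?c * (?Y \<omega> + ?X \<omega>)"
  have exceed: "{\<omega> \<in> space M. \<exists>r\<in>\<rat> \<inter> {0..T}. R < norm (z r \<omega>)} \<in> sets M" if "adapted F T z"
    for z :: "real \<Rightarrow> 'a \<Rightarrow> real ^ 'd"
  proof -
    have "Measurable.pred M (\<lambda>\<omega>. \<exists>r\<in>\<rat> \<inter> {0..T}. R < norm (z r \<omega>))"
    proof (rule pred_countable_Bex[OF countable_rationals_interval])
      fix r assume "r \<in> \<rat> \<inter> {0..T}"
      then have [measurable]: "z r \<in> borel_measurable M" by (auto intro!: adapted_measurable_M[OF that])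
      show "Measurable.pred M (\<lambda>\<omega>. R < norm (z r \<omega>))" by measurable
    qed
    then show ?thesis by (simp add: pred_def)
  qed
  have [measurable]: "Dx \<in> sets M" "Dy \<in> sets M" "rough x \<Delta> \<eta> \<in> sets M"
    unfolding Dx_def Dy_def using exceed x(1) y(1) rough_measurable[OF x(1) \<Delta>] by auto
  have [measurable]: "?S \<in> borel_measurable M"
  proof (rule borel_measurable_SUP)
    show "countable (\<rat> \<inter> {0..T} \<inter> {..T})" using countable_rat by auto
    fix t assume t: "t \<in> \<rat> \<inter> {0..T} \<inter> {..T}"
    have [measurable]: "x t \<in> borel_measurable M" "y t \<in> borel_measurable M"
      using t adapted_measurable_M[OF x(1), of t] adapted_measurable_M[OF y(1), of t] by auto
    have [measurable]: "Measurable.pred M (alive x y \<Delta> R \<eta> t)"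
      using t survival_measurable[OF survival_alive[OF x(1) y(1) \<Delta>], of t] by auto
    show "(\<lambda>\<omega>. if alive x y \<Delta> R \<eta> t \<omega> then ennreal ((norm (y t \<omega> - x t \<omega>))\<^sup>2) else 0) \<in> borel_measurable M"
      by measurable
  qed
  note [measurable] = sup_powr_measurable[OF x(1), of p] sup_powr_measurable[OF y(1), of p]
  have split: "(\<integral>\<^sup>+\<omega>. S \<omega> + ennreal (L\<^sup>2) * (indicator Dx \<omega> + indicator Dy \<omega> + indicator (rough x \<Delta> \<eta>) \<omega>)
      + ennreal ?c * (Y \<omega> + X \<omega>) \<partial>M) = (\<integral>\<^sup>+\<omega>. S \<omega> \<partial>M)
      + ennreal (L\<^sup>2) * (emeasure M Dx + emeasure M Dy + emeasure M (rough x \<Delta> \<eta>))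
      + ennreal ?c * ((\<integral>\<^sup>+\<omega>. Y \<omega> \<partial>M) + (\<integral>\<^sup>+\<omega>. X \<omega> \<partial>M))"
    if [measurable]: "S \<in> borel_measurable M" "Y \<in> borel_measurable M" "X \<in> borel_measurable M" for S X Y
    by (simp add: nn_integral_add nn_integral_cmult)
  have "(\<integral>\<^sup>+\<omega>. (SUP t\<in>{0..T}. ennreal ((norm (y t \<omega> - x t \<omega>))\<^sup>2)) \<partial>M) \<le>
    (\<integral>\<^sup>+\<omega>. ?U \<omega> \<partial>M)"
  proof (rule nn_integral_mono_AE)
    show "AE \<omega> in M. (SUP t\<in>{0..T}. ennreal ((norm (y t \<omega> - x t \<omega>))\<^sup>2)) \<le>
      ?U \<omega>"
      using x(2) y(2) AE_space unfolding ae_continuous_def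
    proof eventually_elim
      case (elim \<omega>)
      have "(SUP t\<in>{0..T}. ennreal ((norm (y t \<omega> - x t \<omega>))\<^sup>2)) = (SUP t\<in>\<rat> \<inter> {0..T}. ennreal ((norm (y t \<omega> - x t \<omega>))\<^sup>2))"
        by (intro SUP_ennreal_rationals continuous_intros elim)
      also have "\<dots> \<le> ?U \<omega>"
      proof (rule SUP_least)
        fix t assume t: "t \<in> \<rat> \<inter> {0..T}"
        show "ennreal ((norm (y t \<omega> - x t \<omega>))\<^sup>2) \<le>
          ?U \<omega>"
        proof (cases "alive x y \<Delta> R \<eta> t \<omega>")
          case True
          have "ennreal ((norm (y t \<omega> - x t \<omega>))\<^sup>2) \<le> ?S \<omega>"
            by (rule SUP_upper2[of t]) (use t True in auto)
          then show ?thesis by (simp add: add_increasing2 add.assoc)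
        next
          case False
          then have "\<omega> \<in> Dx \<or> \<omega> \<in> Dy \<or> \<omega> \<in> rough x \<Delta> \<eta>"
            using elim(3) unfolding alive_def Dx_def Dy_def rough_def by (auto simp: not_le)
          then have ind: "1 \<le> (indicator Dx \<omega> + indicator Dy \<omega> + indicator (rough x \<Delta> \<eta>) \<omega> :: ennreal)"
            by (auto simp: add_increasing add_increasing2)
          let ?z = "norm (y t \<omega> - x t \<omega>)"
          have "?z\<^sup>2 \<le> L\<^sup>2 + L powr (2 - p) * ?z powr p"
            using L p by (intro square_le_truncation) auto
          also have "\<dots> \<le> L\<^sup>2 + L powr (2 - p) * (2 powr p * (norm (y t \<omega>) powr p + norm (x t \<omega>) powr p))"
            using p by (intro add_left_mono mult_left_mono norm_diff_powr_le) auto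
          finally have "ennreal (?z\<^sup>2) \<le> ennreal (L\<^sup>2 + ?c * (norm (y t \<omega>) powr p + norm (x t \<omega>) powr p))"
            by (intro ennreal_leI) (simp add: mult.assoc)
          also have "\<dots> = ennreal (L\<^sup>2) * 1 + ennreal ?c * (ennreal (norm (y t \<omega>) powr p) + ennreal (norm (x t \<omega>) powr p))"
            by (simp add: ennreal_mult')
          also have "\<dots> \<le> ennreal (L\<^sup>2) * (indicator Dx \<omega> + indicator Dy \<omega> + indicator (rough x \<Delta> \<eta>) \<omega>)
              + ennreal ?c * (?Y \<omega> + ?X \<omega>)"
            using t by (intro add_mono mult_left_mono ind SUP_upper) auto
          finally show ?thesis by (simp add: add_increasing add.assoc)
        qed
      qed
      finally show ?case .
    qed
  qed
  also have "\<dots> = (\<integral>\<^sup>+\<omega>. ?S \<omega> \<partial>M)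
      + ennreal (L\<^sup>2) * (emeasure M Dx + emeasure M Dy + emeasure M (rough x \<Delta> \<eta>))
      + ennreal ?c * ((\<integral>\<^sup>+\<omega>. ?Y \<omega> \<partial>M) + (\<integral>\<^sup>+\<omega>. ?X \<omega> \<partial>M))"
    by (rule split) measurable
  also have "\<dots> \<le> ennreal q
      + ennreal (L\<^sup>2) * (ennreal (A / R powr p) + ennreal (A / R powr p) + emeasure M (rough x \<Delta> \<eta>))
      + ennreal ?c * (ennreal A + ennreal A)"
  proof (intro add_mono mult_left_mono order_refl stopped)
    show "emeasure M Dx \<le> ennreal (A / R powr p)" "emeasure M Dy \<le> ennreal (A / R powr p)"
      unfolding Dx_def Dy_def using p by (intro sup_powr_markov x y R x_moment y_moment A; simp)+
    have le: "(SUP t\<in>\<rat> \<inter> {0..T}. \<phi> t) \<le> (SUP t\<in>{0..T}. \<phi> t)" for \<phi> :: "real \<Rightarrow> ennreal"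
      by (intro SUP_subset_mono) auto
    show "(\<integral>\<^sup>+\<omega>. ?Y \<omega> \<partial>M) \<le> ennreal A"
      by (rule order_trans[OF nn_integral_mono[OF le] y_moment])
    show "(\<integral>\<^sup>+\<omega>. ?X \<omega> \<partial>M) \<le> ennreal A"
      by (rule order_trans[OF nn_integral_mono[OF le] x_moment])
  qed auto
  also have "\<dots> = ennreal (q + 2 * L\<^sup>2 * A / R powr p + 2 * L powr (2 - p) * 2 powr p * A)
      + ennreal (L\<^sup>2) * emeasure M (rough x \<Delta> \<eta>)"
  proof -
    have "ennreal (q + 2 * L\<^sup>2 * A / R powr p + 2 * L powr (2 - p) * 2 powr p * A) =
        ennreal (q + L\<^sup>2 * (A / R powr p + A / R powr p) + ?c * (A + A))"
      by (intro arg_cong[where f=ennreal]) (simp add: algebra_simps)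
    also have "\<dots> = ennreal q + ennreal (L\<^sup>2) * (ennreal (A / R powr p) + ennreal (A / R powr p))
        + ennreal ?c * (ennreal A + ennreal A)"
    proof -
      have "ennreal (q + l * (r + r) + c * (A + A)) =
          ennreal q + ennreal l * (ennreal r + ennreal r) + ennreal c * (ennreal A + ennreal A)"
        if "0 \<le> l" "0 \<le> r" "0 \<le> c" for l r c
        using that q A by (simp only: ennreal_plus ennreal_mult add_nonneg_nonneg mult_nonneg_nonneg)
      then show ?thesis by this (use A in auto)
    qed
    finally show ?thesis by (simp only: distrib_left add_ac)
  qed
  finally show ?thesis .
qed

end

section \<open>Choice of the parameters and passage to the limit\<close>

theorem theorem1:
  fixes M :: "'a measure" and F :: "real \<Rightarrow> 'a measure" and T :: real
    and W :: "real \<Rightarrow> 'a \<Rightarrow> real ^ 'm"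
    and x0 :: "'a \<Rightarrow> real ^ 'd"
    and a :: "real ^ 'd \<Rightarrow> real ^ 'd" and b :: "'m \<Rightarrow> real ^ 'd \<Rightarrow> real ^ 'd"
    and f :: "'d \<Rightarrow> real ^ 'd \<Rightarrow> real ^ 'd \<Rightarrow> real"
    and g :: "'d \<Rightarrow> 'm \<Rightarrow> real ^ 'd \<Rightarrow> real ^ 'd \<Rightarrow> real"
    and x :: "real \<Rightarrow> 'a \<Rightarrow> real ^ 'd" and y :: "nat \<Rightarrow> real \<Rightarrow> 'a \<Rightarrow> real ^ 'd"
    and p A :: real
  assumes basis: "usual_filtered_prob_space M F T"
    and wiener: "wiener_process M F T W"
    and x0_measurable: "x0 \<in> borel_measurable (F 0)"
    and x_solution: "sde_solution M F T W x0 a b x"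
    and f_diag: "\<And>i u. f i u u = a u $ i"
    and g_diag: "\<And>i j u. g i j u u = b j u $ i"
    and locally_lipschitz:
      "\<And>R. 0 < R \<Longrightarrow> \<exists>C. \<forall>i j u1 u2 v1 v2.
         norm u1 \<le> R \<longrightarrow> norm u2 \<le> R \<longrightarrow> norm v1 \<le> R \<longrightarrow> norm v2 \<le> R \<longrightarrow>
         \<bar>f i u1 v1 - f i u2 v2\<bar> + \<bar>g i j u1 v1 - g i j u2 v2\<bar>
           \<le> C * (norm (u1 - u2) + norm (v1 - v2))"
    and y_solution:
      "\<And>N. 1 \<le> N \<Longrightarrow> unique_semi_discrete_solution M F T W x0 f g (T / real N) (y N)"
    and p_gt_2: "2 < p" and A_pos: "0 < A"
    and x0_moment: "(\<integral>\<^sup>+\<omega>. ennreal (norm (x0 \<omega>) powr p) \<partial>M) < ennreal A"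
    and x_moment: "(\<integral>\<^sup>+\<omega>. (SUP t\<in>{0..T}. ennreal (norm (x t \<omega>) powr p)) \<partial>M) < ennreal A"
    and y_moment: "\<And>N. 1 \<le> N \<Longrightarrow>
      (\<integral>\<^sup>+\<omega>. (SUP t\<in>{0..T}. ennreal (norm (y N t \<omega>) powr p)) \<partial>M) < ennreal A"
  shows "(\<lambda>N. \<integral>\<^sup>+\<omega>. (SUP t\<in>{0..T}. ennreal ((norm (y N t \<omega> - x t \<omega>))\<^sup>2)) \<partial>M) \<longlonglongrightarrow> 0"
proof -
  interpret usual_filtered_prob_space M F T by (rule basis)
  have x: "adapted F T x" "ae_continuous M T x"
    using x_solution by (auto simp: sde_solution_def ito_process_def)
  have semi: "semi_discrete_solution M F T W x0 f g (T / real (Suc N)) (y (Suc N))" for N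
    using y_solution[of "Suc N"] by (simp add: unique_semi_discrete_solution_def)
  have y: "adapted F T (y (Suc N))" "ae_continuous M T (y (Suc N))" for N
    using semi[of N] by (auto simp: semi_discrete_solution_def ito_process_def)
  have \<Delta>: "0 < T / real (Suc N)" for N using T_pos by simp
  \<comment> \<open>Shifted by one because the hypotheses on the approximations start at index
    1.\<close>
  have "(\<lambda>N. \<integral>\<^sup>+\<omega>. (SUP t\<in>{0..T}. ennreal ((norm (y (Suc N) t \<omega> - x t \<omega>))\<^sup>2)) \<partial>M) \<longlonglongrightarrow> 0"
  proof (rule tendsto_zero_ennrealI)
    fix \<epsilon> :: real assume \<epsilon>: "0 < \<epsilon>"
    \<comment> \<open>Each of the four terms of \<open>expected_error_le\<close> is to cost at most
      \<open>\<epsilon> / 4\<close>. The level \<open>L\<close> comes first, as its term involves no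
      other parameter.\<close>
    have "((\<lambda>L. 2 * L powr (2 - p) * 2 powr p * A) \<longlongrightarrow> 2 * 0 * 2 powr p * A) at_top"
      using p_gt_2 by (intro tendsto_intros tendsto_neg_powr filterlim_ident) auto
    then have "\<forall>\<^sub>F L in at_top. 2 * L powr (2 - p) * 2 powr p * A < \<epsilon> / 4"
      using \<epsilon> by (intro order_tendstoD) auto
    then have "\<forall>\<^sub>F L in at_top. 0 < L \<and> 2 * L powr (2 - p) * 2 powr p * A < \<epsilon> / 4"
      using eventually_gt_at_top[of 0] by eventually_elim simp
    then obtain L where L: "0 < L" "2 * L powr (2 - p) * 2 powr p * A < \<epsilon> / 4"
      using eventually_happens'[OF trivial_limit_at_top_linorder] by blast
    \<comment> \<open>With \<open>L\<close> fixed, the exit probabilities weighted by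
      \<open>L\<^sup>2\<close> vanish for large \<open>R\<close>, uniformly in \<Delta>, since
      \<open>A\<close> bounds all the moments.\<close>
    have "((\<lambda>R. 2 * L\<^sup>2 * A * R powr (- p)) \<longlongrightarrow> 2 * L\<^sup>2 * A * 0) at_top"
      using p_gt_2 by (intro tendsto_intros tendsto_neg_powr filterlim_ident) auto
    then have "\<forall>\<^sub>F R in at_top. 2 * L\<^sup>2 * A * R powr (- p) < \<epsilon> / 4"
      using \<epsilon> by (intro order_tendstoD) auto
    then have "\<forall>\<^sub>F R in at_top. 0 < R \<and> 2 * L\<^sup>2 * A * R powr (- p) < \<epsilon> / 4"
      using eventually_gt_at_top[of 0] by eventually_elim simp
    then obtain R where R: "0 < R" "2 * L\<^sup>2 * A * R powr (- p) < \<epsilon> / 4"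
      using eventually_happens'[OF trivial_limit_at_top_linorder] by blast
    obtain C0 where C0: "\<And>i j u1 u2 v1 v2.
         norm u1 \<le> R \<Longrightarrow> norm u2 \<le> R \<Longrightarrow> norm v1 \<le> R \<Longrightarrow> norm v2 \<le> R \<Longrightarrow>
         \<bar>f i u1 v1 - f i u2 v2\<bar> + \<bar>g i j u1 v1 - g i j u2 v2\<bar>
           \<le> C0 * (norm (u1 - u2) + norm (v1 - v2))"
      using locally_lipschitz[OF R(1)] by blast
    \<comment> \<open>The hypothesis gives a constant without a sign; the error process asks for a
      nonnegative one.\<close>
    define C where "C = max 0 C0"
    have C: "\<bar>f i u1 v1 - f i u2 v2\<bar> + \<bar>g i j u1 v1 - g i j u2 v2\<bar> \<le> C * (norm (u1 - u2) + norm (v1 - v2))"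
      if "norm u1 \<le> R" "norm u2 \<le> R" "norm v1 \<le> R" "norm v2 \<le> R" for i j u1 u2 v1 v2
    proof -
      have "C0 * (norm (u1 - u2) + norm (v1 - v2)) \<le> C * (norm (u1 - u2) + norm (v1 - v2))"
        by (intro mult_right_mono) (auto simp: C_def)
      with C0[OF that, of i j] show ?thesis by linarith
    qed
    let ?\<sigma> = "step_size T CARD('d) CARD('m) C"
    have "0 \<le> noise_const T CARD('d) CARD('m)" using T_pos by (simp add: noise_const_def)
    then have \<sigma>: "0 < ?\<sigma>" by (simp add: step_size_def add_nonneg_pos)
    \<comment> \<open>The extra 1 pays for the first step of the iteration, which only reaches time
      0.\<close>
    define k where "k = nat \<lceil>T / ?\<sigma>\<rceil> + 1"
    have "T / ?\<sigma> \<le> real k - 1" unfolding k_def by (simp add: of_nat_ceiling)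
    then have k: "T \<le> (real k - 1) * ?\<sigma>" using \<sigma> by (simp add: field_simps)
    define K where "K = max 0 (error_const T CARD('d) CARD('m) C k)"
    \<comment> \<open>Solves \<open>(K + 1) * \<eta>\<^sup>2 = \<epsilon> / 4\<close>; the added 1
      keeps the quotient defined when \<open>K = 0\<close>. This is possible because
      \<open>K\<close> was fixed without reference to \<open>\<eta>\<close>.\<close>
    define \<eta> where "\<eta> = sqrt (\<epsilon> / (4 * (K + 1)))"
    have K0: "0 \<le> K" by (simp add: K_def)
    have \<eta>: "0 < \<eta>" "K * \<eta>\<^sup>2 \<le> \<epsilon> / 4"
      using \<epsilon> K0 by (auto simp: \<eta>_def field_simps)
    have stopped: "(\<integral>\<^sup>+\<omega>. (SUP t\<in>\<rat> \<inter> {0..T} \<inter> {..T}. if alive x (y (Suc N)) (T / real (Suc N)) R \<eta> t \<omega>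
      then ennreal ((norm (y (Suc N) t \<omega> - x t \<omega>))\<^sup>2) else 0) \<partial>M) \<le> ennreal (K * \<eta>\<^sup>2)" for N
    proof -
      let ?\<alpha> = "\<lambda>i s \<omega>. f i (y (Suc N) s \<omega>) (y (Suc N) (grid_point (T / real (Suc N)) s) \<omega>) - a (x s \<omega>) $ i"
        and ?\<beta> = "\<lambda>i j s \<omega>. g i j (y (Suc N) s \<omega>) (y (Suc N) (grid_point (T / real (Suc N)) s) \<omega>) - b j (x s \<omega>) $ i"
      obtain I where "error_process M F T (\<lambda>j t \<omega>. W t \<omega> $ j) (\<lambda>t \<omega>. y (Suc N) t \<omega> - x t \<omega>)
        ?\<alpha> ?\<beta>
        I (alive x (y (Suc N)) (T / real (Suc N)) R \<eta>) C \<eta> (2 * R)"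
      proof (rule error_process_alive[OF wiener x_solution semi f_diag g_diag \<Delta>])
        show "0 \<le> C" by (simp add: C_def)
        show "0 \<le> R" "0 \<le> \<eta>" using R \<eta> by auto
      qed (use C in auto)
      then interpret E: error_process M F T "\<lambda>j t \<omega>. W t \<omega> $ j" "\<lambda>t \<omega>. y (Suc N) t \<omega> - x t \<omega>" ?\<alpha> ?\<beta>
        I "alive x (y (Suc N)) (T / real (Suc N)) R \<eta>" C \<eta> "2 * R" .
      note E.expected_err_bound[OF k]
      also have "ennreal (error_const T CARD('d) CARD('m) C k * \<eta>\<^sup>2) \<le> ennreal (K * \<eta>\<^sup>2)"
        by (intro ennreal_leI mult_right_mono) (auto simp: K_def)
      finally show ?thesis unfolding E.err_def .
    qed
    have le: "(\<integral>\<^sup>+\<omega>. (SUP t\<in>{0..T}. ennreal ((norm (y (Suc N) t \<omega> - x t \<omega>))\<^sup>2)) \<partial>M) \<le>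
      ennreal (K * \<eta>\<^sup>2 + 2 * L\<^sup>2 * A / R powr p + 2 * L powr (2 - p) * 2 powr p * A)
      + ennreal (L\<^sup>2) * emeasure M (rough x (T / real (Suc N)) \<eta>)" for N
      using x_moment y_moment[of "Suc N"] A_pos K0
      by (intro expected_error_le x y \<Delta> R L p_gt_2 stopped) (auto intro: less_imp_le)
    \<comment> \<open>Only the grid is left to choose: with \<open>L\<close> and
      \<open>\<eta>\<close> fixed, the oscillation term takes the last quarter of
      \<open>\<epsilon>\<close> for fine grids.\<close>
    have "(\<lambda>N. ennreal (L\<^sup>2) * emeasure M (rough x (T / real (Suc N)) \<eta>)) \<longlonglongrightarrow> ennreal (L\<^sup>2) * 0"
      by (intro ennreal_tendsto_cmult rough_tendsto_0 x \<eta>) simp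
    then have lim: "(\<lambda>N. ennreal (L\<^sup>2) * emeasure M (rough x (T / real (Suc N)) \<eta>)) \<longlonglongrightarrow> 0"
      by (simp only: mult_zero_right)
    have "\<forall>\<^sub>F N in sequentially. ennreal (L\<^sup>2) * emeasure M (rough x (T / real (Suc N)) \<eta>) < ennreal (\<epsilon> / 4)"
      by (rule order_tendstoD(2)[OF lim]) (use \<epsilon> in simp)
    then show "\<forall>\<^sub>F N in sequentially.
        (\<integral>\<^sup>+\<omega>. (SUP t\<in>{0..T}. ennreal ((norm (y (Suc N) t \<omega> - x t \<omega>))\<^sup>2)) \<partial>M) \<le> ennreal \<epsilon>"
    proof eventually_elim
      case (elim N)
      have "K * \<eta>\<^sup>2 + 2 * L\<^sup>2 * A / R powr p + 2 * L powr (2 - p) * 2 powr p * A \<le> 3 * (\<epsilon> / 4)"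
        using \<eta>(2) L(2) R(2) unfolding powr_minus divide_inverse by linarith
      then have "ennreal (K * \<eta>\<^sup>2 + 2 * L\<^sup>2 * A / R powr p + 2 * L powr (2 - p) * 2 powr p * A)
          + ennreal (L\<^sup>2) * emeasure M (rough x (T / real (Suc N)) \<eta>) \<le> ennreal (3 * (\<epsilon> / 4)) + ennreal (\<epsilon> / 4)"
        using elim by (intro add_mono ennreal_leI) auto
      also have "\<dots> = ennreal \<epsilon>" using \<epsilon> by (simp flip: ennreal_plus)
      finally show ?case using le[of N] by (rule order_trans[rotated])
    qed
  qed
  then show ?thesis by (rule LIMSEQ_imp_Suc)
qed

end
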